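(* Let $\mathcal{D}=(G,\chi,a,\alpha)$ be a datum and let $H_{\mathcal{D}}$ be the rank one pointed Hopf algebra associated with $\mathcal{D}$. (Direct part) Let $\mathcal{H}=(H_{\mathcal{D}},\cdot,\mathbin{:})$ be a Hopf $q$-brace structure on $H_{\mathcal{D}}$ and assume that $x\cdot x=x\mathbin{:}x=0$. Then $\mathcal{H}$ induces by restriction a $q$-brace structure on $G$ such that $a\cdot g=a\mathbin{:}g=a$ and $g\cdot a=g\mathbin{:}a=g$, for all $g\in G$. Also, there exist $\mathds{k}^{\times}$-valued characters $\lambda$ and $\xi$ of $G$ satisfying 1) $\lambda(a)=\xi^{-1}(a)$, 2) $\lambda(h(l\mathbin{:}h))=\lambda(l(h\cdot l))$ for all $h,l\in G$, 3) $\lambda(h)\xi(l\cdot h)=\xi(l)\lambda(h\mathbin{:}l)$ for all $h,l\in G$, 4) $\xi(l(h\cdot l))=\xi(h(l\mathbin{:}h))$ for all $h,l\in G$, 5) $\chi(h)\lambda(l)=\lambda(l\mathbin{:}h)\chi(h\cdot l)$ for all $h,l\in G$, 6) $\chi(h)\xi(l)=\xi(l\cdot h)\chi(h\mathbin{:}l)$ for all $h,l\in G$, such that, for all $h,g\in G$ and $j,j'\in\mathbb{N}_0$, $$(\ast)\qquad hx^{j}\cdot gx^{j'}=\begin{cases}\lambda^{j}(g)(h\cdot g)x^{j}&\text{if }j'=0,\\0&\text{otherwise,}\end{cases}\qquad\text{and}\qquad hx^{j}\mathbin{:}gx^{j'}=\begin{cases}\xi^{j}(g)(h\mathbin{:}g)x^{j}&\text{if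 }j'=0,\\0&\text{otherwise.}\end{cases}$$ (Converse) Conversely, given a $q$-brace structure on $G$ such that $a\cdot g=a\mathbin{:}g=a$ and $g\cdot a=g\mathbin{:}a=g$, for all $g\in G$, and $\mathds{k}^{\times}$-valued characters $\lambda$ and $\xi$ of $G$ satisfying items 1)--6), the Hopf algebra $H_{\mathcal{D}}$ is a Hopf $q$-brace via the formulas $(\ast)$.
   Context: $\mathds{k}$ is an algebraically closed field of characteristic zero, $\mathbb{N}_0=\{0,1,2,\dots\}$. Sweedler notation is used. Multiplication has precedence over the binary operations $\cdot$ and $\mathbin{:}$, which have precedence over $+$ and $-$. For a character $\lambda$, $\lambda^j(g)=\lambda(g)^j$. Rank one pointed Hopf algebras. A datum $\mathcal{D}=(G,\chi,a,\alpha)$ consists of a finite group $G$, a character $\chi\colon G\to\mathds{k}^{\times}$, a central element $a\in G$ and $\alpha\in\mathds{k}$ such that, denoting by $n$ the order of $\chi(a)$, one has $n>1$ and ($\alpha(a^n-1)=0$ in $\mathds{k}[G]$ or $\chi^n=1$). $H_{\mathcal{D}}$ is the Hopf algebra generated as an algebra by $G$ and $x$, subject to the group relations of $G$, $x^n=\alpha(a^n-1)$ and $xg=\chi(g)gx$ for $g\in G$, with $\Delta(x)=x\otimes a+1\otimes x$, $\Delta(g)=g\otimes g$ (so $\epsilon(g)=1$, $\epsilon(x)=0$). It has $\mathds{k}$-basis $\{gx^m: g\in G,\ 0\le m<n\}$. Hopf $q$-braces. Let $X$ be a coalgebra and $p,d\colon X\otimes X\to X$ linear maps with $\epsilon\circ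 p=\epsilon\circ d=\epsilon\otimes\epsilon$; write $x\cdot y=p(x\otimes y)$, $x\mathbin{:}y=d(x\otimes y)$. $(X,\cdot,\mathbin{:})$ is a $q$-magma coalgebra if the map $X\otimes X^{\mathrm{cop}}\to X^{\mathrm{cop}}\otimes X$, $x\otimes y\mapsto y_{(1)}\mathbin{:}x_{(2)}\otimes x_{(1)}\cdot y_{(2)}$, is a coalgebra morphism; equivalently, $p,d\colon X\otimes X^{\mathrm{cop}}\to X$ are coalgebra maps and $v_{(1)}\mathbin{:}u_{(2)}\otimes u_{(1)}\cdot v_{(2)}=v_{(2)}\mathbin{:}u_{(1)}\otimes u_{(2)}\cdot v_{(1)}$ for all $u,v\in X$. It is left regular if $x\otimes y\mapsto x\cdot y_{(1)}\otimes y_{(2)}$ is bijective on $X\otimes X$, right regular if $x\otimes y\mapsto x\mathbin{:}y_{(2)}\otimes y_{(1)}$ is bijective, and regular if it is both. A $q$-cycle coalgebra is a left regular $q$-magma coalgebra such that for all $u,v,w$: $(u\cdot v_{(1)})\cdot(w\mathbin{:}v_{(2)})=(u\cdot w_{(2)})\cdot(v\cdot w_{(1)})$, $(u\cdot v_{(1)})\mathbin{:}(w\cdot v_{(2)})=(u\mathbin{:}w_{(2)})\cdot(v\mathbin{:}w_{(1)})$, $(u\mathbin{:}v_{(1)})\mathbin{:}(w\mathbin{:}v_{(2)})=(u\mathbin{:}w_{(2)})\mathbin{:}(v\cdot w_{(1)})$. A Hopf $q$-brace is a Hopf algebra $H$ with a regular $q$-cycle coalgebra structure $(H,\cdot,\mathbin{:})$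 such that $(H,\cdot)$ and $(H,\mathbin{:})$ are right $H^{\mathrm{op}}$-modules (i.e. $h\cdot 1=h$, $h\cdot kl=(h\cdot l)\cdot k$, and likewise for $\mathbin{:}$) and, for all $h,k,l\in H$, $hk\cdot l=(h\cdot(l_{(1)}\mathbin{:}k_{(2)}))(k_{(1)}\cdot l_{(2)})$ and $hk\mathbin{:}l=(h\mathbin{:}(l_{(1)}\cdot k_{(2)}))(k_{(1)}\mathbin{:}l_{(2)})$. A $q$-brace structure on a group $G$ is a pair of binary operations $\cdot,\mathbin{:}$ on the set $G$ whose linear extensions make $\mathds{k}[G]$ a Hopf $q$-brace; i.e. $g\mapsto g\cdot h$ and $g\mapsto g\mathbin{:}h$ are bijective for each $h$ and the identities above hold for elements of $G$ with all Sweedler indices dropped.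
   Formalization: In the converse, existence is proved under the added condition α(a^n−1)=0 or λ^n=ξ^n=1; otherwise (∗) contradicts x^n=α(a^n−1) (e.g. G=Z/4, χ(a)=−1, α=1, trivial q-brace, λ(a)=i). Any bilinear operations satisfying (∗) are shown to give a Hopf q-brace. *)

theory Defs
  imports
    "HOL-Library.Poly_Mapping"
    "HOL-Computational_Algebra.Polynomial"
    "HOL-Algebra.Multiplicative_Group"
    "HOL-Algebra.Elementary_Groups"
begin

section \<open>Vector spaces and tensor products\<close>

text \<open>
  A vector space over the field \<open>'k\<close> is given as the space \<open>'b \<Rightarrow>\<^sub>0 'k\<close> of finitely supported
  functions on a set \<open>'b\<close> indexing a basis; every nonzero vector space is of this form up to the
  choice of a basis.  The basis only serves to have the tensor product as a type:
  \<open>('b \<Rightarrow>\<^sub>0 'k) \<otimes> ('c \<Rightarrow>\<^sub>0 'k)\<close> is \<open>('b \<times> 'c) \<Rightarrow>\<^sub>0 'k\<close>.  No notion below refers to it otherwise.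
\<close>

lift_definition pscale :: "'k::field \<Rightarrow> ('b \<Rightarrow>\<^sub>0 'k) \<Rightarrow> ('b \<Rightarrow>\<^sub>0 'k)" (infixr \<open>*\<^sub>k\<close> 75)
  is "\<lambda>c u b. c * u b"
  by (rule finite_subset[rotated]) auto

lemma lookup_pscale [simp]: "Poly_Mapping.lookup (c *\<^sub>k u) b = c * Poly_Mapping.lookup u b"
  by transfer simp

global_interpretation pm: vector_space pscale
  defines pm_span = pm.span
  by unfold_locales (auto intro!: poly_mapping_eqI simp: lookup_add algebra_simps)

abbreviation basis_vec :: "'b \<Rightarrow> ('b \<Rightarrow>\<^sub>0 'k::field)" where
  "basis_vec b \<equiv> Poly_Mapping.single b 1"

abbreviation lin_map :: "(('b \<Rightarrow>\<^sub>0 'k::field) \<Rightarrow> ('c \<Rightarrow>\<^sub>0 'k)) \<Rightarrow> bool" where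
  "lin_map \<equiv> Vector_Spaces.linear pscale pscale"

abbreviation lin_form :: "(('b \<Rightarrow>\<^sub>0 'k::field) \<Rightarrow> 'k) \<Rightarrow> bool" where
  "lin_form \<equiv> Vector_Spaces.linear pscale (*)"

definition bilin_map ::
  "(('b \<Rightarrow>\<^sub>0 'k::field) \<Rightarrow> ('c \<Rightarrow>\<^sub>0 'k) \<Rightarrow> ('d \<Rightarrow>\<^sub>0 'k)) \<Rightarrow> bool" where
  "bilin_map f \<longleftrightarrow> (\<forall>u. lin_map (f u)) \<and> (\<forall>v. lin_map (\<lambda>u. f u v))"

definition lin_ext :: "('b \<Rightarrow> ('c \<Rightarrow>\<^sub>0 'k::field)) \<Rightarrow> ('b \<Rightarrow>\<^sub>0 'k) \<Rightarrow> ('c \<Rightarrow>\<^sub>0 'k)" where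
  "lin_ext f u = (\<Sum>b\<in>Poly_Mapping.keys u. Poly_Mapping.lookup u b *\<^sub>k f b)"

definition tens :: "('b \<Rightarrow>\<^sub>0 'k::field) \<Rightarrow> ('c \<Rightarrow>\<^sub>0 'k) \<Rightarrow> ('b \<times> 'c \<Rightarrow>\<^sub>0 'k)" (infixr \<open>\<boxtimes>\<close> 72) where
  "u \<boxtimes> v = (\<Sum>b\<in>Poly_Mapping.keys u. \<Sum>c\<in>Poly_Mapping.keys v.
              Poly_Mapping.single (b, c) (Poly_Mapping.lookup u b * Poly_Mapping.lookup v c))"

text \<open>The linear map on the tensor product induced by a bilinear map \<open>f\<close>; see \<open>tlift_tens\<close>.\<close>

definition tlift ::
  "(('b \<Rightarrow>\<^sub>0 'k::field) \<Rightarrow> ('c \<Rightarrow>\<^sub>0 'k) \<Rightarrow> ('d \<Rightarrow>\<^sub>0 'k)) \<Rightarrow> ('b \<times> 'c \<Rightarrow>\<^sub>0 'k) \<Rightarrow> ('d \<Rightarrow>\<^sub>0 'k)" where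
  "tlift f = lin_ext (\<lambda>(b, c). f (basis_vec b) (basis_vec c))"

lemma lookup_tens [simp]: "Poly_Mapping.lookup (u \<boxtimes> v) (b, c) = Poly_Mapping.lookup u b * Poly_Mapping.lookup v c"
proof -
  have "Poly_Mapping.lookup (u \<boxtimes> v) (b, c) =
      (\<Sum>i\<in>Poly_Mapping.keys u. \<Sum>j\<in>Poly_Mapping.keys v.
        if i = b then if j = c then Poly_Mapping.lookup u b * Poly_Mapping.lookup v c else 0 else 0)"
    by (auto simp: tens_def lookup_sum lookup_single when_def intro!: sum.cong)
  also have "\<dots> = (\<Sum>i\<in>Poly_Mapping.keys u. if i = b then Poly_Mapping.lookup u b * Poly_Mapping.lookup v c else 0)"
    by (intro sum.cong refl) (auto simp: sum.delta in_keys_iff)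
  finally show ?thesis
    by (auto simp: sum.delta in_keys_iff)
qed

lemma keys_tens: "Poly_Mapping.keys (u \<boxtimes> v) = Poly_Mapping.keys u \<times> Poly_Mapping.keys v"
  by (auto simp: in_keys_iff)

lemma basis_expansion: "u = (\<Sum>b\<in>Poly_Mapping.keys u. Poly_Mapping.lookup u b *\<^sub>k basis_vec b)"
proof (rule poly_mapping_eqI)
  fix c
  have "(\<Sum>b\<in>Poly_Mapping.keys u. Poly_Mapping.lookup u b * Poly_Mapping.lookup (basis_vec b) c)
      = (\<Sum>b\<in>Poly_Mapping.keys u. if b = c then Poly_Mapping.lookup u c else 0)"
    by (intro sum.cong refl) (auto simp: lookup_single when_def)
  also have "\<dots> = Poly_Mapping.lookup u c"
    by (auto simp: sum.delta in_keys_iff)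
  finally show "Poly_Mapping.lookup u c = Poly_Mapping.lookup (\<Sum>b\<in>Poly_Mapping.keys u. Poly_Mapping.lookup u b *\<^sub>k basis_vec b) c"
    by (simp add: lookup_sum)
qed

lemma tlift_tens:
  assumes "bilin_map f"
  shows "tlift f (u \<boxtimes> v) = f u v"
proof -
  interpret R: Vector_Spaces.linear pscale pscale "f w" for w
    using assms by (simp add: bilin_map_def)
  interpret L: Vector_Spaces.linear pscale pscale "\<lambda>w. f w z" for z
    using assms by (simp add: bilin_map_def)
  have "f u v = f (\<Sum>b\<in>Poly_Mapping.keys u. Poly_Mapping.lookup u b *\<^sub>k basis_vec b) v"
    by (simp flip: basis_expansion)
  also have "\<dots> = (\<Sum>b\<in>Poly_Mapping.keys u. Poly_Mapping.lookup u b *\<^sub>k f (basis_vec b) v)"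
    by (simp add: L.sum L.scale)
  also have "\<dots> = (\<Sum>b\<in>Poly_Mapping.keys u. Poly_Mapping.lookup u b *\<^sub>k
      f (basis_vec b) (\<Sum>c\<in>Poly_Mapping.keys v. Poly_Mapping.lookup v c *\<^sub>k basis_vec c))"
    by (simp flip: basis_expansion)
  also have "\<dots> = (\<Sum>b\<in>Poly_Mapping.keys u. \<Sum>c\<in>Poly_Mapping.keys v.
      (Poly_Mapping.lookup u b * Poly_Mapping.lookup v c) *\<^sub>k f (basis_vec b) (basis_vec c))"
    by (simp add: R.sum R.scale pm.scale_sum_right)
  also have "\<dots> = tlift f (u \<boxtimes> v)"
    by (auto simp: tlift_def lin_ext_def keys_tens sum.cartesian_product intro!: sum.cong)
  finally show ?thesis by simp
qed


section \<open>Coalgebras and Hopf algebras\<close>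

record (overloaded) ('b, 'k) coalg =
  comul :: "('b \<Rightarrow>\<^sub>0 'k::field) \<Rightarrow> ('b \<times> 'b \<Rightarrow>\<^sub>0 'k)"
  counit :: "('b \<Rightarrow>\<^sub>0 'k) \<Rightarrow> 'k"

text \<open>
  Sweedler notation: for \<open>f\<close> bilinear, \<open>swd C u (\<lambda>u1 u2. f u1 u2)\<close> is the sum
  \<open>f u\<^sub>(\<^sub>1\<^sub>) u\<^sub>(\<^sub>2\<^sub>)\<close>, i.e. the value at the coproduct of \<open>u\<close> of the linear map induced by \<open>f\<close>.
\<close>

definition swd :: "('b, 'k::field, 'z) coalg_scheme \<Rightarrow> ('b \<Rightarrow>\<^sub>0 'k) \<Rightarrow>
    (('b \<Rightarrow>\<^sub>0 'k) \<Rightarrow> ('b \<Rightarrow>\<^sub>0 'k) \<Rightarrow> ('d \<Rightarrow>\<^sub>0 'k)) \<Rightarrow> ('d \<Rightarrow>\<^sub>0 'k)" where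
  "swd C u f = tlift f (comul C u)"

definition coalgebra :: "('b, 'k::field, 'z) coalg_scheme \<Rightarrow> bool" where
  "coalgebra C \<longleftrightarrow>
     lin_map (comul C) \<and> lin_form (counit C) \<and>
     (\<forall>u. swd C u (\<lambda>u1 u2. swd C u1 (\<lambda>u11 u12. u11 \<boxtimes> u12 \<boxtimes> u2)) =
          swd C u (\<lambda>u1 u2. u1 \<boxtimes> comul C u2)) \<and>
     (\<forall>u. swd C u (\<lambda>u1 u2. counit C u1 *\<^sub>k u2) = u) \<and>
     (\<forall>u. swd C u (\<lambda>u1 u2. counit C u2 *\<^sub>k u1) = u)"

definition cop :: "('b, 'k::field, 'z) coalg_scheme \<Rightarrow> ('b, 'k) coalg" where
  "cop C = \<lparr>comul = (\<lambda>u. swd C u (\<lambda>u1 u2. u2 \<boxtimes> u1)), counit = counit C\<rparr>"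

definition tensor_coalg ::
  "('b, 'k::field, 'y) coalg_scheme \<Rightarrow> ('c, 'k, 'z) coalg_scheme \<Rightarrow> ('b \<times> 'c, 'k) coalg" where
  "tensor_coalg C D =
    \<lparr>comul = tlift (\<lambda>u v. swd C u (\<lambda>u1 u2. swd D v (\<lambda>v1 v2. (u1 \<boxtimes> v1) \<boxtimes> (u2 \<boxtimes> v2)))),
     counit = (\<lambda>t. \<Sum>(b, c)\<in>Poly_Mapping.keys t.
        Poly_Mapping.lookup t (b, c) * (counit C (basis_vec b) * counit D (basis_vec c)))\<rparr>"

definition coalg_morphism :: "('b, 'k::field, 'y) coalg_scheme \<Rightarrow> ('c, 'k, 'z) coalg_scheme \<Rightarrow>
    (('b \<Rightarrow>\<^sub>0 'k) \<Rightarrow> ('c \<Rightarrow>\<^sub>0 'k)) \<Rightarrow> bool" where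
  "coalg_morphism C D f \<longleftrightarrow>
     lin_map f \<and>
     (\<forall>u. comul D (f u) = swd C u (\<lambda>u1 u2. f u1 \<boxtimes> f u2)) \<and>
     (\<forall>u. counit D (f u) = counit C u)"

record (overloaded) ('b, 'k) bialg = "('b, 'k::field) coalg" +
  hmul :: "('b \<Rightarrow>\<^sub>0 'k) \<Rightarrow> ('b \<Rightarrow>\<^sub>0 'k) \<Rightarrow> ('b \<Rightarrow>\<^sub>0 'k)"
  hone :: "'b \<Rightarrow>\<^sub>0 'k"

definition unital_algebra :: "('b, 'k::field, 'z) bialg_scheme \<Rightarrow> bool" where
  "unital_algebra H \<longleftrightarrow>
     bilin_map (hmul H) \<and>
     (\<forall>u v w. hmul H (hmul H u v) w = hmul H u (hmul H v w)) \<and>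
     (\<forall>u. hmul H (hone H) u = u \<and> hmul H u (hone H) = u)"

definition bialgebra :: "('b, 'k::field, 'z) bialg_scheme \<Rightarrow> bool" where
  "bialgebra H \<longleftrightarrow>
     unital_algebra H \<and> coalgebra H \<and>
     (\<forall>u v. comul H (hmul H u v) =
        swd H u (\<lambda>u1 u2. swd H v (\<lambda>v1 v2. hmul H u1 v1 \<boxtimes> hmul H u2 v2))) \<and>
     comul H (hone H) = hone H \<boxtimes> hone H \<and>
     (\<forall>u v. counit H (hmul H u v) = counit H u * counit H v) \<and>
     counit H (hone H) = 1"

definition is_antipode ::
  "('b, 'k::field, 'z) bialg_scheme \<Rightarrow> (('b \<Rightarrow>\<^sub>0 'k) \<Rightarrow> ('b \<Rightarrow>\<^sub>0 'k)) \<Rightarrow> bool" where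
  "is_antipode H S \<longleftrightarrow>
     lin_map S \<and>
     (\<forall>u. swd H u (\<lambda>u1 u2. hmul H (S u1) u2) = counit H u *\<^sub>k hone H) \<and>
     (\<forall>u. swd H u (\<lambda>u1 u2. hmul H u1 (S u2)) = counit H u *\<^sub>k hone H)"

definition hopf_algebra :: "('b, 'k::field, 'z) bialg_scheme \<Rightarrow> bool" where
  "hopf_algebra H \<longleftrightarrow> bialgebra H \<and> (\<exists>S. is_antipode H S)"

definition hpow :: "('b, 'k::field, 'z) bialg_scheme \<Rightarrow> ('b \<Rightarrow>\<^sub>0 'k) \<Rightarrow> nat \<Rightarrow> ('b \<Rightarrow>\<^sub>0 'k)" where
  "hpow H u j = (hmul H u ^^ j) (hone H)"


section \<open>Hopf q-braces\<close>

text \<open>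
  The linear maps \<open>p\<close> and \<open>d\<close> from the tensor square of \<open>X\<close> to \<open>X\<close> are given by the bilinear maps
  \<open>dot\<close> (for \<open>x \<cdot> y\<close>) and \<open>col\<close> (for \<open>x : y\<close>).
\<close>

definition q_magma_coalgebra :: "('b, 'k::field, 'z) coalg_scheme \<Rightarrow>
    (('b \<Rightarrow>\<^sub>0 'k) \<Rightarrow> ('b \<Rightarrow>\<^sub>0 'k) \<Rightarrow> ('b \<Rightarrow>\<^sub>0 'k)) \<Rightarrow>
    (('b \<Rightarrow>\<^sub>0 'k) \<Rightarrow> ('b \<Rightarrow>\<^sub>0 'k) \<Rightarrow> ('b \<Rightarrow>\<^sub>0 'k)) \<Rightarrow> bool" where
  "q_magma_coalgebra X dot col \<longleftrightarrow>
     coalgebra X \<and> bilin_map dot \<and> bilin_map col \<and>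
     (\<forall>x y. counit X (dot x y) = counit X x * counit X y) \<and>
     (\<forall>x y. counit X (col x y) = counit X x * counit X y) \<and>
     coalg_morphism (tensor_coalg X (cop X)) (tensor_coalg (cop X) X)
       (tlift (\<lambda>x y. swd X x (\<lambda>x1 x2. swd X y (\<lambda>y1 y2. col y1 x2 \<boxtimes> dot x1 y2))))"

definition left_regular :: "('b, 'k::field, 'z) coalg_scheme \<Rightarrow>
    (('b \<Rightarrow>\<^sub>0 'k) \<Rightarrow> ('b \<Rightarrow>\<^sub>0 'k) \<Rightarrow> ('b \<Rightarrow>\<^sub>0 'k)) \<Rightarrow> bool" where
  "left_regular X dot \<longleftrightarrow> bij (tlift (\<lambda>x y. swd X y (\<lambda>y1 y2. dot x y1 \<boxtimes> y2)))"

definition right_regular :: "('b, 'k::field, 'z) coalg_scheme \<Rightarrow>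
    (('b \<Rightarrow>\<^sub>0 'k) \<Rightarrow> ('b \<Rightarrow>\<^sub>0 'k) \<Rightarrow> ('b \<Rightarrow>\<^sub>0 'k)) \<Rightarrow> bool" where
  "right_regular X col \<longleftrightarrow> bij (tlift (\<lambda>x y. swd X y (\<lambda>y1 y2. col x y2 \<boxtimes> y1)))"

definition q_cycle_coalgebra :: "('b, 'k::field, 'z) coalg_scheme \<Rightarrow>
    (('b \<Rightarrow>\<^sub>0 'k) \<Rightarrow> ('b \<Rightarrow>\<^sub>0 'k) \<Rightarrow> ('b \<Rightarrow>\<^sub>0 'k)) \<Rightarrow>
    (('b \<Rightarrow>\<^sub>0 'k) \<Rightarrow> ('b \<Rightarrow>\<^sub>0 'k) \<Rightarrow> ('b \<Rightarrow>\<^sub>0 'k)) \<Rightarrow> bool" where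
  "q_cycle_coalgebra X dot col \<longleftrightarrow>
     q_magma_coalgebra X dot col \<and> left_regular X dot \<and>
     (\<forall>u v w. swd X v (\<lambda>v1 v2. dot (dot u v1) (col w v2)) =
              swd X w (\<lambda>w1 w2. dot (dot u w2) (dot v w1))) \<and>
     (\<forall>u v w. swd X v (\<lambda>v1 v2. col (dot u v1) (dot w v2)) =
              swd X w (\<lambda>w1 w2. dot (col u w2) (col v w1))) \<and>
     (\<forall>u v w. swd X v (\<lambda>v1 v2. col (col u v1) (col w v2)) =
              swd X w (\<lambda>w1 w2. col (col u w2) (dot v w1)))"

definition hopf_q_brace :: "('b, 'k::field, 'z) bialg_scheme \<Rightarrow>
    (('b \<Rightarrow>\<^sub>0 'k) \<Rightarrow> ('b \<Rightarrow>\<^sub>0 'k) \<Rightarrow> ('b \<Rightarrow>\<^sub>0 'k)) \<Rightarrow>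
    (('b \<Rightarrow>\<^sub>0 'k) \<Rightarrow> ('b \<Rightarrow>\<^sub>0 'k) \<Rightarrow> ('b \<Rightarrow>\<^sub>0 'k)) \<Rightarrow> bool" where
  "hopf_q_brace H dot col \<longleftrightarrow>
     hopf_algebra H \<and> q_cycle_coalgebra H dot col \<and> right_regular H col \<and>
     (\<forall>h. dot h (hone H) = h) \<and> (\<forall>h k l. dot h (hmul H k l) = dot (dot h l) k) \<and>
     (\<forall>h. col h (hone H) = h) \<and> (\<forall>h k l. col h (hmul H k l) = col (col h l) k) \<and>
     (\<forall>h k l. dot (hmul H h k) l =
        swd H k (\<lambda>k1 k2. swd H l (\<lambda>l1 l2. hmul H (dot h (col l1 k2)) (dot k1 l2)))) \<and>
     (\<forall>h k l. col (hmul H h k) l =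
        swd H k (\<lambda>k1 k2. swd H l (\<lambda>l1 l2. hmul H (col h (dot l1 k2)) (col k1 l2))))"

definition group_q_brace ::
  "('g, 'm) monoid_scheme \<Rightarrow> ('g \<Rightarrow> 'g \<Rightarrow> 'g) \<Rightarrow> ('g \<Rightarrow> 'g \<Rightarrow> 'g) \<Rightarrow> bool" where
  "group_q_brace G dot col \<longleftrightarrow>
     (\<forall>h\<in>carrier G. bij_betw (\<lambda>g. dot g h) (carrier G) (carrier G)) \<and>
     (\<forall>h\<in>carrier G. bij_betw (\<lambda>g. col g h) (carrier G) (carrier G)) \<and>
     (\<forall>u\<in>carrier G. \<forall>v\<in>carrier G. \<forall>w\<in>carrier G.
        dot (dot u v) (col w v) = dot (dot u w) (dot v w) \<and>
        col (dot u v) (dot w v) = dot (col u w) (col v w) \<and>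
        col (col u v) (col w v) = col (col u w) (dot v w)) \<and>
     (\<forall>h\<in>carrier G. dot h \<one>\<^bsub>G\<^esub> = h \<and> col h \<one>\<^bsub>G\<^esub> = h) \<and>
     (\<forall>h\<in>carrier G. \<forall>k\<in>carrier G. \<forall>l\<in>carrier G.
        dot h (k \<otimes>\<^bsub>G\<^esub> l) = dot (dot h l) k \<and>
        col h (k \<otimes>\<^bsub>G\<^esub> l) = col (col h l) k \<and>
        dot (h \<otimes>\<^bsub>G\<^esub> k) l = dot h (col l k) \<otimes>\<^bsub>G\<^esub> dot k l \<and>
        col (h \<otimes>\<^bsub>G\<^esub> k) l = col h (dot l k) \<otimes>\<^bsub>G\<^esub> col k l)"


section \<open>Rank one pointed Hopf algebras\<close>

definition field_units :: "'k::field monoid" where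
  "field_units = \<lparr>carrier = - {0}, mult = (*), one = 1\<rparr>"

lemma group_field_units: "group (field_units :: 'k::field monoid)"
proof (rule groupI)
  fix c :: 'k assume "c \<in> carrier field_units"
  then show "\<exists>d\<in>carrier field_units. d \<otimes>\<^bsub>field_units\<^esub> c = \<one>\<^bsub>field_units\<^esub>"
    by (intro bexI[of _ "inverse c"]) (auto simp: field_units_def)
qed (auto simp: field_units_def)

abbreviation is_character :: "('g, 'm) monoid_scheme \<Rightarrow> ('g \<Rightarrow> 'k::field) \<Rightarrow> bool" where
  "is_character G f \<equiv> f \<in> hom G field_units"

definition root_order :: "('g \<Rightarrow> 'k::field) \<Rightarrow> 'g \<Rightarrow> nat" where
  "root_order \<chi> a = group.ord field_units (\<chi> a)"

text \<open>The condition \<open>\<alpha> (a\<^sup>n - 1) = 0\<close>, an equation in the group algebra \<open>'g \<Rightarrow>\<^sub>0 'k\<close>.\<close>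

definition lift_trivial :: "('g, 'm) monoid_scheme \<Rightarrow> ('g \<Rightarrow> 'k::field) \<Rightarrow> 'g \<Rightarrow> 'k \<Rightarrow> bool" where
  "lift_trivial G \<chi> a \<alpha> \<longleftrightarrow>
     \<alpha> *\<^sub>k (basis_vec (a [^]\<^bsub>G\<^esub> root_order \<chi> a) - basis_vec \<one>\<^bsub>G\<^esub>) = 0"

definition datum :: "('g, 'm) monoid_scheme \<Rightarrow> ('g \<Rightarrow> 'k::field) \<Rightarrow> 'g \<Rightarrow> 'k \<Rightarrow> bool" where
  "datum G \<chi> a \<alpha> \<longleftrightarrow>
     group G \<and> finite (carrier G) \<and> is_character G \<chi> \<and>
     a \<in> carrier G \<and> (\<forall>g\<in>carrier G. a \<otimes>\<^bsub>G\<^esub> g = g \<otimes>\<^bsub>G\<^esub> a) \<and>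
     root_order \<chi> a > 1 \<and>
     (lift_trivial G \<chi> a \<alpha> \<or> (\<forall>g\<in>carrier G. \<chi> g ^ root_order \<chi> a = 1))"

datatype 'g gen = Gr 'g | XGen

definition gen_words :: "('g, 'm) monoid_scheme \<Rightarrow> 'g gen list set" where
  "gen_words G = lists (insert XGen (Gr ` carrier G))"

text \<open>
  The free algebra on \<open>G\<close> and \<open>x\<close> consists of the linear combinations of words, with the empty
  word as unit.
\<close>

definition free_alg :: "('g, 'm) monoid_scheme \<Rightarrow> ('g gen list \<Rightarrow>\<^sub>0 'k::field) set" where
  "free_alg G = {p. Poly_Mapping.keys p \<subseteq> gen_words G}"

definition rank_one_relators ::
  "('g, 'm) monoid_scheme \<Rightarrow> ('g \<Rightarrow> 'k::field) \<Rightarrow> 'g \<Rightarrow> 'k \<Rightarrow> ('g gen list \<Rightarrow>\<^sub>0 'k) set" where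
  "rank_one_relators G \<chi> a \<alpha> =
     {basis_vec [Gr g, Gr h] - basis_vec [Gr (g \<otimes>\<^bsub>G\<^esub> h)] | g h. g \<in> carrier G \<and> h \<in> carrier G} \<union>
     {basis_vec [Gr \<one>\<^bsub>G\<^esub>] - basis_vec []} \<union>
     {basis_vec (replicate (root_order \<chi> a) XGen) -
        \<alpha> *\<^sub>k (basis_vec [Gr (a [^]\<^bsub>G\<^esub> root_order \<chi> a)] - basis_vec [])} \<union>
     {basis_vec [XGen, Gr g] - \<chi> g *\<^sub>k basis_vec [Gr g, XGen] | g. g \<in> carrier G}"

text \<open>The two-sided ideal of the free algebra generated by \<open>R\<close>.\<close>

definition free_ideal ::
  "('g, 'm) monoid_scheme \<Rightarrow> ('g gen list \<Rightarrow>\<^sub>0 'k::field) set \<Rightarrow> ('g gen list \<Rightarrow>\<^sub>0 'k) set" where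
  "free_ideal G R =
     pm_span {lin_ext (\<lambda>m. basis_vec (w @ m @ w')) r | w r w'.
        w \<in> gen_words G \<and> r \<in> R \<and> w' \<in> gen_words G}"

text \<open>
  The algebra homomorphism from the free algebra to \<open>H\<close> which sends \<open>g\<close> to \<open>\<iota> g\<close> and the free
  generator \<open>XGen\<close> to \<open>x\<close>.
\<close>

definition free_eval :: "('b, 'k::field, 'z) bialg_scheme \<Rightarrow> ('g \<Rightarrow> ('b \<Rightarrow>\<^sub>0 'k)) \<Rightarrow> ('b \<Rightarrow>\<^sub>0 'k) \<Rightarrow>
    ('g gen list \<Rightarrow>\<^sub>0 'k) \<Rightarrow> ('b \<Rightarrow>\<^sub>0 'k)" where
  "free_eval H \<iota> x =
     lin_ext (\<lambda>w. foldr (\<lambda>s. hmul H (case s of Gr g \<Rightarrow> \<iota> g | XGen \<Rightarrow> x)) w (hone H))"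

text \<open>
  \<open>H\<close>, with \<open>\<iota> g\<close> as the image of \<open>g\<close> and with the element \<open>x\<close>, is the Hopf algebra of the datum:
  as an algebra it is the quotient of the free algebra by the ideal of relations, which is expressed
  by prescribing the image and the kernel of \<open>free_eval\<close>.
\<close>

definition rank_one_hopf_algebra :: "('g, 'm) monoid_scheme \<Rightarrow> ('g \<Rightarrow> 'k::field) \<Rightarrow> 'g \<Rightarrow> 'k \<Rightarrow>
    ('b, 'k, 'z) bialg_scheme \<Rightarrow> ('g \<Rightarrow> ('b \<Rightarrow>\<^sub>0 'k)) \<Rightarrow> ('b \<Rightarrow>\<^sub>0 'k) \<Rightarrow> bool" where
  "rank_one_hopf_algebra G \<chi> a \<alpha> H \<iota> x \<longleftrightarrow>
     hopf_algebra H \<and>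
     free_eval H \<iota> x ` free_alg G = UNIV \<and>
     {p \<in> free_alg G. free_eval H \<iota> x p = 0} = free_ideal G (rank_one_relators G \<chi> a \<alpha>) \<and>
     comul H x = x \<boxtimes> \<iota> a + hone H \<boxtimes> x \<and>
     (\<forall>g\<in>carrier G. comul H (\<iota> g) = \<iota> g \<boxtimes> \<iota> g)"


section \<open>The data and formulas of the classification\<close>

definition acts_trivially ::
  "('g, 'm) monoid_scheme \<Rightarrow> 'g \<Rightarrow> ('g \<Rightarrow> 'g \<Rightarrow> 'g) \<Rightarrow> ('g \<Rightarrow> 'g \<Rightarrow> 'g) \<Rightarrow> bool" where
  "acts_trivially G a dot col \<longleftrightarrow>
     (\<forall>g\<in>carrier G. dot a g = a \<and> col a g = a \<and> dot g a = g \<and> col g a = g)"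

definition compatible_characters :: "('g, 'm) monoid_scheme \<Rightarrow> ('g \<Rightarrow> 'k::field) \<Rightarrow> 'g \<Rightarrow>
    ('g \<Rightarrow> 'g \<Rightarrow> 'g) \<Rightarrow> ('g \<Rightarrow> 'g \<Rightarrow> 'g) \<Rightarrow> ('g \<Rightarrow> 'k) \<Rightarrow> ('g \<Rightarrow> 'k) \<Rightarrow> bool" where
  "compatible_characters G \<chi> a dot col lam xi \<longleftrightarrow>
     is_character G lam \<and> is_character G xi \<and>
     lam a = inverse (xi a) \<and>
     (\<forall>h\<in>carrier G. \<forall>l\<in>carrier G.
        lam (h \<otimes>\<^bsub>G\<^esub> col l h) = lam (l \<otimes>\<^bsub>G\<^esub> dot h l) \<and>
        lam h * xi (dot l h) = xi l * lam (col h l) \<and>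
        xi (l \<otimes>\<^bsub>G\<^esub> dot h l) = xi (h \<otimes>\<^bsub>G\<^esub> col l h) \<and>
        \<chi> h * lam l = lam (col l h) * \<chi> (dot h l) \<and>
        \<chi> h * xi l = xi (dot l h) * \<chi> (col h l))"

text \<open>The formula for one operation of \<open>H\<close>, given by the operation \<open>op\<close> of \<open>G\<close> and a character.\<close>

definition extension_formula :: "('g, 'm) monoid_scheme \<Rightarrow> ('b, 'k::field, 'z) bialg_scheme \<Rightarrow>
    ('g \<Rightarrow> ('b \<Rightarrow>\<^sub>0 'k)) \<Rightarrow> ('b \<Rightarrow>\<^sub>0 'k) \<Rightarrow> ('g \<Rightarrow> 'g \<Rightarrow> 'g) \<Rightarrow> ('g \<Rightarrow> 'k) \<Rightarrow>
    (('b \<Rightarrow>\<^sub>0 'k) \<Rightarrow> ('b \<Rightarrow>\<^sub>0 'k) \<Rightarrow> ('b \<Rightarrow>\<^sub>0 'k)) \<Rightarrow> bool" where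
  "extension_formula G H \<iota> x op lam opH \<longleftrightarrow>
     (\<forall>h\<in>carrier G. \<forall>g\<in>carrier G. \<forall>j j'.
        opH (hmul H (\<iota> h) (hpow H x j)) (hmul H (\<iota> g) (hpow H x j')) =
        (if j' = 0 then lam g ^ j *\<^sub>k hmul H (\<iota> (op h g)) (hpow H x j) else 0))"

text \<open>
  If \<open>\<alpha> (a\<^sup>n - 1) \<noteq> 0\<close>, then \<open>x\<^sup>n = \<alpha> (a\<^sup>n - 1)\<close> is a nonzero element of the span of \<open>G\<close>, and for
  \<open>j = n\<close> the extension formulas contradict those for \<open>j = 0\<close> unless the \<open>n\<close>-th powers of both
  characters are trivial.
\<close>

definition formulas_consistent :: "('g, 'm) monoid_scheme \<Rightarrow> ('g \<Rightarrow> 'k::field) \<Rightarrow> 'g \<Rightarrow> 'k \<Rightarrow>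
    ('g \<Rightarrow> 'k) \<Rightarrow> ('g \<Rightarrow> 'k) \<Rightarrow> bool" where
  "formulas_consistent G \<chi> a \<alpha> lam xi \<longleftrightarrow>
     lift_trivial G \<chi> a \<alpha> \<or>
     (\<forall>g\<in>carrier G. lam g ^ root_order \<chi> a = 1 \<and> xi g ^ root_order \<chi> a = 1)"

end

theory Submission
  imports Defs
begin

text \<open>
  Write \<open>q = \<chi> a\<close>, and call \<open>m\<close> the degree of the basis vector \<open>g x\<^sup>m\<close>.  Everything rests on two facts
  about \<open>H\<close>.  First, the elements \<open>g x\<^sup>m\<close> with \<open>m < n\<close> form a basis: they span because of the
  relations, and they are independent because the free algebra acts on a space with a basis indexed
  by the pairs \<open>(g, m)\<close> in a way that kills the relators (\<open>model_act_ideal\<close>, \<open>coords_pbw\<close>).  Second,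
  \<open>\<Delta>(g x\<^sup>m)\<close> is a combination of the \<open>g x\<^sup>k \<otimes> g a\<^sup>k x\<^sup>m\<^sup>-\<^sup>k\<close> with \<open>q\<close>-binomial coefficients (\<open>comul_pbw\<close>),
  so the coproduct is graded.  It follows that the group-like elements of \<open>H\<close> are those of \<open>G\<close>, and
  that a skew primitive element \<open>u\<close>, with \<open>\<Delta> u = u \<otimes> b + 1 \<otimes> u\<close>, is a multiple of \<open>1 - b\<close> unless
  \<open>b = a\<close>, in which case it may have in addition a component along \<open>x\<close> (\<open>skew_primitive_form\<close>).

  From a Hopf q-brace to the group.  Since \<open>\<cdot>\<close> and \<open>:\<close> are coalgebra maps, they restrict to \<open>G\<close>, and
  \<open>x \<cdot> g\<close> is skew primitive.  The map \<open>u \<mapsto> u \<cdot> g\<close> is invertible and permutes \<open>G\<close>, so \<open>x \<cdot> g\<close> must involve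
  \<open>x\<close>; hence \<open>a \<cdot> g = a\<close> and \<open>x \<cdot> g = \<lambda>(g) x + \<mu>(g) (1 - a)\<close>.  The identity
  \<open>v\<^sub>1 : u\<^sub>2 \<otimes> u\<^sub>1 \<cdot> v\<^sub>2 = v\<^sub>2 : u\<^sub>1 \<otimes> u\<^sub>2 \<cdot> v\<^sub>1\<close> (\<open>q_magma_flip\<close>), read at \<open>u = x\<close> and \<open>v = g\<close>, gives \<open>g : a = g\<close>
  and \<open>g : x = 0\<close>.  Expanding both sides of \<open>x g \<cdot> l = \<chi>(g) (g x \<cdot> l)\<close> then gives
  \<open>\<mu>(l : g) = \<chi>(g) \<mu>(l)\<close>, and \<open>g = a\<close> forces \<open>\<mu> = 0\<close> because \<open>q \<noteq> 1\<close> (\<open>d_x_iota\<close>).  The formulas for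
  all \<open>h x\<^sup>j\<close> follow by multiplying with \<open>x\<close>; here \<open>x \<cdot> x = x : x = 0\<close> enters, and the flip identity at
  \<open>u = v = x\<close> gives \<open>\<lambda>(a) \<xi>(a) = 1\<close>.  The remaining conditions on \<open>\<lambda>\<close> and \<open>\<xi>\<close> are the three cycle
  identities at \<open>x, h, l\<close> with \<open>h, l\<close> in \<open>G\<close>, and the comparison of the coefficients of \<open>x\<close> in the
  expansion just mentioned.

  From the group to a Hopf q-brace.  Acting by a basis vector of positive degree gives \<open>0\<close>, so in each
  Sweedler sum only the extreme terms, in which one tensor factor has degree \<open>0\<close>, survive.  Thus every
  identity, evaluated at basis vectors, becomes an identity in \<open>G\<close> times an identity between powers of
  \<open>\<chi>\<close>, \<open>\<lambda>\<close> and \<open>\<xi>\<close>.  The map in the definition of a q-magma coalgebra becomes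
  \<open>h x\<^sup>j \<otimes> g x\<^sup>m \<mapsto> \<xi>(h)\<^sup>m \<lambda>(g)\<^sup>j (g : h) x\<^sup>m \<otimes> (h \<cdot> g) x\<^sup>j\<close> (\<open>flip_map_pbw\<close>), which visibly respects the
  graded coproduct.

  The two operations play symmetric roles, so in both directions the lemmas are proved for one of them
  inside a locale which is stable under exchanging the two.
\<close>

section \<open>Linear maps on spaces with a basis\<close>

lemma vector_space_field_mult: "vector_space ((*) :: 'k::field \<Rightarrow> 'k \<Rightarrow> 'k)"
  by unfold_locales (auto simp: algebra_simps)

lemma lin_mapI:
  assumes "\<And>u v. f (u + v) = f u + f v" "\<And>c u. f (c *\<^sub>k u) = c *\<^sub>k f u"
  shows "lin_map f"
  using assms by (simp add: Vector_Spaces.linear_iff pm.vector_space_axioms)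

text \<open>
  The target is arbitrary, so that this covers \<open>lin_ext\<close> as well as the scalar-valued counit of a
  tensor product.
\<close>

lemma linear_keys_sum:
  assumes "vector_space s"
  shows "Vector_Spaces.linear pscale s
    (\<lambda>u. \<Sum>b\<in>Poly_Mapping.keys u. s (Poly_Mapping.lookup u b) (f b))" (is "Vector_Spaces.linear _ _ ?F")
proof -
  interpret s: vector_space s by fact
  have F: "?F u = (\<Sum>b\<in>A. s (Poly_Mapping.lookup u b) (f b))"
    if "finite A" "Poly_Mapping.keys u \<subseteq> A" for A u
    using that by (intro sum.mono_neutral_left) (auto simp: in_keys_iff)
  have "?F (u + v) = ?F u + ?F v" for u v
  proof -
    let ?A = "Poly_Mapping.keys u \<union> Poly_Mapping.keys v"
    have "?F (u + v) = (\<Sum>b\<in>?A. s (Poly_Mapping.lookup (u + v) b) (f b))"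
      by (rule F) (auto simp: Poly_Mapping.keys_add)
    also have "\<dots> = (\<Sum>b\<in>?A. s (Poly_Mapping.lookup u b) (f b)) + (\<Sum>b\<in>?A. s (Poly_Mapping.lookup v b) (f b))"
      by (simp add: lookup_add s.scale_left_distrib sum.distrib)
    also have "\<dots> = ?F u + ?F v"
      by (simp only: F[of ?A u] F[of ?A v] Un_upper1 Un_upper2 finite_Un Poly_Mapping.finite_keys simp_thms)
    finally show ?thesis .
  qed
  moreover have "?F (c *\<^sub>k u) = s c (?F u)" for c u
    by (subst F[of "Poly_Mapping.keys u"])
      (auto simp: in_keys_iff s.scale_sum_right)
  ultimately show ?thesis
    by (simp add: Vector_Spaces.linear_iff pm.vector_space_axioms assms)
qed

lemma linear_basis_ext:
  assumes "Vector_Spaces.linear pscale s f" "Vector_Spaces.linear pscale s g"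
    and "\<And>b. f (basis_vec b) = g (basis_vec b)"
  shows "f u = g u"
proof -
  interpret f: Vector_Spaces.linear pscale s f by fact
  interpret g: Vector_Spaces.linear pscale s g by fact
  show ?thesis
    by (subst (1 2) basis_expansion[of u]) (simp only: f.sum g.sum f.scale g.scale assms(3))
qed

lemma lin_map_lin_ext: "lin_map (lin_ext f)"
  unfolding lin_ext_def[abs_def] by (rule linear_keys_sum) (rule pm.vector_space_axioms)

lemma lin_ext_basis_vec [simp]: "lin_ext f (basis_vec b) = f b"
  by (simp add: lin_ext_def)

lemma lin_ext_zero [simp]: "lin_ext (\<lambda>b. 0) u = 0"
  by (simp add: lin_ext_def)

lemma lin_map_ident: "lin_map (\<lambda>z. z)"
  by (rule lin_mapI) auto

lemma lin_map_compose: "lin_map L \<Longrightarrow> lin_map g \<Longrightarrow> lin_map (\<lambda>z. L (g z))"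
  by (simp add: Vector_Spaces.linear_iff)

lemma lin_map_scale: "lin_map g \<Longrightarrow> lin_map (\<lambda>z. c *\<^sub>k g z)"
  by (simp add: Vector_Spaces.linear_iff pm.scale_right_distrib pm.scale_left_commute)

lemma lin_map_scale_form: "lin_form \<phi> \<Longrightarrow> lin_map g \<Longrightarrow> lin_map (\<lambda>z. \<phi> (g z) *\<^sub>k w)"
  by (simp add: Vector_Spaces.linear_iff pm.scale_left_distrib pm.vector_space_axioms)

lemma lin_map_add: "lin_map f \<Longrightarrow> lin_map g \<Longrightarrow> lin_map (\<lambda>z. f z + g z)"
  by (simp add: Vector_Spaces.linear_iff pm.scale_right_distrib algebra_simps)

lemma lin_map_zero: "lin_map (\<lambda>z. 0)"
  by (rule lin_mapI) auto

lemma lin_map_sum: "(\<And>i. i \<in> I \<Longrightarrow> lin_map (f i)) \<Longrightarrow> lin_map (\<lambda>z. \<Sum>i\<in>I. f i z)"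
  by (simp add: Vector_Spaces.linear_iff pm.vector_space_axioms sum.distrib pm.scale_sum_right)

lemma lin_map_tlift: "lin_map (tlift f)"
  unfolding tlift_def by (rule lin_map_lin_ext)

lemma lin_map_tlift_param:
  assumes "\<And>b c. lin_map (\<lambda>z. F z b c)"
  shows "lin_map (\<lambda>z. tlift (F z) t)"
  unfolding tlift_def lin_ext_def
  by (intro lin_map_sum lin_map_scale) (auto simp: assms split: prod.splits)

lemma lin_map_lin_ext_param: "(\<And>b. lin_map (\<lambda>z. F z b)) \<Longrightarrow> lin_map (\<lambda>z. lin_ext (F z) u)"
  unfolding lin_ext_def by (intro lin_map_sum lin_map_scale)

lemma bilin_mapI:
  "(\<And>u. lin_map (\<lambda>v. f u v)) \<Longrightarrow> (\<And>v. lin_map (\<lambda>u. f u v)) \<Longrightarrow> bilin_map f"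
  by (simp add: bilin_map_def)

lemma bilin_map_left: "bilin_map D \<Longrightarrow> lin_map g \<Longrightarrow> lin_map (\<lambda>z. D (g z) c)"
  by (auto simp: bilin_map_def intro: lin_map_compose)

lemma bilin_map_right: "bilin_map D \<Longrightarrow> lin_map g \<Longrightarrow> lin_map (\<lambda>z. D c (g z))"
  by (auto simp: bilin_map_def intro: lin_map_compose)

lemma bilin_map_tens: "bilin_map tens"
  by (intro bilin_mapI lin_mapI poly_mapping_eqI) (auto simp: lookup_add algebra_simps)

lemma bilin_map_simps:
  assumes "bilin_map D"
  shows "D (u + v) w = D u w + D v w" "D w (u + v) = D w u + D w v"
    "D (c *\<^sub>k u) w = c *\<^sub>k D u w" "D w (c *\<^sub>k u) = c *\<^sub>k D w u"
    "D (u - v) w = D u w - D v w" "D w (u - v) = D w u - D w v"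
    "D 0 w = 0" "D w 0 = 0"
    "D (sum f A) w = (\<Sum>i\<in>A. D (f i) w)" "D w (sum f A) = (\<Sum>i\<in>A. D w (f i))"
proof -
  interpret R: Vector_Spaces.linear pscale pscale "D w" for w
    using assms by (simp add: bilin_map_def)
  interpret L: Vector_Spaces.linear pscale pscale "\<lambda>w. D w z" for z
    using assms by (simp add: bilin_map_def)
  show "D (u + v) w = D u w + D v w" "D w (u + v) = D w u + D w v"
    "D (c *\<^sub>k u) w = c *\<^sub>k D u w" "D w (c *\<^sub>k u) = c *\<^sub>k D w u"
    "D (u - v) w = D u w - D v w" "D w (u - v) = D w u - D w v"
    "D 0 w = 0" "D w 0 = 0"
    "D (sum f A) w = (\<Sum>i\<in>A. D (f i) w)" "D w (sum f A) = (\<Sum>i\<in>A. D w (f i))"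
    by (simp_all add: R.add L.add R.scale L.scale R.diff L.diff R.zero L.zero R.sum L.sum)
qed

lemma lin_map_simps:
  assumes "lin_map L"
  shows "L (u + v) = L u + L v" "L (c *\<^sub>k u) = c *\<^sub>k L u" "L (u - v) = L u - L v"
    "L 0 = 0" "L (sum f A) = (\<Sum>i\<in>A. L (f i))"
proof -
  interpret Vector_Spaces.linear pscale pscale L by fact
  show "L (u + v) = L u + L v" "L (c *\<^sub>k u) = c *\<^sub>k L u" "L (u - v) = L u - L v"
    "L 0 = 0" "L (sum f A) = (\<Sum>i\<in>A. L (f i))"
    by (simp_all add: add scale diff zero sum)
qed

lemma lin_form_simps:
  assumes "lin_form \<phi>"
  shows "\<phi> (u + v) = \<phi> u + \<phi> v" "\<phi> (c *\<^sub>k u) = c * \<phi> u" "\<phi> (u - v) = \<phi> u - \<phi> v"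
    "\<phi> 0 = 0" "\<phi> (sum f A) = (\<Sum>i\<in>A. \<phi> (f i))"
proof -
  interpret Vector_Spaces.linear pscale "(*)" \<phi> by fact
  show "\<phi> (u + v) = \<phi> u + \<phi> v" "\<phi> (c *\<^sub>k u) = c * \<phi> u" "\<phi> (u - v) = \<phi> u - \<phi> v"
    "\<phi> 0 = 0" "\<phi> (sum f A) = (\<Sum>i\<in>A. \<phi> (f i))"
    by (simp_all add: add scale diff zero sum)
qed

lemma lin_form_compose: "lin_form \<phi> \<Longrightarrow> lin_map g \<Longrightarrow> lin_form (\<lambda>z. \<phi> (g z))"
  by (simp add: Vector_Spaces.linear_iff)

lemmas tens_simps = bilin_map_simps[OF bilin_map_tens]

lemmas lin_map_tens = bilin_map_left[OF bilin_map_tens] bilin_map_right[OF bilin_map_tens]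

lemma tens_basis_vec: "basis_vec b \<boxtimes> basis_vec c = basis_vec (b, c)"
  by (simp add: tens_def)

lemma tensor_ext:
  assumes "Vector_Spaces.linear pscale s f" "Vector_Spaces.linear pscale s g"
    and "\<And>u v. f (u \<boxtimes> v) = g (u \<boxtimes> v)"
  shows "f t = g t"
  using assms(1,2)
proof (rule linear_basis_ext)
  fix p
  show "f (basis_vec p) = g (basis_vec p)"
    using assms(3)[of "basis_vec (fst p)" "basis_vec (snd p)"] by (simp add: tens_basis_vec)
qed


section \<open>Sweedler sums\<close>

text \<open>
  Linearity of the structure maps is all that the manipulation of Sweedler sums needs, and unlike the
  coalgebra axioms it holds for a tensor product for trivial reasons.
\<close>

definition lin_coalg :: "('b, 'k::field, 'z) coalg_scheme \<Rightarrow> bool" where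
  "lin_coalg C \<longleftrightarrow> lin_map (comul C) \<and> lin_form (counit C)"

lemma coalgebra_lin_coalg: "coalgebra C \<Longrightarrow> lin_coalg C"
  by (simp add: coalgebra_def lin_coalg_def)

lemma lin_map_comul: "lin_coalg C \<Longrightarrow> lin_map g \<Longrightarrow> lin_map (\<lambda>z. comul C (g z))"
  by (auto simp: lin_coalg_def intro: lin_map_compose)

lemma lin_map_swd: "lin_coalg C \<Longrightarrow> lin_map g \<Longrightarrow> lin_map (\<lambda>z. swd C (g z) f)"
  unfolding swd_def by (rule lin_map_compose[OF lin_map_tlift]) (rule lin_map_comul)

lemma lin_map_swd_param: "(\<And>b c. lin_map (\<lambda>z. F z b c)) \<Longrightarrow> lin_map (\<lambda>z. swd C u (F z))"
  unfolding swd_def by (rule lin_map_tlift_param)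

lemmas lin_intros = lin_map_tens lin_map_swd lin_map_swd_param lin_map_comul lin_map_ident

lemma lin_map_tlift_eq: "lin_map L \<Longrightarrow> L (tlift f t) = tlift (\<lambda>a b. L (f a b)) t"
  by (rule linear_basis_ext[where s = pscale and f = "\<lambda>t. L (tlift f t)" and g = "tlift (\<lambda>a b. L (f a b))"])
    (auto intro: lin_map_compose lin_map_lin_ext simp: tlift_def)

text \<open>
  The rule by which a linear map is moved inside a Sweedler sum; nearly every computation with
  coproducts below is an iteration of it.
\<close>

lemma lin_map_swd_eq: "lin_map L \<Longrightarrow> L (swd C u f) = swd C u (\<lambda>a b. L (f a b))"
  unfolding swd_def by (rule lin_map_tlift_eq)

lemma swd_zero: "swd C u (\<lambda>a b. 0) = 0"
  by (simp add: swd_def tlift_def case_prod_unfold)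

lemma swd_comul:
  assumes "bilin_map f" "comul C u = a \<boxtimes> b"
  shows "swd C u f = f a b"
  using assms by (simp add: swd_def tlift_tens)

lemma swd_comul_add:
  assumes "bilin_map f" "comul C u = a \<boxtimes> b + c \<boxtimes> d"
  shows "swd C u f = f a b + f c d"
proof -
  interpret Vector_Spaces.linear pscale pscale "tlift f" by (rule lin_map_tlift)
  show ?thesis
    using assms by (simp add: swd_def tlift_tens add)
qed

lemma swd_tens_eq: "lin_coalg C \<Longrightarrow> swd C u (\<lambda>a b. a \<boxtimes> b) = comul C u"
  unfolding swd_def
  by (rule linear_basis_ext[where s = pscale and f = "tlift (\<lambda>a b. a \<boxtimes> b)" and g = "\<lambda>z. z"])
    (auto intro: lin_map_lin_ext lin_map_ident simp: tlift_def tens_basis_vec split: prod.splits)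

lemma comul_cop: "comul (cop C) u = swd C u (\<lambda>a b. b \<boxtimes> a)"
  by (simp add: cop_def)

lemma counit_cop: "counit (cop C) = counit C"
  by (simp add: cop_def)

lemma lin_coalg_cop: "lin_coalg C \<Longrightarrow> lin_coalg (cop C)"
  by (auto simp: lin_coalg_def[of "cop C"] comul_cop[abs_def] counit_cop intro: lin_map_swd lin_map_ident)
    (simp add: lin_coalg_def)

lemma swd_cop:
  assumes "bilin_map f"
  shows "swd (cop C) u f = swd C u (\<lambda>a b. f b a)"
  by (simp add: swd_def[of "cop C"] comul_cop lin_map_swd_eq[OF lin_map_tlift] tlift_tens assms)

lemma swd_swap:
  "swd C u (\<lambda>a b. swd D v (\<lambda>c d. f a b c d)) = swd D v (\<lambda>c d. swd C u (\<lambda>a b. f a b c d))"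
  unfolding swd_def tlift_def lin_ext_def
  by (simp add: pm.scale_sum_right case_prod_unfold)
    (subst sum.swap, simp add: mult.commute)

lemma comul_tensor_coalg:
  assumes "lin_coalg C" "lin_coalg D"
  shows "comul (tensor_coalg C D) (u \<boxtimes> v) =
    swd C u (\<lambda>u1 u2. swd D v (\<lambda>v1 v2. (u1 \<boxtimes> v1) \<boxtimes> (u2 \<boxtimes> v2)))"
  unfolding tensor_coalg_def
  by (simp, rule tlift_tens) (intro bilin_mapI lin_intros assms)

lemma counit_tensor_coalg:
  "counit (tensor_coalg C D) = (\<lambda>t. \<Sum>p\<in>Poly_Mapping.keys t.
     Poly_Mapping.lookup t p * (counit C (basis_vec (fst p)) * counit D (basis_vec (snd p))))"
  by (simp add: tensor_coalg_def case_prod_unfold)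

lemma lin_coalg_tensor: "lin_coalg (tensor_coalg C D)"
  unfolding lin_coalg_def counit_tensor_coalg
  by (auto intro!: linear_keys_sum vector_space_field_mult simp: tensor_coalg_def lin_map_tlift)

lemma counit_tensor_coalg_tens:
  assumes "lin_coalg C" "lin_coalg D"
  shows "counit (tensor_coalg C D) (u \<boxtimes> v) = counit C u * counit D v"
proof -
  have C: "lin_form (counit C)" and D: "lin_form (counit D)"
    using assms by (auto simp: lin_coalg_def)
  have "counit C u * counit D v =
      counit C (\<Sum>b\<in>Poly_Mapping.keys u. Poly_Mapping.lookup u b *\<^sub>k basis_vec b) *
      counit D (\<Sum>b\<in>Poly_Mapping.keys v. Poly_Mapping.lookup v b *\<^sub>k basis_vec b)"
    by (simp flip: basis_expansion)
  also have "\<dots> = counit (tensor_coalg C D) (u \<boxtimes> v)"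
    by (simp only: lin_form_simps[OF C] lin_form_simps[OF D])
      (auto simp: counit_tensor_coalg keys_tens sum_product sum.cartesian_product
        case_prod_unfold algebra_simps intro!: sum.cong)
  finally show ?thesis ..
qed

lemma swd_tensor_coalg:
  assumes "lin_coalg C" "lin_coalg D" "bilin_map f"
  shows "swd (tensor_coalg C D) (u \<boxtimes> v) f =
    swd C u (\<lambda>u1 u2. swd D v (\<lambda>v1 v2. f (u1 \<boxtimes> v1) (u2 \<boxtimes> v2)))"
  by (simp add: swd_def[of "tensor_coalg C D"] comul_tensor_coalg assms(1,2)
      lin_map_swd_eq[OF lin_map_tlift] tlift_tens[OF assms(3)])


section \<open>The coalgebra conditions of a q-magma coalgebra\<close>

lemma counit_swd_left:
  assumes "coalgebra C" "lin_map L"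
  shows "swd C u (\<lambda>u1 u2. counit C u1 *\<^sub>k L u2) = L u"
proof -
  interpret L: Vector_Spaces.linear pscale pscale L by fact
  have "L (swd C u (\<lambda>u1 u2. counit C u1 *\<^sub>k u2)) = L u"
    using assms by (simp add: coalgebra_def)
  then show ?thesis
    by (simp add: lin_map_swd_eq[OF assms(2)] L.scale)
qed

lemma counit_swd_right:
  assumes "coalgebra C" "lin_map L"
  shows "swd C u (\<lambda>u1 u2. counit C u2 *\<^sub>k L u1) = L u"
proof -
  interpret L: Vector_Spaces.linear pscale pscale L by fact
  have "L (swd C u (\<lambda>u1 u2. counit C u2 *\<^sub>k u1)) = L u"
    using assms by (simp add: coalgebra_def)
  then show ?thesis
    by (simp add: lin_map_swd_eq[OF assms(2)] L.scale)
qed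

text \<open>
  The morphism property is a single identity with values in the tensor square of \<open>D = X\<^sup>c\<^sup>o\<^sup>p \<otimes> X\<close>.  Let \<open>Q\<close>
  and \<open>P\<close> be the projections of \<open>D\<close> to the first and second factor which apply the counit to the other
  one.  They send \<open>v\<^sub>1 : u\<^sub>2 \<otimes> u\<^sub>1 \<cdot> v\<^sub>2\<close> to \<open>v : u\<close> and to \<open>u \<cdot> v\<close>.  Applying \<open>P \<otimes> P\<close>, \<open>Q \<otimes> Q\<close> and \<open>Q \<otimes> P\<close> to
  the identity yields the three claims, since composed with the coproduct of \<open>D\<close> these maps are
  \<open>\<Delta> P\<close>, \<open>\<Delta>\<^sup>c\<^sup>o\<^sup>p Q\<close> and the identity.
\<close>

lemma q_magma_coalgebra_components:
  fixes X :: "('b, 'k::field, 'z) coalg_scheme"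
  assumes q: "q_magma_coalgebra X dot col"
  shows q_magma_comul_dot:
      "comul X (dot u v) = swd X u (\<lambda>u1 u2. swd X v (\<lambda>v1 v2. dot u1 v2 \<boxtimes> dot u2 v1))"
    and q_magma_comul_col:
      "comul X (col u v) = swd X u (\<lambda>u1 u2. swd X v (\<lambda>v1 v2. col u1 v2 \<boxtimes> col u2 v1))"
    and q_magma_flip:
      "swd X u (\<lambda>u1 u2. swd X v (\<lambda>v1 v2. col v1 u2 \<boxtimes> dot u1 v2)) =
       swd X u (\<lambda>u1 u2. swd X v (\<lambda>v1 v2. col v2 u1 \<boxtimes> dot u2 v1))"
proof -
  have X: "coalgebra X" and dot: "bilin_map dot" and col: "bilin_map col"
    and eps_dot: "counit X (dot x y) = counit X x * counit X y"
    and eps_col: "counit X (col x y) = counit X x * counit X y" for x y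
    using q by (auto simp: q_magma_coalgebra_def)
  have lX: "lin_coalg X"
    using X by (rule coalgebra_lin_coalg)
  have lX': "lin_coalg (cop X)"
    using lX by (rule lin_coalg_cop)
  have eps: "lin_form (counit X)"
    using lX by (simp add: lin_coalg_def)
  note lin = bilin_map_left[OF dot] bilin_map_right[OF dot] bilin_map_left[OF col] bilin_map_right[OF col]
    lin_map_scale_form[OF eps] lin_map_scale lin_intros lX lX'
  define F where "F = (\<lambda>u v. swd X u (\<lambda>u1 u2. swd X v (\<lambda>v1 v2. col v1 u2 \<boxtimes> dot u1 v2)))"
  define D where "D = tensor_coalg (cop X) X"
  have F: "bilin_map F"
    unfolding F_def by (intro bilin_mapI lin)
  have lD: "lin_coalg D"
    unfolding D_def by (rule lin_coalg_tensor)
  have "comul D (tlift F t) = swd (tensor_coalg X (cop X)) t (\<lambda>t1 t2. tlift F t1 \<boxtimes> tlift F t2)" for t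
    using q by (simp add: q_magma_coalgebra_def coalg_morphism_def F_def D_def)
  then have comul_F: "comul D (F u v) = swd X u (\<lambda>u1 u2. swd X v (\<lambda>v1 v2. F u1 v2 \<boxtimes> F u2 v1))" for u v
  proof -
    have "bilin_map (\<lambda>s t. tlift F s \<boxtimes> tlift F t)" "\<And>u1 u2. bilin_map (\<lambda>v1 v2. F u1 v1 \<boxtimes> F u2 v2)"
      by (intro bilin_mapI lin_map_tens lin_map_tlift bilin_map_right[OF F] lin_map_ident)+
    then show ?thesis
      using \<open>\<And>t. comul D (tlift F t) = _ t\<close>[of "u \<boxtimes> v"]
      by (simp add: swd_tensor_coalg lX lX' tlift_tens[OF F] swd_cop)
  qed
  define P Q :: "('b \<times> 'b \<Rightarrow>\<^sub>0 'k) \<Rightarrow> ('b \<Rightarrow>\<^sub>0 'k)"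
    where "P = tlift (\<lambda>b c. counit X b *\<^sub>k c)" and "Q = tlift (\<lambda>b c. counit X c *\<^sub>k b)"
  have P: "P (b \<boxtimes> c) = counit X b *\<^sub>k c" and Q: "Q (b \<boxtimes> c) = counit X c *\<^sub>k b" for b c
    unfolding P_def Q_def by (rule tlift_tens, intro bilin_mapI lin)+
  have lP: "lin_map P" and lQ: "lin_map Q"
    by (simp_all add: P_def Q_def lin_map_tlift)
  note linPQ = lin_map_compose[OF lP] lin_map_compose[OF lQ]
  have PF: "P (F u v) = dot u v" for u v
  proof -
    have "P (F u v) = swd X u (\<lambda>u1 u2. swd X v (\<lambda>v1 v2. counit X v1 *\<^sub>k (counit X u2 *\<^sub>k dot u1 v2)))"
      by (simp add: F_def lin_map_swd_eq[OF lP] P eps_col)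
    also have "\<dots> = dot u v"
      by (subst counit_swd_left[OF X], intro lin, rule counit_swd_right[OF X], intro lin)
    finally show ?thesis .
  qed
  have QF: "Q (F u v) = col v u" for u v
  proof -
    have "Q (F u v) = swd X u (\<lambda>u1 u2. swd X v (\<lambda>v1 v2. counit X v2 *\<^sub>k (counit X u1 *\<^sub>k col v1 u2)))"
      by (simp add: F_def lin_map_swd_eq[OF lQ] Q eps_dot mult.commute)
    also have "\<dots> = col v u"
      by (subst counit_swd_right[OF X], intro lin, rule counit_swd_left[OF X], intro lin)
    finally show ?thesis .
  qed
  have comul_D: "comul D (b \<boxtimes> c) = swd X b (\<lambda>b1 b2. swd X c (\<lambda>c1 c2. (b2 \<boxtimes> c1) \<boxtimes> (b1 \<boxtimes> c2)))" for b c
    by (simp add: D_def comul_tensor_coalg lX lX', subst swd_cop) (auto intro!: bilin_mapI lin)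
  have bPP: "bilin_map (\<lambda>s t. P s \<boxtimes> P t)" and bQQ: "bilin_map (\<lambda>s t. Q s \<boxtimes> Q t)"
    and bQP: "bilin_map (\<lambda>s t. Q s \<boxtimes> P t)"
    by (intro bilin_mapI linPQ lin)+
  have collapse: "swd X b (\<lambda>b1 b2. (counit X b1 * counit X b2) *\<^sub>k w) = counit X b *\<^sub>k w" for b and w :: "'d \<Rightarrow>\<^sub>0 'k"
    using counit_swd_left[OF X lin_map_scale_form[OF eps lin_map_ident, of w], of b] by simp
  have lc: "lin_map (comul X)" using lX by (simp add: lin_coalg_def)
  have PP: "tlift (\<lambda>s t. P s \<boxtimes> P t) (comul D z) = comul X (P z)" for z
  proof (rule tensor_ext[where s = pscale and
      f = "\<lambda>z. tlift (\<lambda>s t. P s \<boxtimes> P t) (comul D z)" and g = "\<lambda>z. comul X (P z)"])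
    fix b c
    have "tlift (\<lambda>s t. P s \<boxtimes> P t) (comul D (b \<boxtimes> c)) =
        swd X b (\<lambda>b1 b2. swd X c (\<lambda>c1 c2. (counit X b1 * counit X b2) *\<^sub>k (c1 \<boxtimes> c2)))"
      by (simp add: comul_D lin_map_swd_eq[OF lin_map_tlift] tlift_tens[OF bPP] P tens_simps mult.commute)
    also have "\<dots> = swd X b (\<lambda>b1 b2. (counit X b1 * counit X b2) *\<^sub>k comul X c)"
      by (simp add: swd_tens_eq[OF lX] lin_map_swd_eq[OF lin_map_scale[OF lin_map_ident], symmetric])
    also have "\<dots> = comul X (P (b \<boxtimes> c))"
      using lX by (simp add: collapse P Vector_Spaces.linear_iff lin_coalg_def)
    finally show "tlift (\<lambda>s t. P s \<boxtimes> P t) (comul D (b \<boxtimes> c)) = comul X (P (b \<boxtimes> c))" .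
  qed (intro lin_map_compose[OF lin_map_tlift] lin_map_comul lD lX linPQ lin_map_ident)+
  have QQ: "tlift (\<lambda>s t. Q s \<boxtimes> Q t) (comul D z) = comul (cop X) (Q z)" for z
  proof (rule tensor_ext[where s = pscale and
      f = "\<lambda>z. tlift (\<lambda>s t. Q s \<boxtimes> Q t) (comul D z)" and g = "\<lambda>z. comul (cop X) (Q z)"])
    fix b c
    have "tlift (\<lambda>s t. Q s \<boxtimes> Q t) (comul D (b \<boxtimes> c)) =
        swd X c (\<lambda>c1 c2. (counit X c1 * counit X c2) *\<^sub>k swd X b (\<lambda>b1 b2. b2 \<boxtimes> b1))"
      by (simp add: comul_D lin_map_swd_eq[OF lin_map_tlift] tlift_tens[OF bQQ] Q tens_simps mult.commute
          lin_map_swd_eq[OF lin_map_scale[OF lin_map_ident]]) (rule swd_swap)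
    also have "\<dots> = comul (cop X) (Q (b \<boxtimes> c))"
      using lX' by (simp add: collapse Q Vector_Spaces.linear_iff lin_coalg_def comul_cop)
    finally show "tlift (\<lambda>s t. Q s \<boxtimes> Q t) (comul D (b \<boxtimes> c)) = comul (cop X) (Q (b \<boxtimes> c))" .
  qed (intro lin_map_compose[OF lin_map_tlift] lin_map_comul lD lX' linPQ lin_map_ident)+
  have QP: "tlift (\<lambda>s t. Q s \<boxtimes> P t) (comul D z) = z" for z
  proof (rule tensor_ext[where s = pscale and
      f = "\<lambda>z. tlift (\<lambda>s t. Q s \<boxtimes> P t) (comul D z)" and g = "\<lambda>z. z"])
    fix b c
    have "tlift (\<lambda>s t. Q s \<boxtimes> P t) (comul D (b \<boxtimes> c)) =
        swd X b (\<lambda>b1 b2. swd X c (\<lambda>c1 c2. counit X c1 *\<^sub>k (counit X b1 *\<^sub>k (b2 \<boxtimes> c2))))"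
      by (simp add: comul_D lin_map_swd_eq[OF lin_map_tlift] tlift_tens[OF bQP] P Q tens_simps mult.commute)
    also have "\<dots> = b \<boxtimes> c"
      by (subst counit_swd_left[OF X], intro lin, rule counit_swd_left[OF X], intro lin)
    finally show "tlift (\<lambda>s t. Q s \<boxtimes> P t) (comul D (b \<boxtimes> c)) = b \<boxtimes> c" .
  qed (intro lin_map_compose[OF lin_map_tlift] lin_map_comul lD lin_map_ident)+
  show flip: "swd X u (\<lambda>u1 u2. swd X v (\<lambda>v1 v2. col v1 u2 \<boxtimes> dot u1 v2)) =
       swd X u (\<lambda>u1 u2. swd X v (\<lambda>v1 v2. col v2 u1 \<boxtimes> dot u2 v1))" for u v
    using QP[of "F u v"]
    by (simp add: comul_F lin_map_swd_eq[OF lin_map_tlift] tlift_tens[OF bQP] PF QF) (simp add: F_def)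
  show "comul X (dot u v) = swd X u (\<lambda>u1 u2. swd X v (\<lambda>v1 v2. dot u1 v2 \<boxtimes> dot u2 v1))"
    using PP[of "F u v"]
    by (simp add: comul_F lin_map_swd_eq[OF lin_map_tlift] tlift_tens[OF bPP] PF)
  have "swd X (col v u) (\<lambda>a b. b \<boxtimes> a) = swd X u (\<lambda>u1 u2. swd X v (\<lambda>v1 v2. col v2 u1 \<boxtimes> col v1 u2))" for u v
    using QQ[of "F u v"]
    by (simp add: comul_F lin_map_swd_eq[OF lin_map_tlift] tlift_tens[OF bQQ] QF comul_cop)
  then have "tlift (\<lambda>a b. b \<boxtimes> a) (swd X (col u v) (\<lambda>a b. b \<boxtimes> a)) =
      tlift (\<lambda>a b. b \<boxtimes> a) (swd X v (\<lambda>v1 v2. swd X u (\<lambda>u1 u2. col u2 v1 \<boxtimes> col u1 v2)))"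
    by simp
  then show "comul X (col u v) = swd X u (\<lambda>u1 u2. swd X v (\<lambda>v1 v2. col u1 v2 \<boxtimes> col u2 v1))"
    by (simp add: lin_map_swd_eq[OF lin_map_tlift] tlift_tens bilin_mapI lin_map_tens lin_map_ident swd_tens_eq[OF lX])
      (rule swd_swap)
qed


section \<open>Gaussian binomial coefficients\<close>

text \<open>
  The \<open>q\<close>-binomial coefficients, given by the Pascal rule that belongs to
  \<open>(A + B)\<^sup>m = (\<Sum>k\<le>m. gauss_binom q m k A\<^sup>k B\<^sup>m\<^sup>-\<^sup>k)\<close> for \<open>B A = q A B\<close>.
\<close>

fun gauss_binom :: "'k::field \<Rightarrow> nat \<Rightarrow> nat \<Rightarrow> 'k" where
  "gauss_binom q m 0 = 1"
| "gauss_binom q 0 (Suc k) = 0"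
| "gauss_binom q (Suc m) (Suc k) = q ^ (m - k) * gauss_binom q m k + gauss_binom q m (Suc k)"

lemma gauss_binom_eq_0: "m < k \<Longrightarrow> gauss_binom q m k = 0"
  by (induction q m k rule: gauss_binom.induct) auto

lemma gauss_binom_diag [simp]: "gauss_binom q m m = 1"
  by (induction m) (auto simp: gauss_binom_eq_0)

lemma gauss_binom_1: "(q - 1) * gauss_binom q m (Suc 0) = q ^ m - 1"
  by (induction m) (auto simp: algebra_simps)


section \<open>The basis of a rank one pointed Hopf algebra\<close>

locale rank_one =
  fixes G :: "('g, 'm) monoid_scheme" (structure)
    and \<chi> :: "'g \<Rightarrow> 'k::field" and a :: 'g and \<alpha> :: 'k
    and H :: "('b, 'k, 'z) bialg_scheme"
    and \<iota> :: "'g \<Rightarrow> ('b \<Rightarrow>\<^sub>0 'k)" and x :: "'b \<Rightarrow>\<^sub>0 'k"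
  assumes datum: "datum G \<chi> a \<alpha>"
    and rank_one: "rank_one_hopf_algebra G \<chi> a \<alpha> H \<iota> x"
begin

sublocale group G
  using datum by (simp add: datum_def)

abbreviation n :: nat where "n \<equiv> root_order \<chi> a"

abbreviation mulH (infixl \<open>\<star>\<close> 70) where "u \<star> v \<equiv> hmul H u v"

definition pbw :: "'g \<Rightarrow> nat \<Rightarrow> ('b \<Rightarrow>\<^sub>0 'k)" where
  "pbw g m = \<iota> g \<star> hpow H x m"

lemma a_closed [simp]: "a \<in> carrier G"
  and a_central: "g \<in> carrier G \<Longrightarrow> a \<otimes> g = g \<otimes> a"
  and n_gt_1: "1 < n"
  and finite_G: "finite (carrier G)"
  using datum by (auto simp: datum_def)

lemma a_pow_central: "g \<in> carrier G \<Longrightarrow> a [^] k \<otimes> g = g \<otimes> a [^] k" for k :: nat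
proof (induction k)
  case (Suc k)
  have "a [^] Suc k \<otimes> g = a [^] k \<otimes> (g \<otimes> a)"
    using Suc.prems by (simp add: m_assoc a_central)
  also have "\<dots> = (g \<otimes> a [^] k) \<otimes> a"
    using Suc by (simp flip: m_assoc)
  finally show ?case
    using Suc.prems by (simp add: m_assoc)
qed simp

lemma character_mult:
  assumes "is_character G f" "g \<in> carrier G" "h \<in> carrier G"
  shows "f (g \<otimes> h) = f g * f h"
  using hom_mult[OF assms] by (simp add: field_units_def)

lemma character_nonzero:
  assumes "is_character G f" "g \<in> carrier G"
  shows "f g \<noteq> 0"
  using hom_in_carrier[OF assms] by (simp add: field_units_def)

lemma character_one:
  assumes "is_character G f"
  shows "f \<one> = 1"
  using hom_one[OF assms group_axioms group_field_units] by (simp add: field_units_def)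

lemma character_pow:
  assumes "is_character G f" "g \<in> carrier G"
  shows "f (g [^] (m::nat)) = f g ^ m"
  by (induction m) (auto simp: character_one[OF assms(1)] character_mult[OF assms(1)] assms(2))

lemma chi: "is_character G \<chi>"
  using datum by (simp add: datum_def)

lemmas chi_mult = character_mult[OF chi] and chi_one = character_one[OF chi] and chi_pow = character_pow[OF chi]

lemma chi_a_pow: "\<chi> a ^ m = 1 \<longleftrightarrow> n dvd m" for m
proof -
  interpret U: group "field_units :: 'k monoid" by (rule group_field_units)
  have "\<chi> a [^]\<^bsub>field_units\<^esub> m = \<chi> a ^ m"
    by (induction m) (auto simp: field_units_def)
  moreover have "\<chi> a \<in> carrier (field_units :: 'k monoid)"
    by (rule hom_in_carrier[OF chi a_closed])
  ultimately show ?thesis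
    using U.pow_eq_id[of "\<chi> a" m] by (simp add: root_order_def field_units_def)
qed

lemma chi_a_pow_n: "\<chi> a ^ n = 1"
  by (simp add: chi_a_pow)

lemma chi_a_neq_1: "\<chi> a \<noteq> 1"
  using chi_a_pow[of 1] n_gt_1 by auto

lemma a_neq_one: "a \<noteq> \<one>"
  using chi_a_neq_1 chi_one by auto

text \<open>
  This is where the exact order of \<open>\<chi> a\<close> matters: below degree \<open>n\<close> the coproduct of \<open>x\<^sup>m\<close> has a
  nonzero component in degree \<open>(1, m - 1)\<close>, so that there are no skew primitives in degrees above 1.
\<close>

lemma gauss_binom_1_neq_0: "0 < m \<Longrightarrow> m < n \<Longrightarrow> gauss_binom (\<chi> a) m (Suc 0) \<noteq> 0"
  using gauss_binom_1[of "\<chi> a" m] chi_a_pow[of m] by (auto dest: dvd_imp_le)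

lemma hopf: "hopf_algebra H" and bialg: "bialgebra H" and unital: "unital_algebra H"
  and coalg: "coalgebra H" and bilin_mul: "bilin_map (hmul H)"
  using rank_one by (auto simp: rank_one_hopf_algebra_def hopf_algebra_def bialgebra_def unital_algebra_def)

lemma mul_assoc: "(u \<star> v) \<star> w = u \<star> (v \<star> w)"
  and mul_one_left [simp]: "hone H \<star> u = u"
  and mul_one_right [simp]: "u \<star> hone H = u"
  using unital by (auto simp: unital_algebra_def)

lemma lin_coalg: "lin_coalg H"
  using coalg by (rule coalgebra_lin_coalg)

lemma counit_form: "lin_form (counit H)"
  using lin_coalg by (simp add: lin_coalg_def)

lemma counit_mul: "counit H (u \<star> v) = counit H u * counit H v"
  and counit_one [simp]: "counit H (hone H) = 1"
  and comul_mul: "comul H (u \<star> v) = swd H u (\<lambda>u1 u2. swd H v (\<lambda>v1 v2. (u1 \<star> v1) \<boxtimes> (u2 \<star> v2)))"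
  using bialg by (auto simp: bialgebra_def)

lemma comul_x: "comul H x = x \<boxtimes> \<iota> a + hone H \<boxtimes> x"
  and comul_iota: "g \<in> carrier G \<Longrightarrow> comul H (\<iota> g) = \<iota> g \<boxtimes> \<iota> g"
  using rank_one by (auto simp: rank_one_hopf_algebra_def)

lemmas mul_simps = bilin_map_simps[OF bilin_mul]
lemmas lin_H = bilin_map_left[OF bilin_mul] bilin_map_right[OF bilin_mul] lin_intros lin_coalg

subsection \<open>The relations\<close>

lemma free_eval_lin: "lin_map (free_eval H \<iota> x)"
  unfolding free_eval_def by (rule lin_map_lin_ext)

abbreviation letter :: "'g gen \<Rightarrow> ('b \<Rightarrow>\<^sub>0 'k)" where
  "letter s \<equiv> (case s of Gr g \<Rightarrow> \<iota> g | XGen \<Rightarrow> x)"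

lemma free_eval_word: "free_eval H \<iota> x (basis_vec w) = foldr (\<lambda>s. hmul H (letter s)) w (hone H)"
  by (simp add: free_eval_def)

lemma hpow_x_word: "hpow H x m = free_eval H \<iota> x (basis_vec (replicate m XGen))"
  by (simp add: free_eval_word foldr_replicate hpow_def)

lemma pbw_word: "pbw g m = free_eval H \<iota> x (basis_vec (Gr g # replicate m XGen))"
  by (simp add: free_eval_word foldr_replicate hpow_def pbw_def)

lemma free_eval_relator:
  assumes "r \<in> rank_one_relators G \<chi> a \<alpha>"
  shows "free_eval H \<iota> x r = 0"
proof -
  have "lin_ext (\<lambda>m. basis_vec ([] @ m @ [])) r = r"
    by (rule linear_basis_ext[where s = pscale and f = "lin_ext (\<lambda>m. basis_vec ([] @ m @ []))" and g = "\<lambda>z. z"])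
      (simp_all add: lin_map_lin_ext lin_map_ident)
  moreover have "lin_ext (\<lambda>m. basis_vec ([] @ m @ [])) r \<in> free_ideal G (rank_one_relators G \<chi> a \<alpha>)"
    unfolding free_ideal_def
    by (rule pm.span_base, rule CollectI, rule exI[of _ "[]"], rule exI[of _ r], rule exI[of _ "[]"])
      (intro conjI refl assms, simp_all add: gen_words_def)
  ultimately show ?thesis
    using rank_one by (auto simp: rank_one_hopf_algebra_def)
qed

lemma iota_mult: "\<iota> g \<star> \<iota> h = \<iota> (g \<otimes> h)" if "g \<in> carrier G" "h \<in> carrier G"
proof -
  interpret F: Vector_Spaces.linear pscale pscale "free_eval H \<iota> x" by (rule free_eval_lin)
  have "basis_vec [Gr g, Gr h] - basis_vec [Gr (g \<otimes> h)] \<in> rank_one_relators G \<chi> a \<alpha>"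
    using that by (auto simp: rank_one_relators_def)
  from free_eval_relator[OF this] show ?thesis
    by (simp add: F.diff free_eval_word)
qed

lemma iota_one: "\<iota> \<one> = hone H"
proof -
  interpret F: Vector_Spaces.linear pscale pscale "free_eval H \<iota> x" by (rule free_eval_lin)
  have "basis_vec [Gr \<one>] - basis_vec [] \<in> rank_one_relators G \<chi> a \<alpha>"
    by (auto simp: rank_one_relators_def)
  from free_eval_relator[OF this] show ?thesis
    by (simp add: F.diff free_eval_word)
qed

lemma x_iota: "x \<star> \<iota> g = \<chi> g *\<^sub>k (\<iota> g \<star> x)" if "g \<in> carrier G"
proof -
  interpret F: Vector_Spaces.linear pscale pscale "free_eval H \<iota> x" by (rule free_eval_lin)
  have "basis_vec [XGen, Gr g] - \<chi> g *\<^sub>k basis_vec [Gr g, XGen] \<in> rank_one_relators G \<chi> a \<alpha>"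
    using that by (auto simp: rank_one_relators_def)
  from free_eval_relator[OF this] show ?thesis
    by (simp add: F.diff F.scale free_eval_word)
qed

lemma x_pow_n: "hpow H x n = \<alpha> *\<^sub>k (\<iota> (a [^] n) - hone H)"
proof -
  interpret F: Vector_Spaces.linear pscale pscale "free_eval H \<iota> x" by (rule free_eval_lin)
  have "basis_vec (replicate n XGen) - \<alpha> *\<^sub>k (basis_vec [Gr (a [^] n)] - basis_vec [])
      \<in> rank_one_relators G \<chi> a \<alpha>"
    by (auto simp: rank_one_relators_def)
  from free_eval_relator[OF this] show ?thesis
    by (simp add: F.diff F.scale hpow_x_word[symmetric]) (simp add: free_eval_word)
qed

lemma hpow_Suc: "hpow H u (Suc j) = u \<star> hpow H u j"
  and hpow_0 [simp]: "hpow H u 0 = hone H"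
  by (simp_all add: hpow_def)

lemma hpow_add: "hpow H u (i + j) = hpow H u i \<star> hpow H u j"
  by (induction i) (simp_all add: hpow_Suc mul_assoc)

lemma hpow_1: "hpow H u (Suc 0) = u"
  by (simp add: hpow_Suc)

lemma hpow_x_iota: "hpow H x j \<star> \<iota> g = \<chi> g ^ j *\<^sub>k (\<iota> g \<star> hpow H x j)" if "g \<in> carrier G"
proof (induction j)
  case (Suc j)
  have "hpow H x (Suc j) \<star> \<iota> g = \<chi> g ^ j *\<^sub>k ((x \<star> \<iota> g) \<star> hpow H x j)"
    by (simp add: hpow_Suc mul_assoc Suc mul_simps)
  then show ?case
    by (simp add: x_iota[OF that] hpow_Suc mul_assoc mul_simps mult.commute)
qed simp

lemma pbw_0: "pbw g 0 = \<iota> g"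
  by (simp add: pbw_def)

lemma pbw_one: "pbw \<one> j = hpow H x j"
  by (simp add: pbw_def iota_one)

lemma pbw_one_1: "pbw \<one> (Suc 0) = x"
  by (simp add: pbw_one hpow_1)

lemma iota_pbw: "\<iota> g \<star> pbw h m = pbw (g \<otimes> h) m" if "g \<in> carrier G" "h \<in> carrier G"
  using that by (simp add: pbw_def iota_mult flip: mul_assoc)

lemma pbw_mult: "pbw g i \<star> pbw h j = \<chi> h ^ i *\<^sub>k pbw (g \<otimes> h) (i + j)"
  if "g \<in> carrier G" "h \<in> carrier G"
proof -
  have "pbw g i \<star> pbw h j = \<iota> g \<star> ((hpow H x i \<star> \<iota> h) \<star> hpow H x j)"
    by (simp add: pbw_def mul_assoc)
  also have "\<dots> = \<chi> h ^ i *\<^sub>k ((\<iota> g \<star> \<iota> h) \<star> (hpow H x i \<star> hpow H x j))"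
    by (simp add: hpow_x_iota that mul_simps mul_assoc)
  finally show ?thesis
    by (simp add: iota_mult that pbw_def hpow_add)
qed

lemma x_pbw: "x \<star> pbw h m = \<chi> h *\<^sub>k pbw h (Suc m)" if "h \<in> carrier G"
  using pbw_mult[of \<one> h "Suc 0" m] that by (simp add: pbw_one_1)

lemma pbw_x: "pbw h m \<star> x = pbw h (Suc m)" if "h \<in> carrier G"
  using pbw_mult[of h \<one> m "Suc 0"] that by (simp add: pbw_one_1 chi_one)

lemma pbw_iota: "pbw h m \<star> \<iota> g = \<chi> g ^ m *\<^sub>k pbw (h \<otimes> g) m" if "h \<in> carrier G" "g \<in> carrier G"
  using pbw_mult[of h g m 0] that by (simp add: pbw_0)

lemma pbw_add_n: "pbw g (m + n) = \<alpha> *\<^sub>k (pbw (g \<otimes> a [^] n) m - pbw g m)" if "g \<in> carrier G"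
proof -
  have "pbw g (m + n) = \<iota> g \<star> (hpow H x n \<star> hpow H x m)"
    by (simp add: pbw_def add.commute[of m n] hpow_add)
  also have "\<dots> = \<alpha> *\<^sub>k ((\<iota> g \<star> \<iota> (a [^] n)) \<star> hpow H x m - \<iota> g \<star> hpow H x m)"
    by (simp add: x_pow_n mul_simps mul_assoc)
  finally show ?thesis
    by (simp add: iota_mult that pbw_def)
qed

lemma pbw_lift_trivial: "lift_trivial G \<chi> a \<alpha> \<Longrightarrow> g \<in> carrier G \<Longrightarrow> pbw g (m + n) = 0"
proof -
  assume g: "g \<in> carrier G" and "lift_trivial G \<chi> a \<alpha>"
  then consider "\<alpha> = 0" | "(basis_vec (a [^] n) :: 'g \<Rightarrow>\<^sub>0 'k) = basis_vec \<one>"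
    by (auto simp: lift_trivial_def)
  then show ?thesis
  proof cases
    case 2
    then have "a [^] n = \<one>"
      by (metis lookup_single_eq lookup_single_not_eq zero_neq_one)
    then show ?thesis using g by (simp add: pbw_add_n)
  qed (use g in \<open>simp add: pbw_add_n\<close>)
qed

text \<open>
  The span is stable under left multiplication by the generators, where \<open>x\<^sup>n = \<alpha> (a\<^sup>n - 1)\<close> takes care of
  the vectors of top degree, and words are evaluated by successive left multiplications.
\<close>

lemma pbw_span: "pm.span {pbw g m | g m. g \<in> carrier G \<and> m < n} = UNIV" (is "?S = _")
proof -
  have x_pbw_in: "x \<star> v \<in> ?S" if "v \<in> ?S" for v
    using that
  proof (induction rule: pm.span_induct_alt)
    case (step c v w)
    then obtain g m where g: "v = pbw g m" "g \<in> carrier G" "m < n"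
      by blast
    have gen: "pbw h 0 \<in> ?S" if "h \<in> carrier G" for h
      using that n_gt_1 by (intro pm.span_base) (auto intro!: exI[of _ h] exI[of _ 0])
    have "pbw g (Suc m) \<in> ?S"
    proof (cases "Suc m < n")
      case True
      then show ?thesis using g by (intro pm.span_base) auto
    next
      case False
      then have "Suc m = 0 + n" using g(3) by simp
      then have "pbw g (Suc m) = \<alpha> *\<^sub>k (pbw (g \<otimes> a [^] n) 0 - pbw g 0)"
        using pbw_add_n[OF g(2), of 0] by simp
      then show ?thesis
        using gen g(2) by (simp add: pm.span_scale pm.span_diff)
    qed
    then show ?case
      using step(2) g by (simp add: mul_simps x_pbw pm.span_add pm.span_scale)
  qed (simp add: mul_simps pm.span_zero)
  have iota_pbw_in: "\<iota> g \<star> v \<in> ?S" if "v \<in> ?S" "g \<in> carrier G" for v g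
    using that(1)
  proof (induction rule: pm.span_induct_alt)
    case (step c v w)
    then obtain h m where h: "v = pbw h m" "h \<in> carrier G" "m < n"
      by blast
    then have "pbw (g \<otimes> h) m \<in> ?S"
      using that(2) by (intro pm.span_base) auto
    then show ?case
      using step(2) h that(2) by (simp add: mul_simps iota_pbw pm.span_add pm.span_scale)
  qed (simp add: mul_simps pm.span_zero)
  have word: "free_eval H \<iota> x (basis_vec w) \<in> ?S" if "w \<in> gen_words G" for w
    using that
  proof (induction w)
    case Nil
    have "pbw \<one> 0 \<in> ?S" using n_gt_1 by (intro pm.span_base) (auto intro!: exI[of _ \<one>] exI[of _ 0])
    then show ?case by (simp add: free_eval_word pbw_one)
  next
    case (Cons s w)
    then show ?case
      by (auto simp: free_eval_word gen_words_def intro: x_pbw_in iota_pbw_in)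
  qed
  have "u \<in> ?S" for u
  proof -
    interpret F: Vector_Spaces.linear pscale pscale "free_eval H \<iota> x" by (rule free_eval_lin)
    have "u \<in> free_eval H \<iota> x ` free_alg G"
      using rank_one by (simp add: rank_one_hopf_algebra_def)
    then obtain p where p: "p \<in> free_alg G" "u = free_eval H \<iota> x p"
      by blast
    have "free_eval H \<iota> x (\<Sum>w\<in>Poly_Mapping.keys p. Poly_Mapping.lookup p w *\<^sub>k basis_vec w) \<in> ?S"
      using p(1) by (auto simp: F.sum F.scale free_alg_def intro!: pm.span_sum pm.span_scale word)
    then show ?thesis
      by (simp add: p(2) flip: basis_expansion)
  qed
  then show ?thesis by blast
qed

lemma pbw_ext:
  assumes "Vector_Spaces.linear pscale s f" "Vector_Spaces.linear pscale s f'"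
    and "\<And>g m. g \<in> carrier G \<Longrightarrow> m < n \<Longrightarrow> f (pbw g m) = f' (pbw g m)"
  shows "f u = f' u"
proof -
  interpret f: Vector_Spaces.linear pscale s f by fact
  interpret f': Vector_Spaces.linear pscale s f' by fact
  have "u \<in> pm.span {pbw g m | g m. g \<in> carrier G \<and> m < n}"
    by (simp add: pbw_span)
  then show ?thesis
    by (induction rule: pm.span_induct_alt)
      (auto simp: f.zero f'.zero f.add f'.add f.scale f'.scale assms(3))
qed

lemma pbw_ext2:
  assumes "\<And>v. Vector_Spaces.linear pscale s (\<lambda>u. f u v)" "\<And>u. Vector_Spaces.linear pscale s (f u)"
    and "\<And>v. Vector_Spaces.linear pscale s (\<lambda>u. f' u v)" "\<And>u. Vector_Spaces.linear pscale s (f' u)"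
    and "\<And>g m h j. g \<in> carrier G \<Longrightarrow> h \<in> carrier G \<Longrightarrow> m < n \<Longrightarrow> j < n \<Longrightarrow>
      f (pbw g m) (pbw h j) = f' (pbw g m) (pbw h j)"
  shows "f u v = f' u v"
proof (rule pbw_ext[where s = s and f = "\<lambda>u. f u v" and f' = "\<lambda>u. f' u v", OF assms(1)[of v] assms(3)[of v]])
  fix g m assume g: "g \<in> carrier G" "m < n"
  show "f (pbw g m) v = f' (pbw g m) v"
    by (rule pbw_ext[where f = "f (pbw g m)" and f' = "f' (pbw g m)",
          OF assms(2)[of "pbw g m"] assms(4)[of "pbw g m"]]) (intro assms(5) g)
qed

lemma pbw_ext3:
  assumes "\<And>v w. lin_map (\<lambda>u. f u v w)" "\<And>u w. lin_map (\<lambda>v. f u v w)" "\<And>u v. lin_map (\<lambda>w. f u v w)"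
    and "\<And>v w. lin_map (\<lambda>u. f' u v w)" "\<And>u w. lin_map (\<lambda>v. f' u v w)" "\<And>u v. lin_map (\<lambda>w. f' u v w)"
    and "\<And>g m h j k i. g \<in> carrier G \<Longrightarrow> h \<in> carrier G \<Longrightarrow> k \<in> carrier G \<Longrightarrow>
      f (pbw g m) (pbw h j) (pbw k i) = f' (pbw g m) (pbw h j) (pbw k i)"
  shows "f u v w = f' u v w"
proof (rule pbw_ext[where s = pscale and f = "\<lambda>u. f u v w" and f' = "\<lambda>u. f' u v w", OF assms(1)[of v w] assms(4)[of v w]])
  fix g m assume g: "g \<in> carrier G" "m < n"
  show "f (pbw g m) v w = f' (pbw g m) v w"
    by (rule pbw_ext2[where s = pscale and f = "f (pbw g m)" and f' = "f' (pbw g m)"])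
      (rule assms g | assumption)+
qed

subsection \<open>Linear independence\<close>

text \<open>
  The algebra is known only through its presentation, so independence has to come from a
  representation of the free algebra that kills the relators.  The operators below are what left
  multiplication by the generators would be if the \<open>g x\<^sup>m\<close>, standing for \<open>basis_vec (g, m)\<close>, were a
  basis; the word of \<open>g x\<^sup>m\<close> then sends the vector of \<open>1\<close> to \<open>basis_vec (g, m)\<close>.
\<close>

fun model_op :: "'g gen \<Rightarrow> ('g \<times> nat \<Rightarrow>\<^sub>0 'k) \<Rightarrow> ('g \<times> nat \<Rightarrow>\<^sub>0 'k)" where
  "model_op (Gr h) = lin_ext (\<lambda>(g, m). basis_vec (h \<otimes> g, m))"
| "model_op XGen = lin_ext (\<lambda>(g, m). if Suc m < n then \<chi> g *\<^sub>k basis_vec (g, Suc m)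
     else (\<chi> g * \<alpha>) *\<^sub>k (basis_vec (g \<otimes> a [^] n, 0) - basis_vec (g, 0)))"

text \<open>
  The domain for the relations: on it the exponents of \<open>x\<close> stay below \<open>n\<close> and the group components in \<open>G\<close>,
  so that the laws of \<open>G\<close> and \<open>\<chi>\<close> apply.
\<close>

definition model_space :: "('g \<times> nat \<Rightarrow>\<^sub>0 'k) set" where
  "model_space = pm.span {basis_vec (g, m) | g m. g \<in> carrier G \<and> m < n}"

abbreviation model_act :: "'g gen list \<Rightarrow> ('g \<times> nat \<Rightarrow>\<^sub>0 'k) \<Rightarrow> ('g \<times> nat \<Rightarrow>\<^sub>0 'k)" where
  "model_act w \<equiv> foldr model_op w"

lemma lin_map_model_act: "lin_map (model_act w)"
proof (induction w)
  case Nil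
  show ?case by (simp add: id_def lin_map_ident)
next
  case (Cons s w)
  have "lin_map (model_op s)"
    by (cases s) (simp_all add: lin_map_lin_ext)
  from lin_map_compose[OF this Cons] show ?case
    by (simp add: o_def)
qed

lemma model_space_basis: "g \<in> carrier G \<Longrightarrow> m < n \<Longrightarrow> basis_vec (g, m) \<in> model_space"
  unfolding model_space_def by (rule pm.span_base) auto

lemma model_space_scale: "v \<in> model_space \<Longrightarrow> c *\<^sub>k v \<in> model_space"
  and model_space_diff: "v \<in> model_space \<Longrightarrow> w \<in> model_space \<Longrightarrow> v - w \<in> model_space"
  by (simp_all add: model_space_def pm.span_scale pm.span_diff)

lemma model_op_space:
  assumes "v \<in> model_space" "s \<in> insert XGen (Gr ` carrier G)"
  shows "model_op s v \<in> model_space"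
proof -
  interpret L: Vector_Spaces.linear pscale pscale "model_op s"
    by (cases s) (simp_all add: lin_map_lin_ext)
  show ?thesis
    using assms(1)[unfolded model_space_def]
  proof (induction rule: pm.span_induct_alt)
    case base
    show ?case by (simp add: L.zero model_space_def pm.span_zero)
  next
    case (step c v w)
    then obtain g m where g: "v = basis_vec (g, m)" "g \<in> carrier G" "m < n"
      by blast
    have "model_op s v \<in> model_space"
      using assms(2) g n_gt_1
      by (auto simp: model_space_basis intro!: model_space_scale model_space_diff)
    with step(2) show ?case
      by (simp add: L.add L.scale model_space_def pm.span_add pm.span_scale)
  qed
qed

lemma model_act_space: "v \<in> model_space \<Longrightarrow> w \<in> gen_words G \<Longrightarrow> model_act w v \<in> model_space"
  by (induction w) (auto simp: gen_words_def intro: model_op_space)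

lemma model_act_x_pow:
  assumes "m + i < n"
  shows "model_act (replicate i XGen) (basis_vec (g, m)) = \<chi> g ^ i *\<^sub>k basis_vec (g, m + i)"
  using assms
proof (induction i)
  case (Suc i)
  interpret L: Vector_Spaces.linear pscale pscale "model_op XGen"
    by (simp add: lin_map_lin_ext)
  have "model_op XGen (\<chi> g ^ i *\<^sub>k basis_vec (g, m + i)) = \<chi> g ^ i *\<^sub>k model_op XGen (basis_vec (g, m + i))"
    by (rule L.scale)
  then show ?case
    using Suc by (simp add: mult.commute)
qed simp

text \<open>
  Applying \<open>x\<close> to a vector \<open>n\<close> times takes it through the top degree exactly once.  This produces the
  factor \<open>\<chi>(g)\<^sup>n\<close>; multiplying the group component by \<open>a\<^sup>n\<close> changes no scalar, because \<open>\<chi>(a)\<^sup>n = 1\<close>.  The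
  factor is harmless precisely by the condition on a datum: either it is \<open>1\<close>, or
  \<open>\<alpha> (a\<^sup>n - 1) = 0\<close> and both sides vanish.
\<close>

lemma model_act_relation_x_pow_n:
  assumes g: "g \<in> carrier G" and m: "m < n"
  shows "model_act (replicate n XGen) (basis_vec (g, m)) =
    \<alpha> *\<^sub>k (basis_vec (a [^] n \<otimes> g, m) - basis_vec (g, m))"
proof -
  let ?X = "\<lambda>i. model_act (replicate i XGen)"
  interpret X: Vector_Spaces.linear pscale pscale "?X i" for i
    by (rule lin_map_model_act)
  have split: "?X (i + j) v = ?X i (?X j v)" for i j v
    by (simp add: replicate_add)
  obtain k where k: "n = m + Suc k"
    using m by (intro that[of "n - Suc m"]) simp
  have X0: "?X m (basis_vec (h, 0)) = \<chi> h ^ m *\<^sub>k basis_vec (h, m)" for h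
    using model_act_x_pow[of 0 m h] m by (simp only: add_0)
  have nk: "m + (1 + k) = n"
    using k by simp
  have "?X n (basis_vec (g, m)) = ?X m (?X 1 (?X k (basis_vec (g, m))))"
    by (simp only: split[symmetric] nk)
  also have "?X k (basis_vec (g, m)) = \<chi> g ^ k *\<^sub>k basis_vec (g, m + k)"
    by (rule model_act_x_pow) (simp add: k)
  also have "?X 1 \<dots> = (\<chi> g ^ Suc k * \<alpha>) *\<^sub>k (basis_vec (g \<otimes> a [^] n, 0) - basis_vec (g, 0))"
    using X.scale[of 1 "\<chi> g ^ k" "basis_vec (g, m + k)"] k by (simp add: mult_ac)
  also have "?X m \<dots> = (\<chi> g ^ Suc k * \<alpha>) *\<^sub>k
      (\<chi> (g \<otimes> a [^] n) ^ m *\<^sub>k basis_vec (g \<otimes> a [^] n, m) - \<chi> g ^ m *\<^sub>k basis_vec (g, m))"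
    by (simp only: X.scale X.diff X0)
  also have "\<chi> (g \<otimes> a [^] n) = \<chi> g"
    using g by (simp add: chi_mult chi_pow chi_a_pow_n)
  also have "(\<chi> g ^ Suc k * \<alpha>) *\<^sub>k (\<chi> g ^ m *\<^sub>k basis_vec (g \<otimes> a [^] n, m) - \<chi> g ^ m *\<^sub>k basis_vec (g, m)) =
      \<chi> g ^ n *\<^sub>k (\<alpha> *\<^sub>k (basis_vec (g \<otimes> a [^] n, m) - basis_vec (g, m)))"
    by (simp add: k pm.scale_right_diff_distrib power_add mult_ac)
  also have "\<dots> = \<alpha> *\<^sub>k (basis_vec (g \<otimes> a [^] n, m) - basis_vec (g, m))"
  proof -
    consider "\<forall>g\<in>carrier G. \<chi> g ^ n = 1" | "\<alpha> = 0" |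
      "(basis_vec (a [^] n) :: 'g \<Rightarrow>\<^sub>0 'k) = basis_vec \<one>"
      using datum by (auto simp: datum_def lift_trivial_def)
    then show ?thesis
    proof cases
      case 3
      then have "a [^] n = \<one>"
        by (metis lookup_single_eq lookup_single_not_eq zero_neq_one)
      then show ?thesis using g by simp
    qed (use g in auto)
  qed
  finally show ?thesis by (simp add: a_pow_central[OF g])
qed

lemma model_act_relator:
  assumes r: "r \<in> rank_one_relators G \<chi> a \<alpha>" and v: "v \<in> model_space"
  shows "lin_ext (\<lambda>w. model_act w v) r = 0"
proof -
  interpret E: Vector_Spaces.linear pscale pscale "lin_ext (\<lambda>w. model_act w v)" for v
    by (rule lin_map_lin_ext)
  interpret A: Vector_Spaces.linear pscale pscale "model_act w" for w
    by (rule lin_map_model_act)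
  have lin: "lin_map (\<lambda>v. lin_ext (\<lambda>w. model_act w v) r)"
    unfolding lin_ext_def by (intro lin_map_sum lin_map_scale lin_map_model_act)
  then interpret V: Vector_Spaces.linear pscale pscale "\<lambda>v. lin_ext (\<lambda>w. model_act w v) r" .
  have basis: "lin_ext (\<lambda>w. model_act w (basis_vec (g, m))) r = 0"
    if g: "g \<in> carrier G" and m: "m < n" for g m
  proof -
    have model_op_lin: "model_op (Gr h) (c *\<^sub>k v) = c *\<^sub>k model_op (Gr h) v"
      "model_op (Gr h) (u - v) = model_op (Gr h) u - model_op (Gr h) v" for h c u v
      using A.scale[of "[Gr h]"] A.diff[of "[Gr h]"] by simp_all
    have assoc: "h \<otimes> g \<otimes> a [^] n = h \<otimes> (g \<otimes> a [^] n)" if "h \<in> carrier G" for h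
      using that g by (simp add: m_assoc)
    show ?thesis
      using r g m model_act_relation_x_pow_n[OF g m]
      by (auto simp: rank_one_relators_def E.diff E.scale m_assoc chi_mult model_op_lin mult_ac
          simp del: model_op.simps)
        (auto simp: m_assoc model_op_lin chi_mult assoc mult_ac model_op_lin[unfolded model_op.simps])
  qed
  show ?thesis
    using v[unfolded model_space_def]
    by (induction rule: pm.span_induct_alt) (auto simp: V.zero V.add V.scale basis)
qed

lemma model_act_ideal:
  assumes "p \<in> free_ideal G (rank_one_relators G \<chi> a \<alpha>)" "v \<in> model_space"
  shows "lin_ext (\<lambda>w. model_act w v) p = 0"
proof -
  interpret E: Vector_Spaces.linear pscale pscale "lin_ext (\<lambda>w. model_act w v)"
    by (rule lin_map_lin_ext)
  have "lin_ext (\<lambda>w. model_act w v) (lin_ext (\<lambda>m. basis_vec (w @ m @ w')) r) = 0"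
    if "w \<in> gen_words G" "r \<in> rank_one_relators G \<chi> a \<alpha>" "w' \<in> gen_words G" for w r w'
  proof -
    have "lin_ext (\<lambda>w. model_act w v) (lin_ext (\<lambda>m. basis_vec (w @ m @ w')) r) =
        model_act w (lin_ext (\<lambda>m. model_act m (model_act w' v)) r)"
      by (rule linear_basis_ext[where s = pscale and f = "\<lambda>r. lin_ext (\<lambda>w. model_act w v) (lin_ext (\<lambda>m. basis_vec (w @ m @ w')) r)"
        and g = "\<lambda>r. model_act w (lin_ext (\<lambda>m. model_act m (model_act w' v)) r)"])
        (simp_all add: lin_map_compose[OF lin_map_lin_ext lin_map_lin_ext] lin_map_compose[OF lin_map_model_act lin_map_lin_ext])
    also have "\<dots> = model_act w 0"
      using that by (simp add: model_act_relator model_act_space assms(2))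
    also have "\<dots> = 0"
      by (simp add: lin_map_simps[OF lin_map_model_act])
    finally show ?thesis .
  qed
  note relator = this
  show ?thesis
    using assms(1)[unfolded free_ideal_def]
    by (induction rule: pm.span_induct_alt) (auto simp: E.zero E.add E.scale relator)
qed

text \<open>
  The choice of \<open>p\<close> is immaterial: two choices differ by an element of the ideal of relations, which
  acts as zero.
\<close>

definition coords :: "('b \<Rightarrow>\<^sub>0 'k) \<Rightarrow> ('g \<times> nat \<Rightarrow>\<^sub>0 'k)" where
  "coords u = lin_ext (\<lambda>w. model_act w (basis_vec (\<one>, 0)))
     (SOME p. p \<in> free_alg G \<and> free_eval H \<iota> x p = u)"

lemma coords_free_eval:
  assumes "p \<in> free_alg G"
  shows "coords (free_eval H \<iota> x p) = lin_ext (\<lambda>w. model_act w (basis_vec (\<one>, 0))) p"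
proof -
  interpret E: Vector_Spaces.linear pscale pscale "lin_ext (\<lambda>w. model_act w (basis_vec (\<one>, 0)))"
    by (rule lin_map_lin_ext)
  interpret F: Vector_Spaces.linear pscale pscale "free_eval H \<iota> x" by (rule free_eval_lin)
  define p' where "p' = (SOME p'. p' \<in> free_alg G \<and> free_eval H \<iota> x p' = free_eval H \<iota> x p)"
  have p': "p' \<in> free_alg G" "free_eval H \<iota> x p' = free_eval H \<iota> x p"
    using someI[of "\<lambda>p'. p' \<in> free_alg G \<and> free_eval H \<iota> x p' = free_eval H \<iota> x p" p] assms
    by (auto simp: p'_def)
  have "p' - p \<in> free_alg G"
    using p'(1) assms keys_diff[of p' p] by (auto simp: free_alg_def)
  then have "p' - p \<in> free_ideal G (rank_one_relators G \<chi> a \<alpha>)"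
    using rank_one p'(2) by (auto simp: rank_one_hopf_algebra_def F.diff)
  from model_act_ideal[OF this model_space_basis[of \<one> 0]] show ?thesis
    using n_gt_1 by (simp add: E.diff coords_def p'_def)
qed

lemma coords_lin: "lin_map coords"
proof -
  interpret E: Vector_Spaces.linear pscale pscale "lin_ext (\<lambda>w. model_act w (basis_vec (\<one>, 0)))"
    by (rule lin_map_lin_ext)
  interpret F: Vector_Spaces.linear pscale pscale "free_eval H \<iota> x" by (rule free_eval_lin)
  have surj: "\<exists>p\<in>free_alg G. u = free_eval H \<iota> x p" for u
    using rank_one by (metis UNIV_I image_iff rank_one_hopf_algebra_def)
  show ?thesis
  proof (rule lin_mapI)
    fix u v
    obtain p p' where "p \<in> free_alg G" "u = free_eval H \<iota> x p" "p' \<in> free_alg G" "v = free_eval H \<iota> x p'"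
      using surj by metis
    moreover from this have "p + p' \<in> free_alg G"
      using Poly_Mapping.keys_add[of p p'] by (auto simp: free_alg_def)
    ultimately show "coords (u + v) = coords u + coords v"
      by (simp add: coords_free_eval E.add flip: F.add)
  next
    fix c u
    obtain p where "p \<in> free_alg G" "u = free_eval H \<iota> x p"
      using surj by metis
    moreover from this have "c *\<^sub>k p \<in> free_alg G"
      by (auto simp: free_alg_def in_keys_iff)
    ultimately show "coords (c *\<^sub>k u) = c *\<^sub>k coords u"
      by (simp add: coords_free_eval E.scale flip: F.scale)
  qed
qed

lemma coords_pbw:
  assumes "g \<in> carrier G" "m < n"
  shows "coords (pbw g m) = basis_vec (g, m)"
proof -
  have "(basis_vec (Gr g # replicate m XGen) :: _ \<Rightarrow>\<^sub>0 'k) \<in> free_alg G"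
    using assms(1) by (auto simp: free_alg_def gen_words_def)
  then show ?thesis
    using model_act_x_pow[of 0 m \<one>] assms
    by (simp add: pbw_word coords_free_eval chi_one del: model_op.simps)
      (simp add: model_op.simps(1))
qed

definition coord :: "'g \<Rightarrow> nat \<Rightarrow> ('b \<Rightarrow>\<^sub>0 'k) \<Rightarrow> 'k" where
  "coord g m u = Poly_Mapping.lookup (coords u) (g, m)"

lemma coord_form: "lin_form (coord g m)"
  using coords_lin
  by (simp add: Vector_Spaces.linear_iff vector_space_field_mult coord_def lookup_add)

lemma coord_pbw:
  assumes "h \<in> carrier G" "k < n"
  shows "coord g m (pbw h k) = (if g = h \<and> m = k then 1 else 0)"
  using assms by (simp add: coord_def coords_pbw lookup_single when_def)

lemmas coord_simps = lin_form_simps[OF coord_form]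

lemma pbw_expansion: "u = (\<Sum>g\<in>carrier G. \<Sum>m<n. coord g m u *\<^sub>k pbw g m)"
proof (rule pbw_ext[where s = pscale and f = "\<lambda>u. u" and f' = "\<lambda>u. \<Sum>g\<in>carrier G. \<Sum>m<n. coord g m u *\<^sub>k pbw g m"])
  fix h k assume h: "h \<in> carrier G" "k < n"
  have "(\<Sum>m<n. coord g m (pbw h k) *\<^sub>k pbw g m) =
      (\<Sum>m<n. if m = k then if g = h then pbw h k else 0 else 0)" for g
    using h by (intro sum.cong) (auto simp: coord_pbw)
  then show "pbw h k = (\<Sum>g\<in>carrier G. \<Sum>m<n. coord g m (pbw h k) *\<^sub>k pbw g m)"
    using h finite_G by (simp add: sum.delta)
qed (intro lin_map_ident lin_map_sum lin_map_scale_form coord_form)+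

lemma iota_inj: "\<iota> g = \<iota> h \<Longrightarrow> g \<in> carrier G \<Longrightarrow> h \<in> carrier G \<Longrightarrow> g = h"
  using coord_pbw[of g 0 g 0] coord_pbw[of h 0 g 0] n_gt_1 by (auto simp: pbw_0 split: if_splits)

subsection \<open>The coproduct\<close>

lemma swd_iota: "g \<in> carrier G \<Longrightarrow> bilin_map f \<Longrightarrow> swd H (\<iota> g) f = f (\<iota> g) (\<iota> g)"
  by (rule swd_comul) (auto simp: comul_iota)

lemma swd_x: "bilin_map f \<Longrightarrow> swd H x f = f x (\<iota> a) + f (\<iota> \<one>) x"
  by (rule swd_comul_add) (auto simp: comul_x iota_one)

text \<open>
  The two summands of \<open>\<Delta> x = x \<otimes> a + 1 \<otimes> x\<close> commute up to \<open>\<chi>(a)\<close>, which makes this the \<open>q\<close>-binomial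
  theorem.
\<close>

lemma comul_pbw:
  assumes g: "g \<in> carrier G"
  shows "comul H (pbw g m) =
    (\<Sum>k\<le>m. gauss_binom (\<chi> a) m k *\<^sub>k (pbw g k \<boxtimes> pbw (g \<otimes> a [^] k) (m - k)))"
proof (induction m)
  case 0
  show ?case using g by (simp add: pbw_0 comul_iota)
next
  case (Suc m)
  let ?b = "gauss_binom (\<chi> a)"
  let ?Y = "\<lambda>k. pbw g k \<boxtimes> pbw (g \<otimes> a [^] k) (Suc m - k)"
  have step: "bilin_map (\<lambda>u1 u2. (u1 \<star> x) \<boxtimes> (u2 \<star> \<iota> a) + u1 \<boxtimes> (u2 \<star> x))"
    by (intro bilin_mapI lin_map_add lin_H)
  have inner: "bilin_map (\<lambda>v1 v2. (u1 \<star> v1) \<boxtimes> (u2 \<star> v2))" for u1 u2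
    by (intro bilin_mapI lin_H)
  have "comul H (pbw g (Suc m)) = swd H (pbw g m) (\<lambda>u1 u2. (u1 \<star> x) \<boxtimes> (u2 \<star> \<iota> a) + u1 \<boxtimes> (u2 \<star> x))"
    using g by (simp add: comul_mul swd_x inner iota_one flip: pbw_x)
  also have "\<dots> = (\<Sum>k\<le>m. ?b m k *\<^sub>k ((pbw g k \<star> x) \<boxtimes> (pbw (g \<otimes> a [^] k) (m - k) \<star> \<iota> a) +
      pbw g k \<boxtimes> (pbw (g \<otimes> a [^] k) (m - k) \<star> x)))"
    unfolding swd_def Suc
    by (simp add: lin_map_simps[OF lin_map_tlift] tlift_tens[OF step])
  also have "\<dots> = (\<Sum>k\<le>m. (\<chi> a ^ (m - k) * ?b m k) *\<^sub>k ?Y (Suc k)) + (\<Sum>k\<le>m. ?b m k *\<^sub>k ?Y k)"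
    unfolding sum.distrib[symmetric]
    using g by (intro sum.cong)
      (auto simp: pbw_x pbw_iota m_assoc tens_simps pm.scale_right_distrib Suc_diff_le mult.commute)
  also have "(\<Sum>k\<le>m. ?b m k *\<^sub>k ?Y k) = (\<Sum>k\<le>Suc m. ?b m k *\<^sub>k ?Y k)"
    by (simp add: gauss_binom_eq_0)
  also have "\<dots> = ?Y 0 + (\<Sum>k\<le>m. ?b m (Suc k) *\<^sub>k ?Y (Suc k))"
    by (simp only: sum.atMost_Suc_shift) simp
  also have "(\<Sum>k\<le>m. (\<chi> a ^ (m - k) * ?b m k) *\<^sub>k ?Y (Suc k)) + (?Y 0 + (\<Sum>k\<le>m. ?b m (Suc k) *\<^sub>k ?Y (Suc k))) =
      ?Y 0 + (\<Sum>k\<le>m. ?b (Suc m) (Suc k) *\<^sub>k ?Y (Suc k))"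
    by (simp add: pm.scale_left_distrib sum.distrib)
  also have "\<dots> = (\<Sum>k\<le>Suc m. ?b (Suc m) k *\<^sub>k ?Y k)"
    by (simp only: sum.atMost_Suc_shift) simp
  finally show ?case .
qed

lemma swd_pbw:
  assumes "g \<in> carrier G" "bilin_map f"
  shows "swd H (pbw g m) f =
    (\<Sum>k\<le>m. gauss_binom (\<chi> a) m k *\<^sub>k f (pbw g k) (pbw (g \<otimes> a [^] k) (m - k)))"
  unfolding swd_def comul_pbw[OF assms(1)]
  by (simp add: lin_map_simps[OF lin_map_tlift] tlift_tens[OF assms(2)])

lemma swd_pbw_first:
  assumes g: "g \<in> carrier G" and f: "bilin_map f"
    and zero: "\<And>k. 0 < k \<Longrightarrow> k \<le> m \<Longrightarrow> f (pbw g k) (pbw (g \<otimes> a [^] k) (m - k)) = 0"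
  shows "swd H (pbw g m) f = f (pbw g 0) (pbw g m)"
proof -
  have "swd H (pbw g m) f = (\<Sum>k\<le>m. if k = 0 then f (pbw g 0) (pbw g m) else 0)"
    unfolding swd_pbw[OF g f] using g zero by (intro sum.cong) auto
  then show ?thesis by simp
qed

lemma swd_pbw_last:
  assumes g: "g \<in> carrier G" and f: "bilin_map f"
    and zero: "\<And>k. k < m \<Longrightarrow> f (pbw g k) (pbw (g \<otimes> a [^] k) (m - k)) = 0"
  shows "swd H (pbw g m) f = f (pbw g m) (pbw (g \<otimes> a [^] m) 0)"
proof -
  have "swd H (pbw g m) f = (\<Sum>k\<le>m. if k = m then f (pbw g m) (pbw (g \<otimes> a [^] m) 0) else 0)"
    unfolding swd_pbw[OF g f] using g zero by (intro sum.cong) auto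
  then show ?thesis by simp
qed

lemma counit_iota: "g \<in> carrier G \<Longrightarrow> counit H (\<iota> g) = 1"
proof -
  assume g: "g \<in> carrier G"
  have "bilin_map (\<lambda>u1 u2. counit H u1 *\<^sub>k u2)"
    by (intro bilin_mapI lin_map_scale lin_map_scale_form counit_form lin_map_ident)
  then have "counit H (\<iota> g) *\<^sub>k \<iota> g = \<iota> g"
    using g coalg swd_iota[OF g, of "\<lambda>u1 u2. counit H u1 *\<^sub>k u2"] by (metis coalgebra_def)
  moreover have "\<iota> g \<noteq> 0"
    using coord_pbw[OF g, of 0 g 0] n_gt_1 by (auto simp: pbw_0 coord_simps)
  ultimately show ?thesis
    by (metis pm.scale_right_imp_eq pm.scale_one)
qed

lemma counit_x: "counit H x = 0"
proof -
  have "bilin_map (\<lambda>u1 u2. counit H u1 *\<^sub>k u2)"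
    by (intro bilin_mapI lin_map_scale lin_map_scale_form counit_form lin_map_ident)
  then have "counit H x *\<^sub>k \<iota> a + x = x"
    using coalg swd_x[of "\<lambda>u1 u2. counit H u1 *\<^sub>k u2"] by (simp add: coalgebra_def iota_one)
  moreover have "\<iota> a \<noteq> 0"
    using coord_pbw[of a 0 a 0] n_gt_1 by (auto simp: pbw_0 coord_simps)
  ultimately show ?thesis by simp
qed

lemma counit_pbw: "g \<in> carrier G \<Longrightarrow> counit H (pbw g m) = (if m = 0 then 1 else 0)"
  by (cases m) (auto simp: pbw_0 counit_iota counit_mul counit_x simp flip: pbw_x)

end


context rank_one
begin

section \<open>Group-like and skew primitive elements\<close>

lemma coord_eqI:
  assumes "\<And>g m. g \<in> carrier G \<Longrightarrow> m < n \<Longrightarrow> coord g m u = coord g m v"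
  shows "u = v"
  by (subst (1 2) pbw_expansion) (intro sum.cong refl, simp add: assms)

lemma coord_iota: "h \<in> carrier G \<Longrightarrow> coord g m (\<iota> h) = (if g = h \<and> m = 0 then 1 else 0)"
  using coord_pbw[of h 0 g m] n_gt_1 by (simp add: pbw_0)

lemma coord_x: "coord g m x = (if g = \<one> \<and> m = Suc 0 then 1 else 0)"
  using coord_pbw[of \<one> "Suc 0" g m] n_gt_1 by (simp add: pbw_one_1)

lemma bilin_coord_left: "bilin_map (\<lambda>u v. coord g m u *\<^sub>k v)"
  by (intro bilin_mapI lin_map_scale lin_map_scale_form coord_form lin_map_ident)

lemma bilin_coord_right: "bilin_map (\<lambda>u v. coord g m v *\<^sub>k u)"
  by (intro bilin_mapI lin_map_scale lin_map_scale_form coord_form lin_map_ident)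

text \<open>
  The coefficient of \<open>g x\<^sup>k\<close> in the first tensor factor of \<open>\<Delta> u\<close>.  Such slices reduce equations between
  tensors to equations in \<open>H\<close>.
\<close>

lemma coord_swd:
  assumes g: "g \<in> carrier G" and k: "k < n"
  shows "swd H u (\<lambda>u1 u2. coord g k u1 *\<^sub>k u2) =
    (\<Sum>m<n. (coord g m u * gauss_binom (\<chi> a) m k) *\<^sub>k pbw (g \<otimes> a [^] k) (m - k))"
    (is "?L u = ?R u")
proof (rule pbw_ext[where s = pscale and f = ?L and f' = ?R])
  show "lin_map ?L"
    by (intro lin_map_swd lin_coalg lin_map_ident)
  have "?R = (\<lambda>u. \<Sum>m<n. coord g m u *\<^sub>k (gauss_binom (\<chi> a) m k *\<^sub>k pbw (g \<otimes> a [^] k) (m - k)))"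
    by simp
  moreover have "lin_map \<dots>"
    by (intro lin_map_sum lin_map_scale_form coord_form lin_map_ident)
  ultimately show "lin_map ?R"
    by (simp only:)
next
  fix h m assume h: "h \<in> carrier G" "m < n"
  let ?y = "if g = h then gauss_binom (\<chi> a) m k *\<^sub>k pbw (g \<otimes> a [^] k) (m - k) else 0"
  have "?L (pbw h m) = (\<Sum>i\<le>m. if i = k then ?y else 0)"
    unfolding swd_pbw[OF h(1) bilin_coord_left]
    using h by (intro sum.cong) (auto simp: coord_pbw)
  also have "\<dots> = ?y"
    by (simp add: gauss_binom_eq_0)
  also have "\<dots> = (\<Sum>i<n. if i = m then ?y else 0)"
    using h by simp
  also have "\<dots> = ?R (pbw h m)"
    using h by (intro sum.cong) (auto simp: coord_pbw)
  finally show "?L (pbw h m) = ?R (pbw h m)" .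
qed

text \<open>
  Take the slice of \<open>\<Delta> u = u \<otimes> u\<close> at \<open>g x\<^sup>M\<close>, where \<open>M\<close> is the largest degree for which \<open>u\<close> has a nonzero
  coefficient at \<open>g\<close>: on one side it is a multiple of \<open>u\<close>, on the other only the term of degree \<open>0\<close>
  remains, a multiple of \<open>g a\<^sup>M\<close>.
\<close>

lemma group_like_in_G:
  assumes u: "comul H u = u \<boxtimes> u" "u \<noteq> 0"
  obtains g where "g \<in> carrier G" "u = \<iota> g"
proof -
  obtain g m0 where g: "g \<in> carrier G" "m0 < n" "coord g m0 u \<noteq> 0"
    using coord_eqI[of u 0] u(2) by (auto simp: coord_simps)
  define M where "M = Max {m. m < n \<and> coord g m u \<noteq> 0}"
  have fin: "finite {m. m < n \<and> coord g m u \<noteq> 0}"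
    by simp
  moreover have "{m. m < n \<and> coord g m u \<noteq> 0} \<noteq> {}"
    using g by blast
  ultimately have M: "M < n" "coord g M u \<noteq> 0"
    using Max_in[of "{m. m < n \<and> coord g m u \<noteq> 0}"] by (auto simp: M_def)
  have above: "coord g m u = 0" if "M < m" "m < n" for m
  proof (rule ccontr)
    assume "coord g m u \<noteq> 0"
    then have "m \<le> M"
      using that(2) fin unfolding M_def by (intro Max_ge) auto
    then show False using that(1) by simp
  qed
  have "coord g M u *\<^sub>k u = swd H u (\<lambda>u1 u2. coord g M u1 *\<^sub>k u2)"
    by (simp add: swd_comul[OF bilin_coord_left u(1)])
  also have "\<dots> = (\<Sum>m<n. if m = M then coord g M u *\<^sub>k \<iota> (g \<otimes> a [^] M) else 0)"
    unfolding coord_swd[OF g(1) M(1)]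
  proof (rule sum.cong, rule refl)
    fix m assume "m \<in> {..<n}"
    then show "(coord g m u * gauss_binom (\<chi> a) m M) *\<^sub>k pbw (g \<otimes> a [^] M) (m - M) =
        (if m = M then coord g M u *\<^sub>k \<iota> (g \<otimes> a [^] M) else 0)"
      using above[of m] by (cases m M rule: linorder_cases) (auto simp: gauss_binom_eq_0 pbw_0)
  qed
  also have "\<dots> = coord g M u *\<^sub>k \<iota> (g \<otimes> a [^] M)"
    using M(1) by simp
  finally have "u = \<iota> (g \<otimes> a [^] M)"
    using M(2) by simp
  with g(1) show ?thesis
    by (intro that[of "g \<otimes> a [^] M"]) auto
qed

text \<open>
  The slices of \<open>\<Delta> u = u \<otimes> b + 1 \<otimes> u\<close> in degree \<open>1\<close> show that \<open>u\<close> has no component of degree above \<open>1\<close>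
  and that a component \<open>g x\<close> requires \<open>g a = b\<close>; those in degree \<open>0\<close> show that \<open>g = 1\<close> there and
  determine the part of degree \<open>0\<close>.
\<close>

lemma skew_primitive_form:
  assumes b: "b \<in> carrier G" and u: "comul H u = u \<boxtimes> \<iota> b + \<iota> \<one> \<boxtimes> u"
  shows "u = coord \<one> (Suc 0) u *\<^sub>k x + coord \<one> 0 u *\<^sub>k (\<iota> \<one> - \<iota> b)"
    and "coord \<one> (Suc 0) u \<noteq> 0 \<Longrightarrow> b = a"
proof -
  let ?C = "gauss_binom (\<chi> a)"
  have slice: "coord g k u *\<^sub>k \<iota> b + coord g k (\<iota> \<one>) *\<^sub>k u =
      (\<Sum>m<n. (coord g m u * ?C m k) *\<^sub>k pbw (g \<otimes> a [^] k) (m - k))"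
    if "g \<in> carrier G" "k < n" for g k
    using coord_swd[OF that, of u] by (simp add: swd_comul_add[OF bilin_coord_left u])
  have slice_0: "coord g 0 u * coord h j (\<iota> b) + coord g 0 (\<iota> \<one>) * coord h j u =
      (if h = g then coord g j u else 0)" if "g \<in> carrier G" "h \<in> carrier G" "j < n" for g h j
  proof -
    have "coord g 0 u * coord h j (\<iota> b) + coord g 0 (\<iota> \<one>) * coord h j u =
        coord h j (\<Sum>m<n. (coord g m u * ?C m 0) *\<^sub>k pbw (g \<otimes> a [^] (0::nat)) (m - 0))"
      using slice[OF that(1), of 0] n_gt_1 by (simp flip: coord_simps)
    also have "\<dots> = (\<Sum>m<n. if m = j then if h = g then coord g j u else 0 else 0)"
      using that unfolding coord_simps by (intro sum.cong) (auto simp: coord_pbw)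
    finally show ?thesis
      using that by simp
  qed
  have slice_1: "coord g (Suc 0) u * coord (g \<otimes> a) j (\<iota> b) = coord g (Suc j) u * ?C (Suc j) (Suc 0)"
    if "g \<in> carrier G" "Suc j < n" for g j
  proof -
    have "coord g (Suc 0) u * coord (g \<otimes> a) j (\<iota> b) =
        coord (g \<otimes> a) j (\<Sum>m<n. (coord g m u * ?C m (Suc 0)) *\<^sub>k pbw (g \<otimes> a [^] (Suc 0)) (m - Suc 0))"
      using slice[OF that(1), of "Suc 0"] n_gt_1 by (simp add: coord_iota flip: coord_simps)
    also have "\<dots> = (\<Sum>m<n. if m = Suc j then coord g (Suc j) u * ?C (Suc j) (Suc 0) else 0)"
    proof (unfold coord_simps, rule sum.cong, rule refl)
      fix m assume "m \<in> {..<n}"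
      then show "coord g m u * ?C m (Suc 0) * coord (g \<otimes> a) j (pbw (g \<otimes> a [^] Suc 0) (m - Suc 0)) =
          (if m = Suc j then coord g (Suc j) u * ?C (Suc j) (Suc 0) else 0)"
        using that by (cases m) (auto simp: coord_pbw)
    qed
    finally show ?thesis
      using that by simp
  qed
  have high: "coord g m u = 0" if "g \<in> carrier G" "Suc 0 < m" "m < n" for g m
    using slice_1[of g "m - 1"] that b gauss_binom_1_neq_0[of m] by (auto simp: coord_iota)
  have one: "coord g (Suc 0) u = 0" if "g \<in> carrier G" "g \<noteq> \<one> \<or> g \<otimes> a \<noteq> b" for g
    using slice_1[of g 0] slice_0[of g g "Suc 0"] that b n_gt_1
      gauss_binom_1_neq_0[of "Suc 0"] by (auto simp: coord_iota split: if_splits)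
  have zero: "coord g 0 u = (if g = \<one> then coord \<one> 0 u else 0) - (if g = b then coord \<one> 0 u else 0)"
    if "g \<in> carrier G" for g
  proof -
    \<comment> \<open>For \<open>b = 1\<close> the slice at \<open>g = 1\<close> says that twice the coefficient of \<open>1\<close> equals this coefficient.\<close>
    have "(2::'k) \<noteq> 1"
      by (metis add_cancel_left_left one_add_one zero_neq_one)
    then show ?thesis
      using slice_0[of g g 0] slice_0[of \<one> g 0] that b n_gt_1
      by (auto simp: coord_iota eq_neg_iff_add_eq_0 add.commute)
  qed
  show "u = coord \<one> (Suc 0) u *\<^sub>k x + coord \<one> 0 u *\<^sub>k (\<iota> \<one> - \<iota> b)"
  proof (rule coord_eqI)
    fix g m assume g: "g \<in> carrier G" "m < n"
    consider "m = 0" | "m = Suc 0" | "Suc 0 < m" by linarith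
    then show "coord g m u = coord g m (coord \<one> (Suc 0) u *\<^sub>k x + coord \<one> 0 u *\<^sub>k (\<iota> \<one> - \<iota> b))"
      using g b zero[OF g(1)] one[OF g(1)] high[OF g(1) _ g(2)]
      by cases (auto simp: coord_simps coord_x coord_iota)
  qed
  show "b = a" if "coord \<one> (Suc 0) u \<noteq> 0"
    using one[of \<one>] that by auto
qed

end


section \<open>The operations of a Hopf q-brace on the generators\<close>

text \<open>
  The axioms of a Hopf q-brace that concern one operation \<open>d\<close>, where the other operation \<open>c\<close> occurs
  only in the last rule for products.  The cycle identities are left out: exchanging the operations
  turns them into their variants for the opposite coproduct, so they would break the symmetry.
\<close>

definition (in rank_one) half_brace ::
  "(('b \<Rightarrow>\<^sub>0 'k) \<Rightarrow> ('b \<Rightarrow>\<^sub>0 'k) \<Rightarrow> ('b \<Rightarrow>\<^sub>0 'k)) \<Rightarrow> (('b \<Rightarrow>\<^sub>0 'k) \<Rightarrow> ('b \<Rightarrow>\<^sub>0 'k) \<Rightarrow> ('b \<Rightarrow>\<^sub>0 'k)) \<Rightarrow> bool" where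
  "half_brace d c \<longleftrightarrow> bilin_map d \<and>
     (\<forall>u v. counit H (d u v) = counit H u * counit H v) \<and>
     (\<forall>u v. comul H (d u v) = swd H u (\<lambda>u1 u2. swd H v (\<lambda>v1 v2. d u1 v2 \<boxtimes> d u2 v1))) \<and>
     (\<forall>u. d u (hone H) = u) \<and> (\<forall>u v w. d u (v \<star> w) = d (d u w) v) \<and>
     (\<forall>u v w. d (u \<star> v) w = swd H v (\<lambda>v1 v2. swd H w (\<lambda>w1 w2. d u (c w1 v2) \<star> d v1 w2))) \<and>
     d x x = 0"

text \<open>
  Here \<open>d\<close> and \<open>c\<close> stand for \<open>\<cdot>\<close> and \<open>:\<close>, in either order.
\<close>

locale brace_pair = rank_one G \<chi> a \<alpha> H \<iota> x
  for G :: "('g, 'm) monoid_scheme" (structure)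
    and \<chi> :: "'g \<Rightarrow> 'k::field" and a \<alpha> and H :: "('b, 'k, 'z) bialg_scheme" and \<iota> x +
  fixes d c :: "('b \<Rightarrow>\<^sub>0 'k) \<Rightarrow> ('b \<Rightarrow>\<^sub>0 'k) \<Rightarrow> ('b \<Rightarrow>\<^sub>0 'k)"
  assumes half_d: "half_brace d c" and half_c: "half_brace c d"
    and flip: "swd H u (\<lambda>u1 u2. swd H v (\<lambda>v1 v2. c v1 u2 \<boxtimes> d u1 v2)) =
       swd H u (\<lambda>u1 u2. swd H v (\<lambda>v1 v2. c v2 u1 \<boxtimes> d u2 v1))"

definition (in rank_one) restrict_op ::
  "(('b \<Rightarrow>\<^sub>0 'k) \<Rightarrow> ('b \<Rightarrow>\<^sub>0 'k) \<Rightarrow> ('b \<Rightarrow>\<^sub>0 'k)) \<Rightarrow> 'g \<Rightarrow> 'g \<Rightarrow> 'g" where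
  "restrict_op d g h = inv_into (carrier G) \<iota> (d (\<iota> g) (\<iota> h))"

text \<open>
  The scalar \<open>\<lambda>(g)\<close> with \<open>x \<cdot> g = \<lambda>(g) x\<close>, defined as a coefficient because \<open>x \<cdot> g\<close> is at first only
  known to be skew primitive.
\<close>

definition (in rank_one) x_weight ::
  "(('b \<Rightarrow>\<^sub>0 'k) \<Rightarrow> ('b \<Rightarrow>\<^sub>0 'k) \<Rightarrow> ('b \<Rightarrow>\<^sub>0 'k)) \<Rightarrow> 'g \<Rightarrow> 'k" where
  "x_weight d g = coord \<one> (Suc 0) (d x (\<iota> g))"

context brace_pair
begin

lemma bilin_d: "bilin_map d" and bilin_c: "bilin_map c"
  using half_d half_c by (auto simp: half_brace_def)

text \<open>
  Exchanging the tensor factors in the flip identity gives the same identity with \<open>u\<close> and \<open>v\<close> and the two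
  operations exchanged.
\<close>

lemma brace_pair_swap: "brace_pair G \<chi> a \<alpha> H \<iota> x c d"
proof (unfold_locales, rule half_c, rule half_d)
  fix u v
  note lin = bilin_map_left[OF bilin_d] bilin_map_right[OF bilin_d]
    bilin_map_left[OF bilin_c] bilin_map_right[OF bilin_c] lin_H
  have swap: "bilin_map (\<lambda>s t. t \<boxtimes> s)"
    by (intro bilin_mapI lin)
  have "tlift (\<lambda>s t. t \<boxtimes> s) (swd H v (\<lambda>v1 v2. swd H u (\<lambda>u1 u2. c u1 v2 \<boxtimes> d v1 u2))) =
      tlift (\<lambda>s t. t \<boxtimes> s) (swd H v (\<lambda>v1 v2. swd H u (\<lambda>u1 u2. c u2 v1 \<boxtimes> d v2 u1)))"
    by (simp add: flip)
  then show "swd H u (\<lambda>u1 u2. swd H v (\<lambda>v1 v2. d v1 u2 \<boxtimes> c u1 v2)) =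
      swd H u (\<lambda>u1 u2. swd H v (\<lambda>v1 v2. d v2 u1 \<boxtimes> c u2 v1))"
    by (simp add: lin_map_swd_eq[OF lin_map_tlift] tlift_tens[OF swap])
      (simp only: swd_swap[of H v H u])
qed

lemmas lin_dc = bilin_map_left[OF bilin_d] bilin_map_right[OF bilin_d]
  bilin_map_left[OF bilin_c] bilin_map_right[OF bilin_c] lin_H lin_map_add

lemmas d_simps = bilin_map_simps[OF bilin_d]

lemma comul_d: "comul H (d u v) = swd H u (\<lambda>u1 u2. swd H v (\<lambda>v1 v2. d u1 v2 \<boxtimes> d u2 v1))"
  and counit_d: "counit H (d u v) = counit H u * counit H v"
  and d_one [simp]: "d u (hone H) = u" and c_one [simp]: "c u (hone H) = u"
  and d_mult: "d u (v \<star> w) = d (d u w) v"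
  and d_mult_left: "d (u \<star> v) w = swd H v (\<lambda>v1 v2. swd H w (\<lambda>w1 w2. d u (c w1 v2) \<star> d v1 w2))"
  and d_xx: "d x x = 0" and c_xx: "c x x = 0"
  using half_d half_c by (auto simp: half_brace_def)

lemma restrict_closed [simp]: "restrict_op d g h \<in> carrier G"
  and iota_restrict: "\<iota> (restrict_op d g h) = d (\<iota> g) (\<iota> h)"
  if "g \<in> carrier G" "h \<in> carrier G"
proof -
  have b: "bilin_map (\<lambda>v1 v2. d u1 v2 \<boxtimes> d u2 v1)" "bilin_map (\<lambda>u1 u2. d u1 (\<iota> h) \<boxtimes> d u2 (\<iota> h))" for u1 u2
    by (intro bilin_mapI lin_dc)+
  have "comul H (d (\<iota> g) (\<iota> h)) = d (\<iota> g) (\<iota> h) \<boxtimes> d (\<iota> g) (\<iota> h)"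
    using that by (simp add: comul_d swd_iota b)
  moreover have "d (\<iota> g) (\<iota> h) \<noteq> 0"
    using counit_d[of "\<iota> g" "\<iota> h"] that by (auto simp: counit_iota lin_form_simps[OF counit_form])
  ultimately have "d (\<iota> g) (\<iota> h) \<in> \<iota> ` carrier G"
    by (metis group_like_in_G imageI)
  then show "restrict_op d g h \<in> carrier G" "\<iota> (restrict_op d g h) = d (\<iota> g) (\<iota> h)"
    by (auto simp: restrict_op_def inv_into_into f_inv_into_f)
qed

lemma restrict_eqI:
  "d (\<iota> g) (\<iota> h) = \<iota> k \<Longrightarrow> g \<in> carrier G \<Longrightarrow> h \<in> carrier G \<Longrightarrow> k \<in> carrier G \<Longrightarrow> restrict_op d g h = k"
  by (rule iota_inj) (simp_all add: iota_restrict)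

lemma d_inverse:
  assumes "g \<in> carrier G"
  shows "d (d u (\<iota> g)) (\<iota> (inv g)) = u" "d (d u (\<iota> (inv g))) (\<iota> g) = u"
  using assms by (simp_all add: iota_mult iota_one flip: d_mult)

lemma d_mult_left_iota:
  assumes "g \<in> carrier G" "l \<in> carrier G"
  shows "d (u \<star> \<iota> g) (\<iota> l) = d u (c (\<iota> l) (\<iota> g)) \<star> d (\<iota> g) (\<iota> l)"
proof -
  have b: "bilin_map (\<lambda>w1 w2. d u (c w1 v2) \<star> d v1 w2)"
    "bilin_map (\<lambda>v1 v2. d u (c (\<iota> l) v2) \<star> d v1 (\<iota> l))" for v1 v2
    by (intro bilin_mapI lin_dc)+
  show ?thesis
    using assms by (simp add: d_mult_left swd_iota b)
qed

text \<open>
  The rule for products makes \<open>d 1 g\<close> idempotent in the group \<open>G\<close>.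
\<close>

lemma d_one_left: "g \<in> carrier G \<Longrightarrow> d (\<iota> \<one>) (\<iota> g) = \<iota> \<one>"
proof -
  assume g: "g \<in> carrier G"
  have "\<iota> (restrict_op d \<one> g) = \<iota> (restrict_op d \<one> g \<otimes> restrict_op d \<one> g)"
    using d_mult_left_iota[of \<one> g "\<iota> \<one>"] g by (simp add: iota_restrict iota_one flip: iota_mult)
  then have "restrict_op d \<one> g = \<one>"
    using g by (auto dest!: iota_inj)
  then show ?thesis
    using g by (metis iota_restrict one_closed)
qed

lemma d_x_iota_skew:
  assumes g: "g \<in> carrier G"
  shows "comul H (d x (\<iota> g)) = d x (\<iota> g) \<boxtimes> \<iota> (restrict_op d a g) + \<iota> \<one> \<boxtimes> d x (\<iota> g)"
proof -
  have b: "bilin_map (\<lambda>v1 v2. d u1 v2 \<boxtimes> d u2 v1)" "bilin_map (\<lambda>u1 u2. d u1 (\<iota> g) \<boxtimes> d u2 (\<iota> g))" for u1 u2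
    by (intro bilin_mapI lin_dc)+
  show ?thesis
    using g by (simp add: comul_d swd_iota swd_x b iota_restrict d_one_left)
qed

text \<open>
  Otherwise \<open>d x g\<close> would lie in the span of \<open>G\<close>.  The inverse of \<open>u \<mapsto> d u g\<close> preserves this span, which
  does not contain \<open>x\<close>.
\<close>

lemma x_weight_nonzero:
  assumes g: "g \<in> carrier G"
  shows "x_weight d g \<noteq> 0"
proof
  let ?b = "restrict_op d a g"
  assume "x_weight d g = 0"
  then obtain r where r: "d x (\<iota> g) = r *\<^sub>k (\<iota> \<one> - \<iota> ?b)"
    using skew_primitive_form(1)[OF _ d_x_iota_skew[OF g]] g by (auto simp: x_weight_def)
  then have "x = r *\<^sub>k (d (\<iota> \<one>) (\<iota> (inv g)) - d (\<iota> ?b) (\<iota> (inv g)))"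
    using d_inverse(1)[OF g, of x] by (simp add: d_simps)
  also have "d (\<iota> ?b) (\<iota> (inv g)) = \<iota> (restrict_op d ?b (inv g))"
    using g by (simp add: iota_restrict)
  finally have "coord \<one> (Suc 0) x = coord \<one> (Suc 0) (r *\<^sub>k (\<iota> \<one> - \<iota> (restrict_op d ?b (inv g))))"
    using g by (simp add: d_one_left)
  then show False
    using g by (simp add: coord_x coord_simps coord_iota)
qed

lemma d_a_left: "g \<in> carrier G \<Longrightarrow> d (\<iota> a) (\<iota> g) = \<iota> a"
proof -
  assume g: "g \<in> carrier G"
  have "restrict_op d a g = a"
    using skew_primitive_form(2)[OF _ d_x_iota_skew[OF g]] x_weight_nonzero[OF g] g
    by (simp add: x_weight_def)
  then show ?thesis
    using g by (metis iota_restrict a_closed)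
qed

lemma d_x_iota_form:
  assumes g: "g \<in> carrier G"
  shows "d x (\<iota> g) = x_weight d g *\<^sub>k x + coord \<one> 0 (d x (\<iota> g)) *\<^sub>k (\<iota> \<one> - \<iota> a)"
  using skew_primitive_form(1)[OF _ d_x_iota_skew[OF g]] d_a_left[OF g] g
  by (simp add: x_weight_def iota_restrict)

text \<open>
  The flip identity at \<open>x\<close> and \<open>g\<close> says \<open>c g a \<otimes> d x g + c g x \<otimes> 1 = c g x \<otimes> a + g \<otimes> d x g\<close>.  Information on
  \<open>d x g\<close> therefore turns into information on \<open>c\<close>: compare the coefficients of \<open>x\<close> and of \<open>1\<close> in the second
  factor.
\<close>

lemma c_iota_a: "c (\<iota> g) (\<iota> a) = \<iota> g" and c_iota_x: "c (\<iota> g) x = 0" if g: "g \<in> carrier G"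
proof -
  have b: "bilin_map (\<lambda>v1 v2. c v1 u2 \<boxtimes> d u1 v2)" "bilin_map (\<lambda>v1 v2. c v2 u1 \<boxtimes> d u2 v1)"
    "bilin_map (\<lambda>u1 u2. c (\<iota> g) u2 \<boxtimes> d u1 (\<iota> g))" "bilin_map (\<lambda>u1 u2. c (\<iota> g) u1 \<boxtimes> d u2 (\<iota> g))" for u1 u2
    by (intro bilin_mapI lin_dc)+
  have eq: "c (\<iota> g) (\<iota> a) \<boxtimes> d x (\<iota> g) + c (\<iota> g) x \<boxtimes> \<iota> \<one> = c (\<iota> g) x \<boxtimes> \<iota> a + \<iota> g \<boxtimes> d x (\<iota> g)"
    using flip[of x "\<iota> g"] g by (simp add: swd_iota swd_x b d_one_left d_a_left)
      (simp add: iota_one)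
  have slice: "coord \<one> m (d x (\<iota> g)) *\<^sub>k c (\<iota> g) (\<iota> a) + coord \<one> m (\<iota> \<one>) *\<^sub>k c (\<iota> g) x =
      coord \<one> m (\<iota> a) *\<^sub>k c (\<iota> g) x + coord \<one> m (d x (\<iota> g)) *\<^sub>k \<iota> g" for m
    using arg_cong[OF eq, of "tlift (\<lambda>u v. coord \<one> m v *\<^sub>k u)"]
    by (simp add: lin_map_simps[OF lin_map_tlift] tlift_tens[OF bilin_coord_right])
  show ca: "c (\<iota> g) (\<iota> a) = \<iota> g"
    using slice[of "Suc 0"] x_weight_nonzero[OF g] by (simp add: coord_iota x_weight_def)
  show "c (\<iota> g) x = 0"
    using slice[of 0] a_neq_one by (simp add: coord_iota ca)
qed

lemma d_mult_x_iota:
  assumes l: "l \<in> carrier G"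
  shows "d (u \<star> x) (\<iota> l) = d u (\<iota> l) \<star> d x (\<iota> l)"
proof -
  have b: "bilin_map (\<lambda>w1 w2. d u (c w1 v2) \<star> d v1 w2)"
    "bilin_map (\<lambda>v1 v2. d u (c (\<iota> l) v2) \<star> d v1 (\<iota> l))" for v1 v2
    by (intro bilin_mapI lin_dc)+
  show ?thesis
    using l by (simp add: d_mult_left swd_iota swd_x b c_iota_a c_iota_x d_simps mul_simps)
qed

text \<open>
  Both sides compute \<open>d (x g) l\<close>, once with \<open>x g = \<chi>(g) g x\<close> and once directly.
\<close>

lemma d_x_commute:
  assumes g: "g \<in> carrier G" and l: "l \<in> carrier G"
  shows "\<chi> g *\<^sub>k (d (\<iota> g) (\<iota> l) \<star> d x (\<iota> l)) = d x (c (\<iota> l) (\<iota> g)) \<star> d (\<iota> g) (\<iota> l)"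
proof -
  have "\<chi> g *\<^sub>k (d (\<iota> g) (\<iota> l) \<star> d x (\<iota> l)) = d (x \<star> \<iota> g) (\<iota> l)"
    using g l by (simp add: x_iota d_simps d_mult_x_iota)
  then show ?thesis
    using g l by (simp add: d_mult_left_iota)
qed

text \<open>
  For \<open>g = a\<close> the previous lemma says that \<open>y = d x l\<close> satisfies \<open>\<chi>(a) a y = y a\<close>.  The vector \<open>x\<close> does so,
  whereas \<open>1 - a\<close> commutes with \<open>a\<close>; since \<open>\<chi>(a) \<noteq> 1\<close>, the latter cannot occur in \<open>y\<close>.
\<close>

lemma d_x_iota:
  assumes l: "l \<in> carrier G"
  shows "d x (\<iota> l) = x_weight d l *\<^sub>k x"
proof -
  let ?m = "coord \<one> 0 (d x (\<iota> l))"
  let ?y = "x_weight d l *\<^sub>k x + ?m *\<^sub>k (\<iota> \<one> - \<iota> a)"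
  have "\<chi> a *\<^sub>k (\<iota> a \<star> ?y) = ?y \<star> \<iota> a"
    using d_x_commute[OF a_closed l] l by (simp add: d_a_left c_iota_a flip: d_x_iota_form)
  then have "coord a 0 (\<chi> a *\<^sub>k (\<iota> a \<star> ?y)) = coord a 0 (?y \<star> \<iota> a)"
    by (rule arg_cong)
  moreover have "\<iota> a \<star> x = pbw a (Suc 0)"
    using pbw_x[of a 0] by (simp add: pbw_0)
  moreover have "a \<otimes> a \<noteq> a"
    using a_neq_one by simp
  ultimately have "\<chi> a * ?m = ?m"
    using n_gt_1 by (simp add: mul_simps iota_mult x_iota coord_simps coord_iota coord_pbw iota_one[symmetric])
  then have "?m = 0"
    using chi_a_neq_1 by simp
  then show ?thesis
    using d_x_iota_form[OF l] by simp
qed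

lemma x_weight_character: "is_character G (x_weight d)"
proof (rule homI)
  show "x_weight d g \<in> carrier field_units" if "g \<in> carrier G" for g
    using x_weight_nonzero[OF that] by (simp add: field_units_def)
  show "x_weight d (g \<otimes> h) = x_weight d g \<otimes>\<^bsub>field_units\<^esub> x_weight d h"
    if g: "g \<in> carrier G" and h: "h \<in> carrier G" for g h
  proof -
    have "d x (\<iota> (g \<otimes> h)) = (x_weight d h * x_weight d g) *\<^sub>k x"
      using g h by (simp add: d_x_iota d_mult d_simps flip: iota_mult)
    then show ?thesis
      by (simp add: x_weight_def coord_simps coord_x field_units_def mult.commute)
  qed
qed

lemma d_pbw_iota:
  assumes "h \<in> carrier G" "g \<in> carrier G"
  shows "d (pbw h j) (\<iota> g) = x_weight d g ^ j *\<^sub>k pbw (restrict_op d h g) j"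
proof (induction j)
  case 0
  show ?case using assms by (simp add: pbw_0 iota_restrict)
next
  case (Suc j)
  have "d (pbw h (Suc j)) (\<iota> g) = d (pbw h j) (\<iota> g) \<star> d x (\<iota> g)"
    using assms by (simp add: d_mult_x_iota flip: pbw_x)
  then show ?case
    using assms by (simp add: Suc d_x_iota mul_simps pbw_x)
qed

lemma restrict_mult: "g \<in> carrier G \<Longrightarrow> h \<in> carrier G \<Longrightarrow> k \<in> carrier G \<Longrightarrow>
    restrict_op d h (k \<otimes> g) = restrict_op d (restrict_op d h g) k"
  by (rule restrict_eqI) (simp_all add: iota_restrict d_mult flip: iota_mult)

lemma restrict_bij:
  assumes "h \<in> carrier G"
  shows "bij_betw (\<lambda>g. restrict_op d g h) (carrier G) (carrier G)"
proof (rule bij_betw_byWitness[where f' = "\<lambda>g. restrict_op d g (inv h)"])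
  show "\<forall>g\<in>carrier G. restrict_op d (restrict_op d g h) (inv h) = g"
    using assms by (auto intro!: restrict_eqI simp: iota_restrict d_inverse)
  show "\<forall>g\<in>carrier G. restrict_op d (restrict_op d g (inv h)) h = g"
    using assms by (auto intro!: restrict_eqI simp: iota_restrict d_inverse)
qed (use assms in auto)

lemma restrict_one: "g \<in> carrier G \<Longrightarrow> restrict_op d g \<one> = g"
  by (rule restrict_eqI) (simp_all add: iota_one)

lemma restrict_a_left: "g \<in> carrier G \<Longrightarrow> restrict_op d a g = a"
  by (rule restrict_eqI) (simp_all add: d_a_left)

end

section \<open>The interplay of the two operations\<close>

context brace_pair
begin

interpretation swap: brace_pair G \<chi> a \<alpha> H \<iota> x c d
  by (rule brace_pair_swap)

lemma restrict_a_right: "g \<in> carrier G \<Longrightarrow> restrict_op d g a = g"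
  by (rule restrict_eqI) (simp_all add: swap.c_iota_a)

lemma restrict_mult_left:
  assumes "h \<in> carrier G" "k \<in> carrier G" "l \<in> carrier G"
  shows "restrict_op d (h \<otimes> k) l = restrict_op d h (restrict_op c l k) \<otimes> restrict_op d k l"
  by (rule restrict_eqI) (use assms in \<open>simp_all add: iota_restrict swap.iota_restrict d_mult_left_iota flip: iota_mult\<close>)

lemma x_weight_chi:
  assumes g: "g \<in> carrier G" and l: "l \<in> carrier G"
  shows "\<chi> g * x_weight d l = x_weight d (restrict_op c l g) * \<chi> (restrict_op d g l)"
proof -
  let ?p = "restrict_op d g l"
  have "\<iota> ?p \<star> x = pbw ?p (Suc 0)" "x \<star> \<iota> ?p = \<chi> ?p *\<^sub>k pbw ?p (Suc 0)"
    using pbw_x[of ?p 0] x_pbw[of ?p 0] g l by (simp_all add: pbw_0)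
  moreover have "\<chi> g *\<^sub>k (\<iota> ?p \<star> (x_weight d l *\<^sub>k x)) = (x_weight d (restrict_op c l g) *\<^sub>k x) \<star> \<iota> ?p"
    using d_x_commute[OF g l] g l
    by (simp add: d_x_iota iota_restrict flip: swap.iota_restrict)
  ultimately have "(\<chi> g * x_weight d l) *\<^sub>k pbw ?p (Suc 0) =
      (x_weight d (restrict_op c l g) * \<chi> ?p) *\<^sub>k pbw ?p (Suc 0)"
    by (simp add: mul_simps)
  from arg_cong[OF this, of "coord ?p (Suc 0)"] show ?thesis
    using g l n_gt_1 by (simp add: coord_simps coord_pbw)
qed

text \<open>
  Since \<open>x\<close> acts as zero on \<open>G\<close> and on \<open>x\<close> under both operations, all but one term on either side of the
  flip identity at \<open>x\<close> and \<open>x\<close> vanish, and it reads \<open>c x a \<otimes> d x a = x \<otimes> x\<close>.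
\<close>

lemma x_weight_a: "x_weight d a * x_weight c a = 1"
proof -
  note dg = swap.c_iota_x
  have b: "bilin_map (\<lambda>v1 v2. c v1 u2 \<boxtimes> d u1 v2)" "bilin_map (\<lambda>v1 v2. c v2 u1 \<boxtimes> d u2 v1)"
    "bilin_map (\<lambda>u1 u2. c x u2 \<boxtimes> d u1 (\<iota> a) + c (\<iota> \<one>) u2 \<boxtimes> d u1 x)"
    "bilin_map (\<lambda>u1 u2. c (\<iota> a) u1 \<boxtimes> d u2 x + c x u1 \<boxtimes> d u2 (\<iota> \<one>))" for u1 u2
    by (intro bilin_mapI lin_dc)+
  have "c x (\<iota> a) \<boxtimes> d x (\<iota> a) = x \<boxtimes> x"
    using flip[of x x]
    by (simp add: swd_x b c_iota_x dg d_xx c_xx tens_simps) (simp add: iota_one)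
  then have "(x_weight d a * x_weight c a) *\<^sub>k (x \<boxtimes> x) = x \<boxtimes> x"
    by (simp add: d_x_iota swap.d_x_iota tens_simps)
  from arg_cong[OF this, of "tlift (\<lambda>u v. coord \<one> (Suc 0) v *\<^sub>k u)"]
  have "(x_weight d a * x_weight c a) *\<^sub>k x = x"
    by (simp add: lin_map_simps[OF lin_map_tlift] tlift_tens[OF bilin_coord_right] coord_x)
  from arg_cong[OF this, of "coord \<one> (Suc 0)"] show ?thesis
    by (simp add: coord_simps coord_x)
qed

lemma d_mult_x_x: "d (u \<star> x) x = d u x \<star> x"
proof -
  have b: "bilin_map (\<lambda>w1 w2. d u (c w1 v2) \<star> d v1 w2)"
    "bilin_map (\<lambda>v1 v2. d u (c x v2) \<star> d v1 (\<iota> a) + d u (c (\<iota> \<one>) v2) \<star> d v1 x)" for v1 v2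
    by (intro bilin_mapI lin_dc)+
  have "d (u \<star> x) x = (x_weight d a * x_weight c a) *\<^sub>k (d u x \<star> x)"
    by (simp add: d_mult_left swd_x b d_xx c_xx c_iota_x swap.d_x_iota d_x_iota d_simps mul_simps mult.commute)
  then show ?thesis
    by (simp add: x_weight_a)
qed

text \<open>
  The element \<open>x\<close> acts as zero on \<open>G\<close>, and by the previous lemma this passes from \<open>u\<close> to \<open>u x\<close>.
\<close>

lemma d_x_right: "d u x = 0"
proof -
  have "d (pbw h j) x = 0" if "h \<in> carrier G" for h j
    using that
  proof (induction j)
    case 0
    then show ?case by (simp add: pbw_0 swap.c_iota_x)
  next
    case (Suc j)
    then show ?case by (simp add: d_mult_x_x mul_simps flip: pbw_x)
  qed
  then show ?thesis
    by (rule pbw_ext[where f = "\<lambda>u. d u x" and f' = "\<lambda>u. 0",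
          OF bilin_map_left[OF bilin_d lin_map_ident] lin_map_zero])
qed

text \<open>
  A basis vector of positive degree has the form \<open>v x\<close> and acts first through \<open>x\<close>, hence as zero.
\<close>

lemma extension_formula_d: "extension_formula G H \<iota> x (restrict_op d) (x_weight d) d"
proof -
  have "d (pbw h j) (pbw g j') = (if j' = 0 then x_weight d g ^ j *\<^sub>k pbw (restrict_op d h g) j else 0)"
    if "h \<in> carrier G" "g \<in> carrier G" for h g j j'
  proof (cases j')
    case 0
    then show ?thesis using that by (simp add: pbw_0 d_pbw_iota)
  next
    case (Suc i)
    then show ?thesis using that by (simp add: d_mult d_x_right d_simps flip: pbw_x)
  qed
  then show ?thesis
    by (simp add: extension_formula_def pbw_def)
qed

end

lemma (in rank_one) hopf_q_brace_brace_pair: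
  assumes q: "hopf_q_brace H dotH colH" and "dotH x x = 0" "colH x x = 0"
  shows "brace_pair G \<chi> a \<alpha> H \<iota> x dotH colH"
proof -
  have m: "q_magma_coalgebra H dotH colH"
    using q by (simp add: hopf_q_brace_def q_cycle_coalgebra_def)
  show ?thesis
    using assms m
    by unfold_locales
      (auto simp: half_brace_def hopf_q_brace_def q_magma_coalgebra_def q_magma_comul_dot[OF m]
        q_magma_comul_col[OF m] intro: q_magma_flip[OF m])
qed

text \<open>
  The cycle identities for \<open>G\<close> and the conditions on the characters that mention two group elements and
  no \<open>\<chi>\<close> are the cycle identities of \<open>H\<close> at \<open>u, v, w\<close> with \<open>v, w\<close> in \<open>G\<close> and with \<open>u\<close> in \<open>G\<close> or \<open>u = x\<close>.
\<close>

lemma (in rank_one) hopf_q_brace_restriction: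
  assumes q: "hopf_q_brace H dotH colH" and xx: "dotH x x = 0" "colH x x = 0"
  defines "dot \<equiv> restrict_op dotH" and "col \<equiv> restrict_op colH"
  defines "lam \<equiv> x_weight dotH" and "xi \<equiv> x_weight colH"
  shows "\<forall>g\<in>carrier G. \<forall>h\<in>carrier G.
      dotH (\<iota> g) (\<iota> h) = \<iota> (dot g h) \<and> colH (\<iota> g) (\<iota> h) = \<iota> (col g h)"
    and "group_q_brace G dot col"
    and "acts_trivially G a dot col"
    and "compatible_characters G \<chi> a dot col lam xi"
    and "extension_formula G H \<iota> x dot lam dotH"
    and "extension_formula G H \<iota> x col xi colH"
proof -
  interpret D: brace_pair G \<chi> a \<alpha> H \<iota> x dotH colH
    by (rule hopf_q_brace_brace_pair[OF q xx])
  interpret C: brace_pair G \<chi> a \<alpha> H \<iota> x colH dotH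
    by (rule D.brace_pair_swap)
  have cycle: "q_cycle_coalgebra H dotH colH"
    using q by (simp add: hopf_q_brace_def)
  have b: "bilin_map (\<lambda>v1 v2. dotH (dotH u v1) (colH w v2))" "bilin_map (\<lambda>w1 w2. dotH (dotH u w2) (dotH v w1))"
    "bilin_map (\<lambda>v1 v2. colH (dotH u v1) (dotH w v2))" "bilin_map (\<lambda>w1 w2. dotH (colH u w2) (colH v w1))"
    "bilin_map (\<lambda>v1 v2. colH (colH u v1) (colH w v2))" "bilin_map (\<lambda>w1 w2. colH (colH u w2) (dotH v w1))" for u v w
    by (intro bilin_mapI D.lin_dc)+
  have E1: "swd H v (\<lambda>v1 v2. dotH (dotH u v1) (colH w v2)) = swd H w (\<lambda>w1 w2. dotH (dotH u w2) (dotH v w1))"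
    and E2: "swd H v (\<lambda>v1 v2. colH (dotH u v1) (dotH w v2)) = swd H w (\<lambda>w1 w2. dotH (colH u w2) (colH v w1))"
    and E3: "swd H v (\<lambda>v1 v2. colH (colH u v1) (colH w v2)) = swd H w (\<lambda>w1 w2. colH (colH u w2) (dotH v w1))"
    for u v w
    using cycle by (simp_all add: q_cycle_coalgebra_def)
  have cyc1: "dotH (dotH u (\<iota> v)) (\<iota> (col w v)) = dotH (dotH u (\<iota> w)) (\<iota> (dot v w))"
    and cyc2: "colH (dotH u (\<iota> v)) (\<iota> (dot w v)) = dotH (colH u (\<iota> w)) (\<iota> (col v w))"
    and cyc3: "colH (colH u (\<iota> v)) (\<iota> (col w v)) = colH (colH u (\<iota> w)) (\<iota> (dot v w))"
    if "v \<in> carrier G" "w \<in> carrier G" for u v w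
    using E1[of "\<iota> v" u "\<iota> w"] E2[of "\<iota> v" u "\<iota> w"] E3[of "\<iota> v" u "\<iota> w"] that
    by (simp_all add: b dot_def col_def D.iota_restrict C.iota_restrict swd_iota)
  show iota: "\<forall>g\<in>carrier G. \<forall>h\<in>carrier G.
      dotH (\<iota> g) (\<iota> h) = \<iota> (dot g h) \<and> colH (\<iota> g) (\<iota> h) = \<iota> (col g h)"
    by (simp add: D.iota_restrict C.iota_restrict dot_def col_def)
  have closed: "dot g h \<in> carrier G" "col g h \<in> carrier G" if "g \<in> carrier G" "h \<in> carrier G" for g h
    using that by (simp_all add: dot_def col_def)
  show "group_q_brace G dot col"
    unfolding group_q_brace_def
  proof (intro conjI ballI)
    fix u v w assume g: "u \<in> carrier G" "v \<in> carrier G" "w \<in> carrier G"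
    show "dot (dot u v) (col w v) = dot (dot u w) (dot v w)"
      using cyc1[of v w "\<iota> u"] g iota closed by (auto intro!: iota_inj)
    show "col (dot u v) (dot w v) = dot (col u w) (col v w)"
      using cyc2[of v w "\<iota> u"] g iota closed by (auto intro!: iota_inj)
    show "col (col u v) (col w v) = col (col u w) (dot v w)"
      using cyc3[of v w "\<iota> u"] g iota closed by (auto intro!: iota_inj)
  qed (auto simp: dot_def col_def D.restrict_bij C.restrict_bij D.restrict_one C.restrict_one
      D.restrict_mult C.restrict_mult D.restrict_mult_left C.restrict_mult_left)
  show "acts_trivially G a dot col"
    by (auto simp: acts_trivially_def dot_def col_def D.restrict_a_left C.restrict_a_left
        D.restrict_a_right C.restrict_a_right)
  have lam: "is_character G lam" and xi: "is_character G xi"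
    by (simp_all add: lam_def xi_def D.x_weight_character C.x_weight_character)
  have x_dot: "dotH x (\<iota> g) = lam g *\<^sub>k x" and x_col: "colH x (\<iota> g) = xi g *\<^sub>k x" if "g \<in> carrier G" for g
    using that by (simp_all add: lam_def xi_def D.d_x_iota C.d_x_iota)
  have x_cancel: "c = c'" if "c *\<^sub>k x = c' *\<^sub>k x" for c c'
    using arg_cong[OF that, of "coord \<one> (Suc 0)"] by (simp add: coord_simps coord_x)
  show "compatible_characters G \<chi> a dot col lam xi"
    unfolding compatible_characters_def
  proof (intro conjI ballI lam xi)
    show "lam a = inverse (xi a)"
      using D.x_weight_a by (metis lam_def xi_def inverse_unique mult.commute)
    fix h l assume g: "h \<in> carrier G" "l \<in> carrier G"
    show "lam (h \<otimes> col l h) = lam (l \<otimes> dot h l)"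
      using cyc1[of h l x] g closed
      by (intro x_cancel) (simp add: x_dot D.d_simps character_mult[OF lam])
    show "xi (l \<otimes> dot h l) = xi (h \<otimes> col l h)"
      using cyc3[of h l x, symmetric] g closed
      by (intro x_cancel) (simp add: x_col C.d_simps character_mult[OF xi])
    show "lam h * xi (dot l h) = xi l * lam (col h l)"
      using cyc2[of h l x] g closed
      by (intro x_cancel) (simp add: x_dot x_col D.d_simps C.d_simps)
    show "\<chi> h * lam l = lam (col l h) * \<chi> (dot h l)"
      using D.x_weight_chi[OF g] by (simp add: lam_def dot_def col_def)
    show "\<chi> h * xi l = xi (dot l h) * \<chi> (col h l)"
      using C.x_weight_chi[OF g] by (simp add: xi_def dot_def col_def)
  qed
  show "extension_formula G H \<iota> x dot lam dotH" "extension_formula G H \<iota> x col xi colH"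
    by (simp_all add: dot_def col_def lam_def xi_def D.extension_formula_d C.extension_formula_d)
qed


section \<open>Compatible operations and characters of the group\<close>

lemma (in rank_one) extension_formula_pbw:
  "extension_formula G H \<iota> x f \<eta> F \<longleftrightarrow> (\<forall>h\<in>carrier G. \<forall>g\<in>carrier G. \<forall>j j'.
     F (pbw h j) (pbw g j') = (if j' = 0 then \<eta> g ^ j *\<^sub>k pbw (f h g) j else 0))"
  by (simp add: extension_formula_def pbw_def)

locale brace_data = rank_one G \<chi> a \<alpha> H \<iota> x
  for G :: "('g, 'm) monoid_scheme" (structure)
    and \<chi> :: "'g \<Rightarrow> 'k::field" and a \<alpha> and H :: "('b, 'k, 'z) bialg_scheme" and \<iota> x +
  fixes d c :: "'g \<Rightarrow> 'g \<Rightarrow> 'g" and lam xi :: "'g \<Rightarrow> 'k"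
  assumes brace: "group_q_brace G d c"
    and trivial: "acts_trivially G a d c"
    and compatible: "compatible_characters G \<chi> a d c lam xi"
begin

lemma lam: "is_character G lam" and xi: "is_character G xi"
  using compatible by (auto simp: compatible_characters_def)

lemma lam_xi_a: "lam a * xi a = 1"
  using compatible character_nonzero[OF xi a_closed] by (auto simp: compatible_characters_def)

lemmas lam_mult = character_mult[OF lam] and lam_pow = character_pow[OF lam]
  and lam_one = character_one[OF lam]
lemmas xi_mult = character_mult[OF xi] and xi_pow = character_pow[OF xi]

lemma d_closed [simp]: "d g h \<in> carrier G" and c_closed [simp]: "c g h \<in> carrier G"
  if "g \<in> carrier G" "h \<in> carrier G"
proof -
  have "bij_betw (\<lambda>g. d g h) (carrier G) (carrier G)" "bij_betw (\<lambda>g. c g h) (carrier G) (carrier G)"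
    using brace that(2) by (simp_all add: group_q_brace_def)
  then show "d g h \<in> carrier G" "c g h \<in> carrier G"
    using that(1) by (auto dest: bij_betw_apply)
qed

lemma lam_cycle: "lam (g \<otimes> c h g) = lam (h \<otimes> d g h)"
  and lam_xi_cycle: "lam g * xi (d h g) = xi h * lam (c g h)"
  and xi_cycle: "xi (h \<otimes> d g h) = xi (g \<otimes> c h g)"
  and chi_lam: "\<chi> g * lam h = lam (c h g) * \<chi> (d g h)"
  and chi_xi: "\<chi> g * xi h = xi (d h g) * \<chi> (c g h)"
  if "g \<in> carrier G" "h \<in> carrier G"
  using compatible that unfolding compatible_characters_def by blast+

lemma brace_data_swap: "brace_data G \<chi> a \<alpha> H \<iota> x c d xi lam"
proof
  show "group_q_brace G c d"
    using brace by (simp add: group_q_brace_def)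
  show "acts_trivially G a c d"
    using trivial by (simp add: acts_trivially_def)
  show "compatible_characters G \<chi> a c d xi lam"
    unfolding compatible_characters_def
  proof (intro conjI ballI lam xi)
    show "xi a = inverse (lam a)"
      using inverse_unique[OF lam_xi_a] by simp
    fix h l assume g: "h \<in> carrier G" "l \<in> carrier G"
    show "xi (h \<otimes> d l h) = xi (l \<otimes> c h l)" "xi h * lam (c l h) = lam l * xi (d h l)"
      "lam (l \<otimes> c h l) = lam (h \<otimes> d l h)" "\<chi> h * xi l = xi (d l h) * \<chi> (c h l)"
      "\<chi> h * lam l = lam (c l h) * \<chi> (d h l)"
      using xi_cycle[OF g(2,1)] lam_xi_cycle[OF g(2,1)] lam_cycle[OF g(2,1)] chi_xi[OF g] chi_lam[OF g]
      by (simp_all only:)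
  qed
qed

lemma d_one_right: "d g \<one> = g" and c_one_right: "c g \<one> = g"
  and d_mult_right: "h \<in> carrier G \<Longrightarrow> k \<in> carrier G \<Longrightarrow> d g (h \<otimes> k) = d (d g k) h"
  and d_mult_left: "h \<in> carrier G \<Longrightarrow> k \<in> carrier G \<Longrightarrow> d (g \<otimes> h) k = d g (c k h) \<otimes> d h k"
  and d_cycle: "h \<in> carrier G \<Longrightarrow> k \<in> carrier G \<Longrightarrow> d (d g h) (c k h) = d (d g k) (d h k)"
  and cd_cycle: "h \<in> carrier G \<Longrightarrow> k \<in> carrier G \<Longrightarrow> c (d g h) (d k h) = d (c g k) (c h k)"
  if "g \<in> carrier G"
  using brace that unfolding group_q_brace_def by blast+

lemma d_a_right: "d g a = g" and d_a_left: "d a g = a" and c_a_right: "c g a = g"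
  if "g \<in> carrier G"
  using trivial that unfolding acts_trivially_def by blast+

text \<open>
  Multiply by \<open>a\<close>, which is fixed by every \<open>g\<close>.
\<close>

lemma d_one_left: "g \<in> carrier G \<Longrightarrow> d \<one> g = \<one>"
proof -
  assume g: "g \<in> carrier G"
  have "a \<otimes> d \<one> g = d (a \<otimes> \<one>) g"
    using d_mult_left[of a \<one> g] g by (simp add: d_a_left c_one_right)
  then show ?thesis
    using g by (simp add: d_a_left)
qed

lemma d_a_pow_right: "g \<in> carrier G \<Longrightarrow> h \<in> carrier G \<Longrightarrow> d g (h \<otimes> a [^] (k::nat)) = d g h"
proof -
  assume g: "g \<in> carrier G" "h \<in> carrier G"
  have "d g (a [^] k) = g"
    using g(1) by (induction k) (simp_all add: d_one_right d_mult_right d_a_right)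
  then show ?thesis
    using g by (simp add: d_mult_right)
qed

lemma d_a_pow_left:
  "g \<in> carrier G \<Longrightarrow> h \<in> carrier G \<Longrightarrow> d (g \<otimes> a [^] (k::nat)) h = d g h \<otimes> a [^] k"
proof (induction k)
  case (Suc k)
  have "d (g \<otimes> a [^] k \<otimes> a) h = d (g \<otimes> a [^] k) (c h a) \<otimes> d a h"
    using Suc.prems by (intro d_mult_left) auto
  then show ?case
    using Suc by (simp add: m_assoc c_a_right d_a_left)
qed (simp add: d_one_right)

text \<open>
  The basis vectors of degree below \<open>n\<close> determine the operation.  That the formula persists in higher
  degrees is the consistency with \<open>x\<^sup>n = \<alpha> (a\<^sup>n - 1)\<close>: if the right-hand side is zero, so are all
  powers from \<open>x\<^sup>n\<close> on; otherwise one uses induction in steps of \<open>n\<close>, with \<open>\<lambda>(g)\<^sup>n = 1\<close> for powers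
  in the first argument and \<open>\<lambda>(a)\<^sup>n = 1\<close> for powers in the second.
\<close>

lemma extension_exists:
  assumes consistent: "lift_trivial G \<chi> a \<alpha> \<or> (\<forall>g\<in>carrier G. lam g ^ n = 1)"
  shows "\<exists>D. bilin_map D \<and> extension_formula G H \<iota> x d lam D"
proof -
  define F where "F = (\<lambda>(h, j) (g, j'). if j' = (0::nat) then lam g ^ j *\<^sub>k pbw (d h g) j else 0)"
  define D where "D = (\<lambda>u v. lin_ext (\<lambda>p. lin_ext (F p) (coords v)) (coords u))"
  have D: "bilin_map D"
    unfolding D_def
    by (intro bilin_mapI lin_map_lin_ext_param lin_map_compose[OF lin_map_lin_ext] coords_lin)
  note D_simps = bilin_map_simps[OF D]
  have base: "D (pbw h j) (pbw g j') = (if j' = 0 then lam g ^ j *\<^sub>k pbw (d h g) j else 0)"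
    if "h \<in> carrier G" "g \<in> carrier G" "j < n" "j' < n" for h g j j'
    using that by (simp add: D_def coords_pbw F_def)
  have left: "D (pbw h j) (pbw g j') = (if j' = 0 then lam g ^ j *\<^sub>k pbw (d h g) j else 0)"
    if "h \<in> carrier G" "g \<in> carrier G" "j' < n" for h g j j'
    using that(1)
  proof (induction j arbitrary: h rule: less_induct)
    case (less j)
    show ?case
    proof (cases "j < n")
      case True
      then show ?thesis using base less.prems that by simp
    next
      case False
      then obtain i where i: "j = i + n"
        using le_Suc_ex[of n j] by (auto simp: add.commute)
      have "i < j"
        using i n_gt_1 by simp
      show ?thesis
      proof (cases "lift_trivial G \<chi> a \<alpha>")
        case True
        then show ?thesis
          using less.prems that by (simp add: i pbw_lift_trivial D_simps)
      next
        case False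
        then have "lam g ^ n = 1"
          using consistent that by auto
        then show ?thesis
          using less.IH[OF \<open>i < j\<close>, of "h \<otimes> a [^] n"] less.IH[OF \<open>i < j\<close>, of h] less.prems that
          by (simp add: i pbw_add_n D_simps d_a_pow_left power_add pm.scale_right_diff_distrib mult.commute)
      qed
    qed
  qed
  have "D (pbw h j) (pbw g j') = (if j' = 0 then lam g ^ j *\<^sub>k pbw (d h g) j else 0)"
    if "h \<in> carrier G" "g \<in> carrier G" for h g j j'
    using that(2)
  proof (induction j' arbitrary: g rule: less_induct)
    case (less j')
    show ?case
    proof (cases "j' < n")
      case True
      then show ?thesis using left less.prems that by simp
    next
      case False
      then obtain i where i: "j' = i + n"
        using le_Suc_ex[of n j'] by (auto simp: add.commute)
      have "i < j'"
        using i n_gt_1 by simp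
      show ?thesis
      proof (cases "lift_trivial G \<chi> a \<alpha>")
        case True
        then show ?thesis
          using less.prems that n_gt_1 by (simp add: i pbw_lift_trivial D_simps)
      next
        case False
        then have "lam a ^ n = 1"
          using consistent by auto
        then show ?thesis
          using less.IH[OF \<open>i < j'\<close>, of "g \<otimes> a [^] n"] less.IH[OF \<open>i < j'\<close>, of g] less.prems that n_gt_1
          by (simp add: i pbw_add_n D_simps d_a_pow_right lam_mult lam_pow)
      qed
    qed
  qed
  then show ?thesis
    using D by (auto simp: extension_formula_pbw)
qed

end


section \<open>Extending a q-brace structure from the group\<close>

locale brace_extension = brace_data G \<chi> a \<alpha> H \<iota> x d c lam xi
  for G :: "('g, 'm) monoid_scheme" (structure)
    and \<chi> :: "'g \<Rightarrow> 'k::field" and a \<alpha> and H :: "('b, 'k, 'z) bialg_scheme" and \<iota> x d c lam xi +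
  fixes D C :: "('b \<Rightarrow>\<^sub>0 'k) \<Rightarrow> ('b \<Rightarrow>\<^sub>0 'k) \<Rightarrow> ('b \<Rightarrow>\<^sub>0 'k)"
  assumes bilin_D: "bilin_map D" and bilin_C: "bilin_map C"
    and formula_D: "extension_formula G H \<iota> x d lam D"
    and formula_C: "extension_formula G H \<iota> x c xi C"
begin

lemma brace_extension_swap: "brace_extension G \<chi> a \<alpha> H \<iota> x c d xi lam C D"
proof -
  interpret swap: brace_data G \<chi> a \<alpha> H \<iota> x c d xi lam
    by (rule brace_data_swap)
  show ?thesis
    by unfold_locales (rule bilin_C bilin_D formula_C formula_D)+
qed

lemmas D_simps = bilin_map_simps[OF bilin_D] and C_simps = bilin_map_simps[OF bilin_C]

lemmas lin_DC = bilin_map_left[OF bilin_D] bilin_map_right[OF bilin_D]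
  bilin_map_left[OF bilin_C] bilin_map_right[OF bilin_C] lin_H

lemma D_pbw: "h \<in> carrier G \<Longrightarrow> g \<in> carrier G \<Longrightarrow>
    D (pbw h j) (pbw g 0) = lam g ^ j *\<^sub>k pbw (d h g) j"
  and C_pbw: "h \<in> carrier G \<Longrightarrow> g \<in> carrier G \<Longrightarrow>
    C (pbw h j) (pbw g 0) = xi g ^ j *\<^sub>k pbw (c h g) j"
  using formula_D formula_C by (simp_all add: extension_formula_pbw)

lemma D_pbw_zero: "D u (pbw g j) = 0" if "g \<in> carrier G" "0 < j"
  by (rule pbw_ext[where f = "\<lambda>u. D u (pbw g j)" and f' = "\<lambda>u. 0",
        OF bilin_map_left[OF bilin_D lin_map_ident] lin_map_zero])
    (use that formula_D in \<open>simp add: extension_formula_pbw\<close>)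

lemma counit_D: "counit H (D u v) = counit H u * counit H v"
proof (rule pbw_ext2[where s = "(*)" and f = "\<lambda>u v. counit H (D u v)" and f' = "\<lambda>u v. counit H u * counit H v"])
  fix g m h j assume "g \<in> carrier G" "h \<in> carrier G"
  then show "counit H (D (pbw g m) (pbw h j)) = counit H (pbw g m) * counit H (pbw h j)"
    by (cases "j = 0") (auto simp: D_pbw D_pbw_zero counit_pbw lin_form_simps[OF counit_form])
next
  show "lin_form (\<lambda>u. counit H u * counit H v)" "lin_form (\<lambda>v. counit H u * counit H v)" for u v
    using counit_form by (auto simp: Vector_Spaces.linear_iff algebra_simps)
qed (auto intro!: lin_form_compose[OF counit_form] lin_DC)

lemma D_one: "D u (hone H) = u"
  by (rule pbw_ext[where f = "\<lambda>u. D u (hone H)" and f' = "\<lambda>u. u",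
        OF bilin_map_left[OF bilin_D lin_map_ident] lin_map_ident])
    (use D_pbw[of _ \<one>] in \<open>auto simp: pbw_one d_one_right lam_one\<close>)

lemma D_mult: "D u (v \<star> w) = D (D u w) v"
proof (rule pbw_ext3[where f = "\<lambda>u v w. D u (v \<star> w)" and f' = "\<lambda>u v w. D (D u w) v"])
  fix g m h j k i assume "g \<in> carrier G" "h \<in> carrier G" "k \<in> carrier G"
  then show "D (pbw g m) (pbw h j \<star> pbw k i) = D (D (pbw g m) (pbw k i)) (pbw h j)"
    by (cases "i = 0"; cases "j = 0")
      (simp_all add: pbw_mult D_simps D_pbw D_pbw_zero d_mult_right lam_mult power_mult_distrib mult.commute)
qed (intro lin_DC)+

lemma D_iota_inverse:
  assumes "g \<in> carrier G"
  shows "D (D u (\<iota> g)) (\<iota> (inv g)) = u" "D (D u (\<iota> (inv g))) (\<iota> g) = u"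
  using assms by (simp_all add: iota_mult iota_one D_one flip: D_mult)

text \<open>
  The maps of the regularity conditions fix the second tensor factor when it is a basis vector, and
  act on the first one by an invertible map depending on that vector.
\<close>

lemma bij_tlift_diagonal:
  assumes f: "bilin_map f"
    and fA: "\<And>u g m. g \<in> carrier G \<Longrightarrow> m < n \<Longrightarrow> f u (pbw g m) = A g m u \<boxtimes> pbw g m"
    and B: "\<And>g m. lin_map (B g m)"
    and BA: "\<And>g m u. g \<in> carrier G \<Longrightarrow> B g m (A g m u) = u"
    and AB: "\<And>g m u. g \<in> carrier G \<Longrightarrow> A g m (B g m u) = u"
  shows "bij (tlift f)"
proof -
  define f' where "f' = (\<lambda>u v. lin_ext (\<lambda>(g, m). B g m u \<boxtimes> pbw g m) (coords v))"
  have f': "bilin_map f'"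
    unfolding f'_def
    by (intro bilin_mapI lin_map_lin_ext_param lin_map_compose[OF lin_map_lin_ext] coords_lin)
      (auto intro: lin_map_tens B)
  have f'B: "f' u (pbw g m) = B g m u \<boxtimes> pbw g m" if "g \<in> carrier G" "m < n" for u g m
    using that by (simp add: f'_def coords_pbw)
  have "tlift f' (tlift f t) = t" for t
  proof (rule tensor_ext[where s = pscale and f = "\<lambda>t. tlift f' (tlift f t)" and g = "\<lambda>t. t"])
    fix u v
    show "tlift f' (tlift f (u \<boxtimes> v)) = u \<boxtimes> v"
      unfolding tlift_tens[OF f]
      by (rule pbw_ext[where s = pscale and f = "\<lambda>v. tlift f' (f u v)" and f' = "\<lambda>v. u \<boxtimes> v"])
        (auto simp: fA f'B BA tlift_tens[OF f'] intro!: lin_map_compose[OF lin_map_tlift]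
          bilin_map_right[OF f] lin_H)
  qed (intro lin_map_compose[OF lin_map_tlift] lin_map_ident)+
  moreover have "tlift f (tlift f' t) = t" for t
  proof (rule tensor_ext[where s = pscale and f = "\<lambda>t. tlift f (tlift f' t)" and g = "\<lambda>t. t"])
    fix u v
    show "tlift f (tlift f' (u \<boxtimes> v)) = u \<boxtimes> v"
      unfolding tlift_tens[OF f']
      by (rule pbw_ext[where s = pscale and f = "\<lambda>v. tlift f (f' u v)" and f' = "\<lambda>v. u \<boxtimes> v"])
        (auto simp: fA f'B AB tlift_tens[OF f] intro!: lin_map_compose[OF lin_map_tlift]
          bilin_map_right[OF f'] lin_H)
  qed (intro lin_map_compose[OF lin_map_tlift] lin_map_ident)+
  ultimately show ?thesis
    by (intro o_bij[of "tlift f'"]) auto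
qed

text \<open>
  In \<open>D u v\<^sub>1 \<otimes> v\<^sub>2\<close> the first Sweedler factor of \<open>v = g x\<^sup>m\<close> must have degree \<open>0\<close>, so it is \<open>g\<close>.
\<close>

lemma left_regular_D: "left_regular H D"
  unfolding left_regular_def
proof (rule bij_tlift_diagonal[where A = "\<lambda>g m u. D u (\<iota> g)" and B = "\<lambda>g m u. D u (\<iota> (inv g))"])
  fix u g m assume "g \<in> carrier G"
  then show "swd H (pbw g m) (\<lambda>y1 y2. D u y1 \<boxtimes> y2) = D u (\<iota> g) \<boxtimes> pbw g m"
    by (subst swd_pbw_first) (auto simp: D_pbw_zero tens_simps pbw_0 intro!: bilin_mapI lin_DC)
qed (auto simp: D_iota_inverse intro!: bilin_mapI lin_DC)

text \<open>
  Here the second Sweedler factor must have degree \<open>0\<close>, so it is \<open>g a\<^sup>m\<close>.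
\<close>

lemma right_regular_D: "right_regular H D"
  unfolding right_regular_def
proof (rule bij_tlift_diagonal[where A = "\<lambda>g m u. D u (\<iota> (g \<otimes> a [^] m))"
      and B = "\<lambda>g m u. D u (\<iota> (inv (g \<otimes> a [^] m)))"])
  fix u g m assume "g \<in> carrier G"
  then show "swd H (pbw g m) (\<lambda>y1 y2. D u y2 \<boxtimes> y1) = D u (\<iota> (g \<otimes> a [^] m)) \<boxtimes> pbw g m"
    by (subst swd_pbw_last) (auto simp: D_pbw_zero tens_simps pbw_0 intro!: bilin_mapI lin_DC)
qed (auto simp: D_iota_inverse intro!: bilin_mapI lin_DC)

end

context brace_extension
begin

interpretation swap: brace_extension G \<chi> a \<alpha> H \<iota> x c d xi lam C D
  by (rule brace_extension_swap)

text \<open>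
  Of the double sum only the term \<open>D u (C w (g a\<^sup>m)) (D v h)\<close> with \<open>v = g x\<^sup>m\<close> and \<open>w = h\<close> of degree \<open>0\<close>
  survives.  For \<open>u = p x\<^sup>i\<close>, moving \<open>x\<^sup>i\<close> past group elements costs \<open>\<chi>(g)\<^sup>i\<close> on the left-hand side and
  \<open>\<chi>(d g h)\<^sup>i\<close> on the right-hand side, and the condition that relates \<open>\<chi>\<close> and \<open>\<lambda>\<close> balances the two.
\<close>

lemma D_mult_left: "D (u \<star> v) w = swd H v (\<lambda>v1 v2. swd H w (\<lambda>w1 w2. D u (C w1 v2) \<star> D v1 w2))"
proof (rule pbw_ext3[where f = "\<lambda>u v w. D (u \<star> v) w" and
      f' = "\<lambda>u v w. swd H v (\<lambda>v1 v2. swd H w (\<lambda>w1 w2. D u (C w1 v2) \<star> D v1 w2))"])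
  fix p i g m h j assume G: "p \<in> carrier G" "g \<in> carrier G" "h \<in> carrier G"
  let ?u = "pbw p i"
  have b: "bilin_map (\<lambda>v1 v2. swd H w (\<lambda>w1 w2. D ?u (C w1 v2) \<star> D v1 w2))"
    "bilin_map (\<lambda>w1 w2. D ?u (C w1 v2) \<star> D v1 w2)" for w v1 v2
    by (intro bilin_mapI lin_DC)+
  have "swd H (pbw g m) (\<lambda>v1 v2. swd H (pbw h j) (\<lambda>w1 w2. D ?u (C w1 v2) \<star> D v1 w2)) =
      swd H (pbw h j) (\<lambda>w1 w2. D ?u (C w1 (pbw (g \<otimes> a [^] m) 0)) \<star> D (pbw g m) w2)"
    using G by (intro swd_pbw_last b) (simp_all add: swap.D_pbw_zero D_simps mul_simps swd_zero)
  also have "\<dots> = D ?u (C (pbw h j) (pbw (g \<otimes> a [^] m) 0)) \<star> D (pbw g m) (pbw (h \<otimes> a [^] j) 0)"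
    using G by (intro swd_pbw_last b) (simp_all add: D_pbw_zero mul_simps)
  also have "\<dots> = D (?u \<star> pbw g m) (pbw h j)"
  proof (cases "j = 0")
    case True
    have "\<chi> g ^ i * lam h ^ (i + m) = (\<chi> g * lam h) ^ i * lam h ^ m"
      by (simp add: power_mult_distrib power_add)
    also have "\<dots> = (lam (c h g) * \<chi> (d g h)) ^ i * lam h ^ m"
      using G by (simp add: chi_lam)
    finally have "\<chi> g ^ i * lam h ^ (i + m) = lam (c h g) ^ i * \<chi> (d g h) ^ i * lam h ^ m"
      by (simp add: power_mult_distrib)
    then show ?thesis
      using G True
      by (simp add: D_pbw swap.D_pbw D_simps mul_simps pbw_mult d_mult_left swap.d_a_pow_right mult_ac)
  next
    case False
    then show ?thesis
      using G by (simp add: swap.D_pbw D_pbw_zero D_simps mul_simps pbw_mult)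
  qed
  finally show "D (?u \<star> pbw g m) (pbw h j) =
      swd H (pbw g m) (\<lambda>v1 v2. swd H (pbw h j) (\<lambda>w1 w2. D ?u (C w1 v2) \<star> D v1 w2))" ..
qed (intro lin_DC)+

text \<open>
  In the cycle identities both sides vanish unless \<open>v\<close> and \<open>w\<close> have degree \<open>0\<close>, and then they reduce to the
  identities in \<open>G\<close> and the conditions on the characters.
\<close>

lemma cycle_DD: "swd H v (\<lambda>v1 v2. D (D u v1) (C w v2)) = swd H w (\<lambda>w1 w2. D (D u w2) (D v w1))"
proof (rule pbw_ext3[where f = "\<lambda>u v w. swd H v (\<lambda>v1 v2. D (D u v1) (C w v2))" and
      f' = "\<lambda>u v w. swd H w (\<lambda>w1 w2. D (D u w2) (D v w1))"])
  fix p i g m h j assume G: "p \<in> carrier G" "g \<in> carrier G" "h \<in> carrier G"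
  let ?u = "pbw p i"
  have b: "bilin_map (\<lambda>v1 v2. D (D ?u v1) (C (pbw h j) v2))" "bilin_map (\<lambda>w1 w2. D (D ?u w2) (D (pbw g m) w1))"
    by (intro bilin_mapI lin_DC)+
  have "swd H (pbw g m) (\<lambda>v1 v2. D (D ?u v1) (C (pbw h j) v2)) = D (D ?u (pbw g 0)) (C (pbw h j) (pbw g m))"
    using G by (intro swd_pbw_first b) (simp_all add: D_pbw_zero D_simps)
  moreover have "swd H (pbw h j) (\<lambda>w1 w2. D (D ?u w2) (D (pbw g m) w1)) = D (D ?u (pbw h j)) (D (pbw g m) (pbw h 0))"
    using G by (intro swd_pbw_first b) (simp_all add: D_pbw_zero D_simps)
  moreover have "lam g ^ i * lam (c h g) ^ i = lam h ^ i * lam (d g h) ^ i"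
    using lam_cycle[of g h] G by (simp add: lam_mult flip: power_mult_distrib)
  ultimately show "swd H (pbw g m) (\<lambda>v1 v2. D (D ?u v1) (C (pbw h j) v2)) =
      swd H (pbw h j) (\<lambda>w1 w2. D (D ?u w2) (D (pbw g m) w1))"
    using G by (cases "m = 0"; cases "j = 0")
      (simp_all add: D_pbw swap.D_pbw D_pbw_zero swap.D_pbw_zero D_simps d_cycle)
qed (intro lin_DC)+

text \<open>
  With the operations exchanged this is the third cycle identity; it differs from the first one by
  the order of the Sweedler factors.
\<close>

lemma cycle_DD_cop: "swd H v (\<lambda>v1 v2. D (D u v1) (D w v2)) = swd H w (\<lambda>w1 w2. D (D u w2) (C v w1))"
proof (rule pbw_ext3[where f = "\<lambda>u v w. swd H v (\<lambda>v1 v2. D (D u v1) (D w v2))" and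
      f' = "\<lambda>u v w. swd H w (\<lambda>w1 w2. D (D u w2) (C v w1))"])
  fix p i g m h j assume G: "p \<in> carrier G" "g \<in> carrier G" "h \<in> carrier G"
  let ?u = "pbw p i"
  have b: "bilin_map (\<lambda>v1 v2. D (D ?u v1) (D (pbw h j) v2))" "bilin_map (\<lambda>w1 w2. D (D ?u w2) (C (pbw g m) w1))"
    by (intro bilin_mapI lin_DC)+
  have "swd H (pbw g m) (\<lambda>v1 v2. D (D ?u v1) (D (pbw h j) v2)) = D (D ?u (pbw g 0)) (D (pbw h j) (pbw g m))"
    using G by (intro swd_pbw_first b) (simp_all add: D_pbw_zero D_simps)
  moreover have "swd H (pbw h j) (\<lambda>w1 w2. D (D ?u w2) (C (pbw g m) w1)) = D (D ?u (pbw h j)) (C (pbw g m) (pbw h 0))"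
    using G by (intro swd_pbw_first b) (simp_all add: swap.D_pbw_zero D_simps)
  moreover have "lam g ^ i * lam (d h g) ^ i = lam h ^ i * lam (c g h) ^ i"
    using lam_cycle[of h g] G by (simp add: lam_mult flip: power_mult_distrib)
  ultimately show "swd H (pbw g m) (\<lambda>v1 v2. D (D ?u v1) (D (pbw h j) v2)) =
      swd H (pbw h j) (\<lambda>w1 w2. D (D ?u w2) (C (pbw g m) w1))"
    using G by (cases "m = 0"; cases "j = 0")
      (simp_all add: D_pbw swap.D_pbw D_pbw_zero swap.D_pbw_zero D_simps d_cycle)
qed (intro lin_DC)+

lemma cycle_CD: "swd H v (\<lambda>v1 v2. C (D u v1) (D w v2)) = swd H w (\<lambda>w1 w2. D (C u w2) (C v w1))"
proof (rule pbw_ext3[where f = "\<lambda>u v w. swd H v (\<lambda>v1 v2. C (D u v1) (D w v2))" and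
      f' = "\<lambda>u v w. swd H w (\<lambda>w1 w2. D (C u w2) (C v w1))"])
  fix p i g m h j assume G: "p \<in> carrier G" "g \<in> carrier G" "h \<in> carrier G"
  let ?u = "pbw p i"
  have b: "bilin_map (\<lambda>v1 v2. C (D ?u v1) (D (pbw h j) v2))" "bilin_map (\<lambda>w1 w2. D (C ?u w2) (C (pbw g m) w1))"
    by (intro bilin_mapI lin_DC)+
  have "swd H (pbw g m) (\<lambda>v1 v2. C (D ?u v1) (D (pbw h j) v2)) = C (D ?u (pbw g 0)) (D (pbw h j) (pbw g m))"
    using G by (intro swd_pbw_first b) (simp_all add: D_pbw_zero C_simps)
  moreover have "swd H (pbw h j) (\<lambda>w1 w2. D (C ?u w2) (C (pbw g m) w1)) = D (C ?u (pbw h j)) (C (pbw g m) (pbw h 0))"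
    using G by (intro swd_pbw_first b) (simp_all add: swap.D_pbw_zero D_simps)
  moreover have "lam g ^ i * xi (d h g) ^ i = xi h ^ i * lam (c g h) ^ i"
    using lam_xi_cycle[of g h] G by (simp flip: power_mult_distrib)
  ultimately show "swd H (pbw g m) (\<lambda>v1 v2. C (D ?u v1) (D (pbw h j) v2)) =
      swd H (pbw h j) (\<lambda>w1 w2. D (C ?u w2) (C (pbw g m) w1))"
    using G by (cases "m = 0"; cases "j = 0")
      (simp_all add: D_pbw swap.D_pbw D_pbw_zero swap.D_pbw_zero D_simps C_simps cd_cycle)
qed (intro lin_DC)+

text \<open>
  The map of the definition of a q-magma coalgebra.
\<close>

definition flip_map :: "('b \<Rightarrow>\<^sub>0 'k) \<Rightarrow> ('b \<Rightarrow>\<^sub>0 'k) \<Rightarrow> ('b \<times> 'b \<Rightarrow>\<^sub>0 'k)" where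
  "flip_map u v = swd H u (\<lambda>u1 u2. swd H v (\<lambda>v1 v2. C v1 u2 \<boxtimes> D u1 v2))"

lemma bilin_flip_map: "bilin_map flip_map"
  unfolding flip_map_def by (intro bilin_mapI lin_DC)

text \<open>
  The surviving term is \<open>C (g x\<^sup>m) (h a\<^sup>j) \<otimes> D (h x\<^sup>j) (g a\<^sup>m)\<close>.  The powers of \<open>a\<close> contribute
  \<open>\<xi>(a)\<^sup>j\<^sup>m \<lambda>(a)\<^sup>j\<^sup>m = 1\<close>.
\<close>

lemma flip_map_pbw:
  assumes G: "h \<in> carrier G" "g \<in> carrier G"
  shows "flip_map (pbw h j) (pbw g m) = (xi h ^ m * lam g ^ j) *\<^sub>k (pbw (c g h) m \<boxtimes> pbw (d h g) j)"
proof -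
  have b: "bilin_map (\<lambda>u1 u2. swd H v (\<lambda>v1 v2. C v1 u2 \<boxtimes> D u1 v2))"
    "bilin_map (\<lambda>v1 v2. C v1 u2 \<boxtimes> D u1 v2)" for v u1 u2
    by (intro bilin_mapI lin_DC)+
  have "flip_map (pbw h j) (pbw g m) =
      swd H (pbw g m) (\<lambda>v1 v2. C v1 (pbw (h \<otimes> a [^] j) 0) \<boxtimes> D (pbw h j) v2)"
    unfolding flip_map_def
    using G by (intro swd_pbw_last b) (simp_all add: swap.D_pbw_zero tens_simps swd_zero)
  also have "\<dots> = C (pbw g m) (pbw (h \<otimes> a [^] j) 0) \<boxtimes> D (pbw h j) (pbw (g \<otimes> a [^] m) 0)"
    using G by (intro swd_pbw_last b) (simp_all add: D_pbw_zero tens_simps)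
  also have "\<dots> = (xi (h \<otimes> a [^] j) ^ m * lam (g \<otimes> a [^] m) ^ j) *\<^sub>k (pbw (c g h) m \<boxtimes> pbw (d h g) j)"
    using G by (simp add: D_pbw swap.D_pbw tens_simps d_a_pow_right swap.d_a_pow_right)
  also have "xi (h \<otimes> a [^] j) ^ m * lam (g \<otimes> a [^] m) ^ j = xi h ^ m * lam g ^ j * (lam a * xi a) ^ (j * m)"
    using G by (simp add: lam_mult lam_pow xi_mult xi_pow power_mult_distrib power_mult[symmetric] mult_ac)
  finally show ?thesis
    by (simp add: lam_xi_a)
qed

text \<open>
  Both sides expand into the same double sum over the graded components of \<open>\<Delta>(h x\<^sup>j)\<close> and \<open>\<Delta>(g x\<^sup>m)\<close>.
  The scalars of \<open>flip_map\<close> at the two Sweedler factors multiply to the scalar at \<open>h x\<^sup>j\<close> and \<open>g x\<^sup>m\<close>, again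
  because of \<open>\<lambda>(a) \<xi>(a) = 1\<close>.
\<close>

lemma flip_map_coalg_morphism:
  "coalg_morphism (tensor_coalg H (cop H)) (tensor_coalg (cop H) H) (tlift flip_map)"
  unfolding coalg_morphism_def
proof (intro conjI allI)
  let ?T = "tensor_coalg H (cop H)" and ?T' = "tensor_coalg (cop H) H"
  let ?K = "gauss_binom (\<chi> a)"
  note lc = lin_coalg lin_coalg_cop[OF lin_coalg] lin_coalg_tensor
  note lin = lin_DC lc bilin_map_left[OF bilin_flip_map] bilin_map_right[OF bilin_flip_map]
  show "lin_map (tlift flip_map)"
    by (rule lin_map_tlift)
  have comul: "comul ?T' (flip_map u v) = swd H u (\<lambda>u1 u2. swd H v (\<lambda>v1 v2. flip_map u1 v2 \<boxtimes> flip_map u2 v1))" for u v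
  proof (rule pbw_ext2[where s = pscale and f = "\<lambda>u v. comul ?T' (flip_map u v)" and
        f' = "\<lambda>u v. swd H u (\<lambda>u1 u2. swd H v (\<lambda>v1 v2. flip_map u1 v2 \<boxtimes> flip_map u2 v1))"])
    fix h j g m assume G: "h \<in> carrier G" "g \<in> carrier G"
    let ?s = "xi h ^ m * lam g ^ j"
    let ?Y = "\<lambda>t s. (pbw (c g h \<otimes> a [^] t) (m - t) \<boxtimes> pbw (d h g) s) \<boxtimes> (pbw (c g h) t \<boxtimes> pbw (d h g \<otimes> a [^] s) (j - s))"
    have b: "bilin_map (\<lambda>a1 a2. swd H w (\<lambda>b1 b2. (a2 \<boxtimes> b1) \<boxtimes> (a1 \<boxtimes> b2)))"
      "bilin_map (\<lambda>a1 a2. swd H w (\<lambda>b1 b2. (a1 \<boxtimes> b1) \<boxtimes> (a2 \<boxtimes> b2)))"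
      "bilin_map (\<lambda>b1 b2. (a2 \<boxtimes> b1) \<boxtimes> (a1 \<boxtimes> b2))"
      "bilin_map (\<lambda>u1 u2. swd H w (\<lambda>v1 v2. flip_map u1 v2 \<boxtimes> flip_map u2 v1))"
      "bilin_map (\<lambda>v1 v2. flip_map a1 v2 \<boxtimes> flip_map a2 v1)"
      for w a1 a2
      by (intro bilin_mapI lin)+
    have scal: "xi h ^ (m - t) * lam (g \<otimes> a [^] t) ^ s * (xi (h \<otimes> a [^] s) ^ t * lam g ^ (j - s)) = ?s"
      if "t \<le> m" "s \<le> j" for t s
    proof -
      have "xi h ^ (m - t) * lam (g \<otimes> a [^] t) ^ s * (xi (h \<otimes> a [^] s) ^ t * lam g ^ (j - s)) =
          (xi h ^ (m - t) * xi h ^ t) * (lam g ^ s * lam g ^ (j - s)) * (lam a * xi a) ^ (t * s)"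
        using G by (simp add: lam_mult lam_pow xi_mult xi_pow power_mult_distrib power_mult[symmetric] mult_ac)
      then show ?thesis
        using that by (simp add: lam_xi_a flip: power_add)
    qed
    have "comul ?T' (flip_map (pbw h j) (pbw g m)) =
        ?s *\<^sub>k swd H (pbw (c g h) m) (\<lambda>a1 a2. swd H (pbw (d h g) j) (\<lambda>b1 b2. (a2 \<boxtimes> b1) \<boxtimes> (a1 \<boxtimes> b2)))"
      using G by (simp add: flip_map_pbw lin_map_simps[OF lin_map_comul[OF lin_coalg_tensor lin_map_ident]]
          comul_tensor_coalg lc swd_cop b)
    also have "\<dots> = (\<Sum>t\<le>m. \<Sum>s\<le>j. (?s * ?K m t * ?K j s) *\<^sub>k ?Y t s)"
      by (subst swd_pbw, simp add: G, rule b(1)) (simp add: G swd_pbw b pm.scale_sum_right mult.assoc)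
    also have "\<dots> = (\<Sum>t\<le>m. \<Sum>s\<le>j. (?K j s * ?K m t) *\<^sub>k
        (flip_map (pbw h s) (pbw (g \<otimes> a [^] t) (m - t)) \<boxtimes> flip_map (pbw (h \<otimes> a [^] s) (j - s)) (pbw g t)))"
    proof (intro sum.cong refl)
      fix t s assume "t \<in> {..m}" "s \<in> {..j}"
      then have ts: "t \<le> m" "s \<le> j" by auto
      have "flip_map (pbw h s) (pbw (g \<otimes> a [^] t) (m - t)) \<boxtimes> flip_map (pbw (h \<otimes> a [^] s) (j - s)) (pbw g t) =
          ?s *\<^sub>k ?Y t s"
        using G by (simp add: flip_map_pbw tens_simps d_a_pow_left d_a_pow_right swap.d_a_pow_left
            swap.d_a_pow_right flip: scal[OF ts])
      then show "(?s * ?K m t * ?K j s) *\<^sub>k ?Y t s = (?K j s * ?K m t) *\<^sub>k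
        (flip_map (pbw h s) (pbw (g \<otimes> a [^] t) (m - t)) \<boxtimes> flip_map (pbw (h \<otimes> a [^] s) (j - s)) (pbw g t))"
        by (simp add: mult_ac)
    qed
    also have "\<dots> = swd H (pbw h j) (\<lambda>u1 u2. swd H (pbw g m) (\<lambda>v1 v2. flip_map u1 v2 \<boxtimes> flip_map u2 v1))"
      by (subst sum.swap, subst swd_pbw, rule G(1), rule b(4)) (simp add: G swd_pbw b pm.scale_sum_right)
    finally show "comul ?T' (flip_map (pbw h j) (pbw g m)) =
        swd H (pbw h j) (\<lambda>u1 u2. swd H (pbw g m) (\<lambda>v1 v2. flip_map u1 v2 \<boxtimes> flip_map u2 v1))" .
  qed (intro lin)+
  show "comul ?T' (tlift flip_map t) = swd ?T t (\<lambda>t1 t2. tlift flip_map t1 \<boxtimes> tlift flip_map t2)" for t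
  proof (rule tensor_ext[where s = pscale and f = "\<lambda>t. comul ?T' (tlift flip_map t)" and
        g = "\<lambda>t. swd ?T t (\<lambda>t1 t2. tlift flip_map t1 \<boxtimes> tlift flip_map t2)"])
    fix u v
    have b: "bilin_map (\<lambda>t1 t2. tlift flip_map t1 \<boxtimes> tlift flip_map t2)"
      "bilin_map (\<lambda>v1 v2. flip_map u1 v1 \<boxtimes> flip_map u2 v2)" for u1 u2
      by (intro bilin_mapI lin lin_map_tlift)+
    show "comul ?T' (tlift flip_map (u \<boxtimes> v)) = swd ?T (u \<boxtimes> v) (\<lambda>t1 t2. tlift flip_map t1 \<boxtimes> tlift flip_map t2)"
      by (simp add: tlift_tens[OF bilin_flip_map] comul swd_tensor_coalg lc b swd_cop)
  qed (intro lin lin_map_tlift)+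
  have forms: "lin_form (counit ?T)" "lin_form (counit ?T')"
    using lin_coalg_tensor by (auto simp: lin_coalg_def)
  show "counit ?T' (tlift flip_map t) = counit ?T t" for t
  proof (rule tensor_ext[where s = "(*)" and f = "\<lambda>t. counit ?T' (tlift flip_map t)" and g = "counit ?T"])
    fix u v
    have "counit ?T' (flip_map u v) = counit H u * counit H v"
    proof (rule pbw_ext2[where s = "(*)" and f = "\<lambda>u v. counit ?T' (flip_map u v)" and f' = "\<lambda>u v. counit H u * counit H v"])
      show "lin_form (\<lambda>u. counit H u * counit H v)" "lin_form (\<lambda>v. counit H u * counit H v)" for u v
        using counit_form by (auto simp: Vector_Spaces.linear_iff algebra_simps)
      fix h j g m assume "h \<in> carrier G" "g \<in> carrier G"
      then show "counit ?T' (flip_map (pbw h j) (pbw g m)) = counit H (pbw h j) * counit H (pbw g m)"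
        by (simp add: flip_map_pbw lin_form_simps[OF forms(2)] counit_tensor_coalg_tens lc counit_cop counit_pbw)
    qed (intro lin_form_compose[OF forms(2)] lin)+
    then show "counit ?T' (tlift flip_map (u \<boxtimes> v)) = counit ?T (u \<boxtimes> v)"
      by (simp add: tlift_tens[OF bilin_flip_map] counit_tensor_coalg_tens lc counit_cop)
  qed (intro lin_form_compose[OF forms(2)] lin_map_tlift forms)+
qed

end

context brace_extension
begin

interpretation swap: brace_extension G \<chi> a \<alpha> H \<iota> x c d xi lam C D
  by (rule brace_extension_swap)

lemma extension_is_hopf_q_brace: "hopf_q_brace H D C"
proof -
  have "q_magma_coalgebra H D C"
    using flip_map_coalg_morphism coalg bilin_D bilin_C
    by (simp add: q_magma_coalgebra_def counit_D swap.counit_D flip_map_def[abs_def])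
  then have "q_cycle_coalgebra H D C"
    unfolding q_cycle_coalgebra_def
    by (intro conjI allI left_regular_D cycle_DD cycle_CD swap.cycle_DD_cop)
  then show ?thesis
    using hopf
    by (simp add: hopf_q_brace_def swap.right_regular_D D_one swap.D_one D_mult swap.D_mult
        D_mult_left swap.D_mult_left)
qed

end

section \<open>The classification\<close>

theorem theorem3p2:
  fixes G :: "('g, 'm) monoid_scheme"
    and \<chi> :: "'g \<Rightarrow> 'k::{alg_closed_field, field_char_0}"
    and a :: 'g and \<alpha> :: 'k
    and H :: "('b, 'k) bialg"
    and \<iota> :: "'g \<Rightarrow> ('b \<Rightarrow>\<^sub>0 'k)"
    and x :: "'b \<Rightarrow>\<^sub>0 'k"
  assumes "datum G \<chi> a \<alpha>"
    and "rank_one_hopf_algebra G \<chi> a \<alpha> H \<iota> x"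
  shows
    "(\<forall>dotH colH.
        hopf_q_brace H dotH colH \<and> dotH x x = 0 \<and> colH x x = 0 \<longrightarrow>
        (\<exists>dot col.
           (\<forall>g\<in>carrier G. \<forall>h\<in>carrier G.
              dotH (\<iota> g) (\<iota> h) = \<iota> (dot g h) \<and> colH (\<iota> g) (\<iota> h) = \<iota> (col g h)) \<and>
           group_q_brace G dot col \<and>
           acts_trivially G a dot col \<and>
           (\<exists>lam xi.
              compatible_characters G \<chi> a dot col lam xi \<and>
              extension_formula G H \<iota> x dot lam dotH \<and>
              extension_formula G H \<iota> x col xi colH)))
     \<and>
     (\<forall>dot col lam xi.
        group_q_brace G dot col \<and>
        acts_trivially G a dot col \<and>
        compatible_characters G \<chi> a dot col lam xi \<longrightarrow>
        (\<forall>dotH colH.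
           bilin_map dotH \<and> bilin_map colH \<and>
           extension_formula G H \<iota> x dot lam dotH \<and>
           extension_formula G H \<iota> x col xi colH \<longrightarrow>
           hopf_q_brace H dotH colH) \<and>
        (formulas_consistent G \<chi> a \<alpha> lam xi \<longrightarrow>
         (\<exists>dotH colH.
            hopf_q_brace H dotH colH \<and>
            extension_formula G H \<iota> x dot lam dotH \<and>
            extension_formula G H \<iota> x col xi colH)))"
proof (intro conjI allI impI; (elim conjE)?)
  interpret rank_one G \<chi> a \<alpha> H \<iota> x
    using assms by unfold_locales
  fix dotH colH
  assume q: "hopf_q_brace H dotH colH" "dotH x x = 0" "colH x x = 0"
  show "\<exists>dot col.
      (\<forall>g\<in>carrier G. \<forall>h\<in>carrier G.
        dotH (\<iota> g) (\<iota> h) = \<iota> (dot g h) \<and> colH (\<iota> g) (\<iota> h) = \<iota> (col g h)) \<and>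
      group_q_brace G dot col \<and> acts_trivially G a dot col \<and>
      (\<exists>lam xi. compatible_characters G \<chi> a dot col lam xi \<and>
        extension_formula G H \<iota> x dot lam dotH \<and> extension_formula G H \<iota> x col xi colH)"
    using hopf_q_brace_restriction[OF q] by blast
next
  fix dot col lam xi
  assume data: "group_q_brace G dot col" "acts_trivially G a dot col"
    "compatible_characters G \<chi> a dot col lam xi"
  interpret brace_data G \<chi> a \<alpha> H \<iota> x dot col lam xi
    using assms data by unfold_locales
  interpret swap: brace_data G \<chi> a \<alpha> H \<iota> x col dot xi lam
    by (rule brace_data_swap)
  have brace: "hopf_q_brace H dotH colH"
    if "bilin_map dotH" "bilin_map colH"
      "extension_formula G H \<iota> x dot lam dotH" "extension_formula G H \<iota> x col xi colH" for dotH colH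
  proof -
    interpret brace_extension G \<chi> a \<alpha> H \<iota> x dot col lam xi dotH colH
      using that by unfold_locales
    show ?thesis by (rule extension_is_hopf_q_brace)
  qed
  then show "hopf_q_brace H dotH colH"
    if "bilin_map dotH" "bilin_map colH"
      "extension_formula G H \<iota> x dot lam dotH" "extension_formula G H \<iota> x col xi colH" for dotH colH
    using that by blast
  assume "formulas_consistent G \<chi> a \<alpha> lam xi"
  then have "lift_trivial G \<chi> a \<alpha> \<or> (\<forall>g\<in>carrier G. lam g ^ n = 1)"
    "lift_trivial G \<chi> a \<alpha> \<or> (\<forall>g\<in>carrier G. xi g ^ n = 1)"
    by (auto simp: formulas_consistent_def)
  with extension_exists swap.extension_exists brace
  show "\<exists>dotH colH. hopf_q_brace H dotH colH \<and>
      extension_formula G H \<iota> x dot lam dotH \<and> extension_formula G H \<iota> x col xi colH"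
    by blast
qed

end
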